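(* Let $\mathbb{G}$ be a Carnot group, $\alpha\ge1$, and let $\psi\in\mathcal{M}_{cc}^\alpha(\mathbb{G})$ be a sub-Finsler convex metric. Then the following hold: i) for a.e. $x\in\mathbb{G}$, $\varphi_{d_\psi}(x,v)\le\psi(x,v)$ for every $v\in H_x\mathbb{G}$. ii) If $\psi$ is upper semicontinuous, then $\varphi_{d_\psi}(x,v)\le\psi(x,v)$ for every $(x,v)\in H\mathbb{G}$. iii) If $\psi$ is lower semicontinuous, then $\varphi_{d_\psi}(x,v)\ge\psi(x,v)$ for every $(x,v)\in H\mathbb{G}$. In particular, for a.e. $x\in\mathbb{G}$ it holds that $\varphi_{d_\psi}(x,v)=\psi(x,v)$ for every $v\in H_x\mathbb{G}$.
   Context: Carnot group: a connected, simply connected Lie group $\mathbb{G}$ with identity $e$ whose Lie algebra $\mathfrak{g}\cong T_e\mathbb{G}$ satisfies $\mathfrak{g}=\mathfrak{g}_1\oplus\dots\oplus\mathfrak{g}_k$, $[\mathfrak{g}_1,\mathfrak{g}_i]=\mathfrak{g}_{i+1}$ for $i<k$, $\mathfrak{g}_k\ne\{0\}$, $[\mathfrak{g}_1,\mathfrak{g}_k]=\{0\}$. $\mathbb{G}$ is identified with $\mathbb{R}^n$ via exponential coordinates; "a.e." refers to Lebesgue measure $\mathcal{L}^n$. $\tau_x(y)=x\cdot y$. The horizontal bundle $H\mathbb{G}$ has fibers $H_x\mathbb{G}=\mathrm{d}_e\tau_x(\mathfrak{g}_1)$; it is identified with $\mathbb{G}\times\mathfrak{g}_1$ via $(x,v)\mapsto(x,\mathrm{d}_x\tau_{x^{-1}}[v])$,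 which gives its topology and Borel $\sigma$-algebra. A scalar product $\langle\cdot,\cdot\rangle_e$ on $\mathfrak{g}_1$ is fixed and $\langle v,w\rangle_x:=\langle \mathrm{d}_x\tau_{x^{-1}}[v],\mathrm{d}_x\tau_{x^{-1}}[w]\rangle_e$, with norm $\|\cdot\|_x$. For $v\in\mathfrak{g}_1$, $t\in\mathbb{R}$: $\delta_t\exp(v)=\exp(tv)$. Horizontal curve: an absolutely continuous curve $\gamma:[a,b]\to\mathbb{G}$ with $\dot\gamma(t)\in H_{\gamma(t)}\mathbb{G}$ for a.e. $t$ and $t\mapsto\|\dot\gamma(t)\|_{\gamma(t)}$ in $L^\infty(a,b)$. $\mathcal{M}_{cc}^\alpha(\mathbb{G})$: Borel maps $\psi:H\mathbb{G}\to[0,+\infty)$ with $\psi(x,\lambda v)=|\lambda|\psi(x,v)$ for $\lambda\in\mathbb{R}$ and $\frac1\alpha\|v\|_x\le\psi(x,v)\le\alpha\|v\|_x$ for all $(x,v)\in H\mathbb{G}$. Such $\psi$ is a sub-Finsler convex metric if moreover $\psi(x,v_1+v_2)\le\psi(x,v_1)+\psi(x,v_2)$ for all $x\in\mathbb{G}$, $v_1,v_2\in H_x\mathbb{G}$. Intrinsic distance: $d_\psi(x,y):=\inf_\gamma\int_0^1\psi(\gamma(t),\dot\gamma(t))\,\mathrm{d}t$ over horizontal curves $\gamma:[0,1]\to\mathbb{G}$ joining $x$ and $y$. Metric derivative of a distance $d$ on $\mathbb{G}$: $\varphi_d(x,v):=\limsup_{t\to0}\frac{d(x,\,x\cdot\delta_t\exp(\mathrm{d}_x\tau_{x^{-1}}[v]))}{|t|}$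 for $(x,v)\in H\mathbb{G}$. *)

theory Defs
  imports "HOL-Analysis.Analysis"
begin

section \<open>Smooth maps between normed spaces\<close>

text \<open>
  In finite dimension, \<open>f\<close> is of class \<open>C\<^sup>m\<^sup>+\<^sup>1\<close> iff it is differentiable and all its directional
  derivatives are of class \<open>C\<^sup>m\<close>.
\<close>

fun C_k :: "nat \<Rightarrow> ('a::real_normed_vector \<Rightarrow> 'b::real_normed_vector) \<Rightarrow> bool" where
  "C_k 0 f \<longleftrightarrow> continuous_on UNIV f"
| "C_k (Suc m) f \<longleftrightarrow>
     (\<forall>x. f differentiable (at x)) \<and> (\<forall>v. C_k m (\<lambda>x. frechet_derivative f (at x) v))"

definition smooth :: "('a::real_normed_vector \<Rightarrow> 'b::real_normed_vector) \<Rightarrow> bool" where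
  "smooth f \<longleftrightarrow> (\<forall>m. C_k m f)"

section \<open>Carnot groups in exponential coordinates\<close>

text \<open>
  The group is identified with its Lie algebra \<open>'a\<close> through exponential coordinates, so that the
  carrier is the whole Euclidean space \<open>'a\<close> (in particular it is connected and simply connected),
  the identity is \<open>0\<close>, and the Lie algebra \<open>T\<^sub>0 'a\<close> is \<open>'a\<close> itself.  \<open>layer G i\<close> is the \<open>i\<close>-th layer
  (\<open>1 \<le> i \<le> step G\<close>) of the stratification and \<open>hinner G\<close> the scalar product on the first layer;
  the values of \<open>layer G\<close> outside \<open>{1..step G}\<close> and of \<open>hinner G\<close> outside the first layer are
  irrelevant.
\<close>

record 'a carnot =
  gmult :: "'a \<Rightarrow> 'a \<Rightarrow> 'a"
  ginv :: "'a \<Rightarrow> 'a"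
  layer :: "nat \<Rightarrow> 'a set"
  step :: nat
  hinner :: "'a \<Rightarrow> 'a \<Rightarrow> real"

text \<open>\<open>dtau G x y\<close> is the differential at \<open>y\<close> of the left translation by \<open>x\<close>.\<close>

definition dtau :: "'a::euclidean_space carnot \<Rightarrow> 'a \<Rightarrow> 'a \<Rightarrow> 'a \<Rightarrow> 'a" where
  "dtau G x y = frechet_derivative (gmult G x) (at y)"

definition left_invariant_field :: "'a::euclidean_space carnot \<Rightarrow> 'a \<Rightarrow> 'a \<Rightarrow> 'a" where
  "left_invariant_field G v x = dtau G x 0 v"

definition vector_field_bracket ::
    "('a::euclidean_space \<Rightarrow> 'a) \<Rightarrow> ('a \<Rightarrow> 'a) \<Rightarrow> 'a \<Rightarrow> 'a" where
  "vector_field_bracket X Y x =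
     frechet_derivative Y (at x) (X x) - frechet_derivative X (at x) (Y x)"

definition lie_bracket :: "'a::euclidean_space carnot \<Rightarrow> 'a \<Rightarrow> 'a \<Rightarrow> 'a" where
  "lie_bracket G v w =
     vector_field_bracket (left_invariant_field G v) (left_invariant_field G w) 0"

definition one_parameter_subgroup ::
    "'a::euclidean_space carnot \<Rightarrow> (real \<Rightarrow> 'a) \<Rightarrow> 'a \<Rightarrow> bool" where
  "one_parameter_subgroup G \<gamma> v \<longleftrightarrow>
     (\<forall>s t. \<gamma> (s + t) = gmult G (\<gamma> s) (\<gamma> t)) \<and> (\<gamma> has_vector_derivative v) (at 0)"

definition lie_exp :: "'a::euclidean_space carnot \<Rightarrow> 'a \<Rightarrow> 'a" where
  "lie_exp G v = (THE p. \<exists>\<gamma>. one_parameter_subgroup G \<gamma> v \<and> p = \<gamma> 1)"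

text \<open>
  The axiom \<open>exp_coords\<close> says that the coordinates are exponential, i.e. that the exponential map
  is the identity (see \<open>lie_exp_eq\<close> below).  In \<open>bracket_layer\<close>, \<open>[V, W]\<close> is, as usual, the linear
  span of the brackets of elements of \<open>V\<close> and \<open>W\<close>.
\<close>

locale carnot_group =
  fixes G :: "'a::euclidean_space carnot"
  assumes grp: "group (gmult G) 0 (ginv G)"
    and smooth_mult: "smooth (\<lambda>(x, y). gmult G x y)"
    and smooth_inv: "smooth (ginv G)"
    and exp_coords: "\<And>v. one_parameter_subgroup G (\<lambda>t. t *\<^sub>R v) v"
    and step_pos: "step G \<ge> 1"
    and layer_subspace: "\<And>i. i \<in> {1..step G} \<Longrightarrow> subspace (layer G i)"
    and direct_sum:
      "\<And>x. \<exists>!f. f \<in> (\<Pi>\<^sub>E i\<in>{1..step G}. layer G i) \<and> x = (\<Sum>i=1..step G. f i)"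
    and bracket_layer: "\<And>i. 1 \<le> i \<Longrightarrow> i < step G \<Longrightarrow>
      span {lie_bracket G v w |v w. v \<in> layer G 1 \<and> w \<in> layer G i} = layer G (Suc i)"
    and last_layer: "layer G (step G) \<noteq> {0}"
    and bracket_last: "\<And>v w. v \<in> layer G 1 \<Longrightarrow> w \<in> layer G (step G) \<Longrightarrow> lie_bracket G v w = 0"
    and hinner_add: "\<And>u v w. u \<in> layer G 1 \<Longrightarrow> v \<in> layer G 1 \<Longrightarrow> w \<in> layer G 1 \<Longrightarrow>
      hinner G (u + v) w = hinner G u w + hinner G v w"
    and hinner_scale: "\<And>c u v. u \<in> layer G 1 \<Longrightarrow> v \<in> layer G 1 \<Longrightarrow>
      hinner G (c *\<^sub>R u) v = c * hinner G u v"
    and hinner_sym: "\<And>u v. u \<in> layer G 1 \<Longrightarrow> v \<in> layer G 1 \<Longrightarrow> hinner G u v = hinner G v u"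
    and hinner_pos: "\<And>u. u \<in> layer G 1 \<Longrightarrow> u \<noteq> 0 \<Longrightarrow> hinner G u u > 0"

section \<open>The horizontal bundle\<close>

definition hfiber :: "'a::euclidean_space carnot \<Rightarrow> 'a \<Rightarrow> 'a set" where
  "hfiber G x = dtau G x 0 ` layer G 1"

definition hbundle :: "'a::euclidean_space carnot \<Rightarrow> ('a \<times> 'a) set" where
  "hbundle G = (SIGMA x:UNIV. hfiber G x)"

definition to_layer :: "'a::euclidean_space carnot \<Rightarrow> 'a \<Rightarrow> 'a \<Rightarrow> 'a" where
  "to_layer G x v = dtau G (ginv G x) x v"

definition hbundle_topology :: "'a::euclidean_space carnot \<Rightarrow> ('a \<times> 'a) topology" where
  "hbundle_topology G =
     pullback_topology (hbundle G) (\<lambda>(x, v). (x, to_layer G x v))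
       (prod_topology euclidean (top_of_set (layer G 1)))"

definition hbundle_borel :: "'a::euclidean_space carnot \<Rightarrow> ('a \<times> 'a) measure" where
  "hbundle_borel G = sigma (hbundle G) {U. openin (hbundle_topology G) U}"

definition hnorm :: "'a::euclidean_space carnot \<Rightarrow> 'a \<Rightarrow> 'a \<Rightarrow> real" where
  "hnorm G x v = sqrt (hinner G (to_layer G x v) (to_layer G x v))"

section \<open>Sub-Finsler metrics\<close>

definition metric_class ::
    "'a::euclidean_space carnot \<Rightarrow> real \<Rightarrow> ('a \<times> 'a \<Rightarrow> real) set" where
  "metric_class G \<alpha> = {\<psi>.
     \<psi> \<in> borel_measurable (hbundle_borel G) \<and>
     (\<forall>(x, v)\<in>hbundle G. 0 \<le> \<psi> (x, v)) \<and>
     (\<forall>(x, v)\<in>hbundle G. \<forall>c. \<psi> (x, c *\<^sub>R v) = \<bar>c\<bar> * \<psi> (x, v)) \<and>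
     (\<forall>(x, v)\<in>hbundle G. 1 / \<alpha> * hnorm G x v \<le> \<psi> (x, v) \<and> \<psi> (x, v) \<le> \<alpha> * hnorm G x v)}"

definition subfinsler_convex ::
    "'a::euclidean_space carnot \<Rightarrow> real \<Rightarrow> ('a \<times> 'a \<Rightarrow> real) \<Rightarrow> bool" where
  "subfinsler_convex G \<alpha> \<psi> \<longleftrightarrow> \<psi> \<in> metric_class G \<alpha> \<and>
     (\<forall>x. \<forall>v\<in>hfiber G x. \<forall>w\<in>hfiber G x. \<psi> (x, v + w) \<le> \<psi> (x, v) + \<psi> (x, w))"

definition upper_semicontinuous_map :: "'b topology \<Rightarrow> ('b \<Rightarrow> real) \<Rightarrow> bool" where
  "upper_semicontinuous_map T f \<longleftrightarrow> (\<forall>c. openin T {p \<in> topspace T. f p < c})"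

definition lower_semicontinuous_map :: "'b topology \<Rightarrow> ('b \<Rightarrow> real) \<Rightarrow> bool" where
  "lower_semicontinuous_map T f \<longleftrightarrow> (\<forall>c. openin T {p \<in> topspace T. f p > c})"

section \<open>Horizontal curves and intrinsic distance\<close>

definition absolutely_continuous_curve ::
    "real \<Rightarrow> real \<Rightarrow> (real \<Rightarrow> 'a::euclidean_space) \<Rightarrow> bool" where
  "absolutely_continuous_curve a b \<gamma> \<longleftrightarrow>
     (\<forall>\<epsilon>>0. \<exists>\<delta>>0. \<forall>(n::nat) u v.
        (\<forall>i<n. a \<le> u i \<and> u i \<le> v i \<and> v i \<le> b) \<and>
        disjoint_family_on (\<lambda>i. {u i<..<v i}) {..<n} \<and> (\<Sum>i<n. v i - u i) < \<delta> \<longrightarrow>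
        (\<Sum>i<n. norm (\<gamma> (v i) - \<gamma> (u i))) < \<epsilon>)"

abbreviation velocity :: "real \<Rightarrow> real \<Rightarrow> (real \<Rightarrow> 'a::euclidean_space) \<Rightarrow> real \<Rightarrow> 'a" where
  "velocity a b \<gamma> t \<equiv> vector_derivative \<gamma> (at t within {a..b})"

text \<open>
  The velocity is meaningful only at points of differentiability.  An absolutely continuous curve
  is differentiable almost everywhere; this is made explicit in the second conjunct.  The last two
  conjuncts say that the speed is in \<open>L\<^sup>\<infinity>(a, b)\<close>.
\<close>

definition horizontal_curve ::
    "'a::euclidean_space carnot \<Rightarrow> real \<Rightarrow> real \<Rightarrow> (real \<Rightarrow> 'a) \<Rightarrow> bool" where
  "horizontal_curve G a b \<gamma> \<longleftrightarrow>
     absolutely_continuous_curve a b \<gamma> \<and>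
     (AE t in lebesgue_on {a..b}.
        \<gamma> differentiable (at t within {a..b}) \<and> velocity a b \<gamma> t \<in> hfiber G (\<gamma> t)) \<and>
     (\<lambda>t. hnorm G (\<gamma> t) (velocity a b \<gamma> t)) \<in> borel_measurable (lebesgue_on {a..b}) \<and>
     (\<exists>C. AE t in lebesgue_on {a..b}. hnorm G (\<gamma> t) (velocity a b \<gamma> t) \<le> C)"

text \<open>
  Distances take values in \<open>[0, \<infinity>]\<close>, so that the infimum over an empty set of curves is \<open>\<infinity>\<close> and
  the limes superior below always exists.
\<close>

definition intrinsic_distance ::
    "'a::euclidean_space carnot \<Rightarrow> ('a \<times> 'a \<Rightarrow> real) \<Rightarrow> 'a \<Rightarrow> 'a \<Rightarrow> ennreal" where
  "intrinsic_distance G \<psi> x y =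
     (INF \<gamma>\<in>{\<gamma>. horizontal_curve G 0 1 \<gamma> \<and> \<gamma> 0 = x \<and> \<gamma> 1 = y}.
        \<integral>\<^sup>+t. ennreal (\<psi> (\<gamma> t, velocity 0 1 \<gamma> t)) \<partial>lebesgue_on {0..1})"

text \<open>For \<open>w\<close> in the first layer, the dilation of \<open>exp w\<close> by \<open>t\<close> is \<open>exp (t w)\<close>.\<close>

definition metric_derivative ::
    "'a::euclidean_space carnot \<Rightarrow> ('a \<Rightarrow> 'a \<Rightarrow> ennreal) \<Rightarrow> 'a \<times> 'a \<Rightarrow> ennreal" where
  "metric_derivative G d = (\<lambda>(x, v).
     Limsup (at (0::real))
       (\<lambda>t. d x (gmult G x (lie_exp G (t *\<^sub>R to_layer G x v))) / ennreal \<bar>t\<bar>))"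

section \<open>Basic consequences\<close>

context carnot_group
begin

interpretation gr: group "gmult G" 0 "ginv G" by (rule grp)

lemma mult_differentiable: "(\<lambda>(x, y). gmult G x y) differentiable (at p)"
proof -
  have "C_k (Suc 0) (\<lambda>(x, y). gmult G x y)"
    using smooth_mult unfolding smooth_def by blast
  then show ?thesis unfolding C_k.simps by blast
qed

lemma left_translation_has_derivative: "(gmult G x has_derivative dtau G x y) (at y)"
proof -
  have "(\<lambda>y. (\<lambda>(x, y). gmult G x y) (x, y)) differentiable (at y)"
    by (rule differentiable_compose[of "\<lambda>(x, y). gmult G x y" "\<lambda>y. (x, y)",
          OF mult_differentiable])
       (auto intro!: derivative_eq_intros exI simp: differentiable_def)
  then show ?thesis
    unfolding dtau_def by (simp add: frechet_derivative_works[symmetric])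
qed

lemma right_translation_differentiable: "(\<lambda>x. gmult G x y) differentiable (at x)"
proof -
  have "(\<lambda>x. (\<lambda>(x, y). gmult G x y) (x, y)) differentiable (at x)"
    by (rule differentiable_compose[of "\<lambda>(x, y). gmult G x y" "\<lambda>x. (x, y)",
          OF mult_differentiable])
       (auto intro!: derivative_eq_intros exI simp: differentiable_def)
  then show ?thesis by simp
qed

lemma to_layer_dtau: "to_layer G x (dtau G x 0 w) = w"
proof -
  have x0: "gmult G x 0 = x" by simp
  have "((\<lambda>y. gmult G (ginv G x) (gmult G x y)) has_derivative
      (\<lambda>w. dtau G (ginv G x) x (dtau G x 0 w))) (at 0)"
    using has_derivative_compose[OF left_translation_has_derivative[of x 0],
        of "gmult G (ginv G x)" "dtau G (ginv G x) x"]
      left_translation_has_derivative[of "ginv G x" x] by (simp add: x0)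
  moreover have "(\<lambda>y. gmult G (ginv G x) (gmult G x y)) = (\<lambda>y. y)"
    by (simp add: gr.assoc[symmetric])
  ultimately have "((\<lambda>y. y) has_derivative (\<lambda>w. dtau G (ginv G x) x (dtau G x 0 w))) (at 0)"
    by simp
  then have "(\<lambda>w. dtau G (ginv G x) x (dtau G x 0 w)) = (\<lambda>w. w)"
    using has_derivative_ident has_derivative_unique by blast
  then show ?thesis by (simp add: to_layer_def fun_eq_iff)
qed

lemma topspace_hbundle: "topspace (hbundle_topology G) = hbundle G"
  by (auto simp: hbundle_topology_def topspace_pullback_topology hbundle_def hfiber_def
      to_layer_dtau)

lemma one_parameter_subgroup_unique:
  assumes "one_parameter_subgroup G \<gamma> v"
  shows "\<gamma> t = t *\<^sub>R v"
proof -
  have hom: "\<gamma> (s + t) = gmult G (\<gamma> s) (\<gamma> t)" for s t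
    using assms by (auto simp: one_parameter_subgroup_def)
  have der: "(\<gamma> has_vector_derivative v) (at 0)"
    using assms by (auto simp: one_parameter_subgroup_def)
  have lin: "gmult G (s *\<^sub>R v) (t *\<^sub>R v) = (s + t) *\<^sub>R v" for s t
    using exp_coords[of v] by (simp add: one_parameter_subgroup_def)
  have g0: "\<gamma> 0 = 0"
    using hom[of 0 0] by (simp, metis gr.left_cancel gr.right_neutral)
  define f where "f s = gmult G (\<gamma> s) ((- s) *\<^sub>R v)" for s
  define M where "M = (\<lambda>(x, y). gmult G x y)"
  obtain M' where M': "(M has_derivative M') (at (0, 0))"
    using mult_differentiable[of "(0, 0)"] unfolding M_def differentiable_def by blast
  interpret M': bounded_linear M' using M' by (rule has_derivative_bounded_linear)
  have pairder: "((\<lambda>s. (\<gamma> s, (- s) *\<^sub>R v)) has_derivative (\<lambda>h. (h *\<^sub>R v, (- h) *\<^sub>R v))) (at 0)"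
    using der unfolding has_vector_derivative_def by (auto intro!: derivative_eq_intros)
  have "((\<lambda>s. M (\<gamma> s, (- s) *\<^sub>R v)) has_derivative (\<lambda>h. M' (h *\<^sub>R v, (- h) *\<^sub>R v))) (at 0)"
    using has_derivative_compose[OF pairder, of M M'] M' by (simp add: g0)
  moreover have "M' (h *\<^sub>R v, (- h) *\<^sub>R v) = 0" for h
  proof -
    have "((\<lambda>s. (s *\<^sub>R v, (- s) *\<^sub>R v)) has_derivative (\<lambda>h. (h *\<^sub>R v, (- h) *\<^sub>R v))) (at (0::real))"
      by (auto intro!: derivative_eq_intros)
    from has_derivative_compose[OF this, of M M'] M'
    have "((\<lambda>s. M (s *\<^sub>R v, (- s) *\<^sub>R v)) has_derivative (\<lambda>h. M' (h *\<^sub>R v, (- h) *\<^sub>R v))) (at (0::real))"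
      by simp
    moreover have "(\<lambda>s. M (s *\<^sub>R v, (- s) *\<^sub>R v)) = (\<lambda>s. 0)"
      unfolding M_def using lin[of s "- s" for s] by (simp add: fun_eq_iff)
    ultimately have "((\<lambda>s::real. 0::'a) has_derivative (\<lambda>h. M' (h *\<^sub>R v, (- h) *\<^sub>R v))) (at 0)"
      by simp
    then have "(\<lambda>h. M' (h *\<^sub>R v, (- h) *\<^sub>R v)) = (\<lambda>h. 0)"
      using has_derivative_const has_derivative_unique by blast
    then show ?thesis by (simp add: fun_eq_iff)
  qed
  ultimately have f0: "(f has_derivative (\<lambda>h. 0)) (at 0)"
    by (simp add: f_def[abs_def] M_def)
  have f_0: "f 0 = 0" by (simp add: f_def g0)
  have "(f has_derivative (\<lambda>h. 0)) (at s)" for s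
  proof -
    define R where "R = (\<lambda>x. gmult G x ((- s) *\<^sub>R v))"
    obtain R' where R': "(R has_derivative R') (at (\<gamma> s))"
      using right_translation_differentiable unfolding R_def differentiable_def by blast
    interpret L: bounded_linear "dtau G (\<gamma> s) 0"
      using left_translation_has_derivative by (rule has_derivative_bounded_linear)
    interpret R: bounded_linear R' using R' by (rule has_derivative_bounded_linear)
    have feq: "f t = R (gmult G (\<gamma> s) (f (t - s)))" for t
    proof -
      have "gmult G ((- (t - s)) *\<^sub>R v) ((- s) *\<^sub>R v) = (- t) *\<^sub>R v"
        by (subst lin) simp
      moreover have "\<gamma> t = gmult G (\<gamma> s) (\<gamma> (t - s))"
        using hom[of s "t - s"] by simp
      ultimately show ?thesis unfolding f_def R_def by (simp add: gr.assoc)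
    qed
    have sh: "((\<lambda>t. t - s) has_derivative (\<lambda>h. h)) (at s)"
      by (auto intro!: derivative_eq_intros)
    have "((\<lambda>t. f (t - s)) has_derivative (\<lambda>h. 0)) (at s)"
      using has_derivative_compose[OF sh, of f "\<lambda>h. 0"] f0 by simp
    from has_derivative_compose[OF this, of "gmult G (\<gamma> s)" "dtau G (\<gamma> s) 0"]
    have "((\<lambda>t. gmult G (\<gamma> s) (f (t - s))) has_derivative (\<lambda>h. 0)) (at s)"
      using left_translation_has_derivative[of "\<gamma> s" 0] by (simp add: f_0 L.zero)
    from has_derivative_compose[OF this, of R R'] R'
    have "((\<lambda>t. R (gmult G (\<gamma> s) (f (t - s)))) has_derivative (\<lambda>h. 0)) (at s)"
      by (simp add: f_0 R.zero)
    moreover have "f = (\<lambda>t. R (gmult G (\<gamma> s) (f (t - s))))"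
      using feq by (rule ext)
    ultimately show ?thesis by simp
  qed
  then have "f t = f 0"
    using has_derivative_zero_unique[of UNIV f t 0] by simp
  then have "gmult G (gmult G (\<gamma> t) ((- t) *\<^sub>R v)) (t *\<^sub>R v) = t *\<^sub>R v"
    using f_0 by (simp add: f_def)
  then show ?thesis
    using lin[of "- t" t] by (simp add: gr.assoc)
qed

lemma lie_exp_eq: "lie_exp G v = v"
  unfolding lie_exp_def
proof (rule the_equality)
  show "\<exists>\<gamma>. one_parameter_subgroup G \<gamma> v \<and> v = \<gamma> 1"
    using exp_coords[of v] by (intro exI[of _ "\<lambda>t. t *\<^sub>R v"]) simp
qed (use one_parameter_subgroup_unique in force)

end

end

theory Submission
  imports Defs
begin

text \<open>
  Left translation turns \<open>\<psi>\<close> into a function \<open>\<Psi> x w\<close> of a point and a vector \<open>w\<close> of the first layer.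
  Along the ray \<open>s \<mapsto> x exp (s w)\<close> the length functional is an integral of \<open>\<Psi> (x exp (s w)) w\<close>, so upper
  semicontinuity, or Lebesgue differentiation along the ray, bounds the metric derivative by
  \<open>\<Psi> x w\<close>; Fubini and the smoothness of right translations make the exceptional set of \<open>x\<close> null
  for each \<open>w\<close>.  A countable dense set of directions suffices: \<open>x exp (t w)\<close> and \<open>x exp (t w')\<close> differ by
  the dilation by \<open>t\<close> of \<open>exp (- w) exp w'\<close>, and the identity has neighbourhoods that are joined to it by
  horizontal paths of arbitrarily small length.  For the lower bound, near \<open>x\<close> lower semicontinuity and
  compactness of the unit sphere bound \<open>\<psi>\<close> from below by \<open>1 / (1 + \<epsilon>)\<close> times the fixed sublinear function
  \<open>frozen x\<close>, for which the length of a curve dominates the value at its increment.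

  That dilations are automorphisms rests on one remark: in exponential coordinates every
  differentiable automorphism, in particular every conjugation, is linear.
\<close>

section \<open>Real analysis\<close>

text \<open>Nearby rays separate at a Euclidean rate proportional to \<open>t\<close>, and Euclidean
  closeness alone does not bound the horizontal distance linearly. Dilations, being automorphisms,
  carry the comparison to scale one, where it suffices that a neighbourhood of the identity is
  reached by short paths, at whatever rate. Accessibility is therefore proved qualitatively, through
  a continuous map whose derivative at one point is invertible.

  In the lower bound the obstacle is a competing curve that wanders far from \<open>x\<close>, where
  nothing relates \<open>\<psi>\<close> to \<open>frozen x\<close>. When it first leaves a small
  ball it has already paid a fixed positive amount, which exceeds any given multiple of
  \<open>t\<close> once \<open>t\<close> is small. As curves are merely absolutely continuous and
  \<open>frozen x\<close> is merely sublinear, the increment is written as a gauge integral of the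
  velocity, and Jensen's inequality is obtained on Riemann sums.

  Convexity enters in both directions: it lets a dense set of directions control the others, and it
  is what Jensen's inequality uses.\<close>

lemma lmeasurable_outer_open:
  assumes "S \<in> lmeasurable" "0 < e"
  obtains T where "open T" "S \<subseteq> T" "T \<in> lmeasurable" "measure lebesgue (T - S) < e"
proof -
  from assms obtain T where T: "open T" "S \<subseteq> T" "(T - S) \<in> lmeasurable" "emeasure lebesgue (T - S) < ennreal e"
    using sets_lebesgue_outer_open[of S e] by blast
  have "T = S \<union> (T - S)" using T by blast
  then have "T \<in> lmeasurable" using T assms(1) by (metis fmeasurable.Un)
  moreover have "measure lebesgue (T - S) < e"
    using T(4) assms(2) by (simp add: emeasure_eq_measure2[OF T(3)] ennreal_less_iff)
  ultimately show ?thesis using that T by blast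
qed

subsection \<open>The fundamental theorem of calculus for absolutely continuous curves\<close>

text \<open>A Henstock argument. Tags off \<open>N\<close> obey the straddle estimate for the
  derivative; tags in \<open>N\<close> belong to intervals inside an open set of small measure,
  where absolute continuity makes the increments of \<open>f\<close> small. The gauge integral fits
  because integrability of \<open>f'\<close> is part of the conclusion.\<close>

lemma absolutely_continuous_curve_imp_has_integral:
  fixes f :: "real \<Rightarrow> 'a::euclidean_space"
  assumes ac: "absolutely_continuous_curve a b f" and "a \<le> b" and N: "negligible N"
    and der: "\<And>x. x \<in> {a..b} - N \<Longrightarrow> (f has_vector_derivative f' x) (at x within {a..b})"
  shows "(f' has_integral f b - f a) {a..b}"
proof -
  \<comment> \<open>Zero on \<open>N\<close> leaves only an increment of \<open>f\<close> as the
    error of an interval tagged in \<open>N\<close>.\<close>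
  define g where "g x = (if x \<in> N then 0 else f' x)" for x
  have "(g has_integral f b - f a) (cbox a b)"
    unfolding has_integral
  proof (intro allI impI)
    fix e :: real assume "e > 0"
    then obtain \<delta> where "\<delta> > 0" and \<delta>: "\<And>(n::nat) u v. (\<forall>i<n. a \<le> u i \<and> u i \<le> v i \<and> v i \<le> b) \<Longrightarrow>
        disjoint_family_on (\<lambda>i. {u i<..<v i}) {..<n} \<Longrightarrow> (\<Sum>i<n. v i - u i) < \<delta> \<Longrightarrow>
        (\<Sum>i<n. norm (f (v i) - f (u i))) < e / 2"
      using ac[unfolded absolutely_continuous_curve_def, rule_format, of "e / 2"] by auto
    have "N \<in> lmeasurable" "measure lebesgue N = 0"
      using N negligible_iff_measure by blast+
    with lmeasurable_outer_open[OF this(1) \<open>\<delta> > 0\<close>]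
    obtain U where U: "open U" "N \<subseteq> U" "U \<in> lmeasurable" "measure lebesgue (U - N) < \<delta>"
      by auto
    have "measure lebesgue U = measure lebesgue (U - N)"
      using measure_Diff_null_set[of U lebesgue N] N U(3) by (simp add: negligible_iff_null_sets fmeasurableD)
    with U(4) have U4: "measure lebesgue U < \<delta>" by simp
    \<comment> \<open>The total straddle error is \<open>e' * (b - a)\<close>, below
      \<open>e / 2\<close>; the \<open>+ 1\<close> covers \<open>a = b\<close>.\<close>
    define e' where "e' = e / (2 * (b - a + 1))"
    have "e' > 0" using \<open>e > 0\<close> \<open>a \<le> b\<close> by (simp add: e'_def)
    have "\<forall>x. \<exists>d>0. x \<in> {a..b} - N \<longrightarrow>
         (\<forall>y\<in>{a..b}. norm (y-x) < d \<longrightarrow> norm (f y - f x - (y-x) *\<^sub>R f' x) \<le> e' * norm (y-x))"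
      using der[unfolded has_vector_derivative_def has_derivative_within_alt] \<open>e' > 0\<close>
      by (metis zero_less_one)
    then obtain d where d: "\<And>x. 0 < d x"
       "\<And>x y. \<lbrakk>x \<in> {a..b} - N; y \<in> {a..b}; norm (y-x) < d x\<rbrakk>
          \<Longrightarrow> norm (f y - f x - (y-x) *\<^sub>R f' x) \<le> e' * norm (y-x)"
      by metis
    define \<gamma> where "\<gamma> x = (if x \<in> N then U else ball x (d x))" for x
    show "\<exists>\<gamma>. gauge \<gamma> \<and> (\<forall>\<D>. \<D> tagged_division_of cbox a b \<and> \<gamma> fine \<D> \<longrightarrow>
            norm ((\<Sum>(x, k)\<in>\<D>. measure lborel k *\<^sub>R g x) - (f b - f a)) < e)"
    proof (intro exI[of _ \<gamma>] conjI allI impI)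
      show "gauge \<gamma>" using U d by (auto simp: gauge_def \<gamma>_def)
      fix p assume "p tagged_division_of cbox a b \<and> \<gamma> fine p"
      then have p: "p tagged_division_of cbox a b" and fine: "\<gamma> fine p" by auto
      have finp: "finite p" using p by blast
      have K: "K = {Inf K..Sup K}" "x \<in> K" "Inf K \<le> Sup K" "a \<le> Inf K" "Sup K \<le> b"
        if xK: "(x, K) \<in> p" for x K
      proof -
        obtain u v where uv: "K = cbox u v" "x \<in> K" "K \<subseteq> cbox a b"
          using tagged_division_ofD(2)[OF p xK] tagged_division_ofD(3)[OF p xK]
            tagged_division_ofD(4)[OF p xK] by blast
        then have "u \<le> v" by auto
        with uv show "K = {Inf K..Sup K}" "x \<in> K" "Inf K \<le> Sup K" "a \<le> Inf K" "Sup K \<le> b" by auto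
      qed
      have cont: "measure lborel K = Sup K - Inf K" if "(x, K) \<in> p" for x K
        using K(1,3)[OF that] by (metis content_real)
      define p1 p2 where "p1 = {z\<in>p. fst z \<in> N}" and "p2 = {z\<in>p. fst z \<notin> N}"
      have fin12: "finite p1" "finite p2" and p12: "p = p1 \<union> p2" "p1 \<inter> p2 = {}"
        using finp by (auto simp: p1_def p2_def)
      define \<Delta> where "\<Delta> K = f (Sup K) - f (Inf K)" for K
      have "norm (\<Sum>z\<in>p2. measure lborel (snd z) *\<^sub>R g (fst z) - \<Delta> (snd z)) \<le> (\<Sum>z\<in>p2. e' * measure lborel (snd z))"
      proof (rule sum_norm_le)
        fix z assume z: "z \<in> p2"
        obtain x K where xK: "z = (x, K)" by (cases z)
        with z have in_p: "(x, K) \<in> p" and xN: "x \<notin> N" by (auto simp: p2_def)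
        define u v where "u = Inf K" and "v = Sup K"
        have uv: "K = {u..v}" "x \<in> {u..v}" "u \<le> v" "a \<le> u" "v \<le> b"
          using K[OF in_p] by (auto simp: u_def v_def)
        have "K \<subseteq> ball x (d x)" using fineD[OF fine in_p] xN by (simp add: \<gamma>_def)
        then have near: "norm (u - x) < d x" "norm (v - x) < d x"
          using uv subsetD[OF _, of K "ball x (d x)" u] subsetD[OF _, of K "ball x (d x)" v]
          by (auto simp: dist_real_def abs_minus_commute)
        \<comment> \<open>Splitting at the tag gives two errors whose weights add up to the length
          of \<open>K\<close>, since the tag lies between the endpoints.\<close>
        have "measure lborel K *\<^sub>R g x - \<Delta> K = (f u - f x - (u - x) *\<^sub>R f' x) - (f v - f x - (v - x) *\<^sub>R f' x)"
          using uv xN cont[OF in_p] by (simp add: g_def \<Delta>_def u_def[symmetric] v_def[symmetric] algebra_simps)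
        also have "norm \<dots> \<le> e' * norm (u - x) + e' * norm (v - x)"
          by (rule order_trans[OF norm_triangle_ineq4 add_mono]; rule d(2)) (use near uv xN in auto)
        also have "\<dots> = e' * measure lborel K"
          using uv cont[OF in_p] by (simp add: u_def[symmetric] v_def[symmetric] algebra_simps)
        finally show "norm (measure lborel (snd z) *\<^sub>R g (fst z) - \<Delta> (snd z)) \<le> e' * measure lborel (snd z)"
          by (simp add: xK)
      qed
      also have "\<dots> \<le> (\<Sum>z\<in>p. e' * measure lborel (snd z))"
        using finp \<open>e' > 0\<close> by (intro sum_mono2) (auto simp: p2_def)
      also have "\<dots> = e' * (b - a)"
        using additive_content_tagged_division[OF p] \<open>a \<le> b\<close>
        by (simp add: sum_distrib_left[symmetric] case_prod_unfold)
      also have "\<dots> < e / 2"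
      proof -
        have "e' * (b - a) < e' * (b - a + 1)" using \<open>e' > 0\<close> by simp
        also have "\<dots> = e / 2" using \<open>a \<le> b\<close> by (simp add: e'_def field_simps)
        finally show ?thesis .
      qed
      finally have sum2: "norm (\<Sum>z\<in>p2. measure lborel (snd z) *\<^sub>R g (fst z) - \<Delta> (snd z)) < e / 2" .
      have sum1: "(\<Sum>z\<in>p1. norm (\<Delta> (snd z))) < e / 2"
      proof -
        define n where "n = card p1"
        obtain h where h: "bij_betw h {0..<n} p1"
          using ex_bij_betw_nat_finite[OF fin12(1)] n_def by blast
        define u v where "u i = Inf (snd (h i))" and "v i = Sup (snd (h i))" for i
        have hp: "h i \<in> p1" "(fst (h i), snd (h i)) \<in> p" if "i < n" for i
          using bij_betwE[OF h] that by (auto simp: p1_def)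
        have disj: "disjoint_family_on (\<lambda>i. {u i<..<v i}) {..<n}"
          unfolding disjoint_family_on_def
        proof (intro ballI impI)
          fix i j assume ij: "i \<in> {..<n}" "j \<in> {..<n}" "i \<noteq> j"
          then have "h i \<noteq> h j" using h by (auto simp: bij_betw_def inj_on_def)
          then have "interior (snd (h i)) \<inter> interior (snd (h j)) = {}"
            using tagged_division_ofD(5)[OF p hp(2) hp(2)] ij by (metis lessThan_iff prod.collapse)
          moreover have "interior (snd (h k)) = {u k<..<v k}" if "k < n" for k
            using K(1)[OF hp(2)[OF that]] interior_atLeastAtMost_real unfolding u_def v_def by metis
          ultimately show "{u i<..<v i} \<inter> {u j<..<v j} = {}" using ij by auto
        qed
        have "(\<Sum>i<n. v i - u i) = (\<Sum>i<n. measure lebesgue {u i<..<v i})"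
          using K(3)[OF hp(2)] by (intro sum.cong) (auto simp: u_def v_def)
        also have "\<dots> = measure lebesgue (\<Union>i<n. {u i<..<v i})"
          using disj by (intro measure_finite_Union[symmetric]) (auto simp: image_subset_iff emeasure_lborel_box_eq
            box_real(1)[symmetric] simp del: box_real(1))
        also have "\<dots> \<le> measure lebesgue U"
        proof (rule measure_mono_fmeasurable)
          show "(\<Union>i<n. {u i<..<v i}) \<subseteq> U"
          proof (intro UN_least)
            fix i assume "i \<in> {..<n}"
            then have i: "i < n" by simp
            have "snd (h i) \<subseteq> U"
              using fineD[OF fine hp(2)[OF i]] hp(1)[OF i] by (simp add: \<gamma>_def p1_def)
            then show "{u i<..<v i} \<subseteq> U"
              using K(1)[OF hp(2)[OF i]] greaterThanLessThan_subseteq_atLeastAtMost_iff[of "u i" "v i" "u i" "v i"]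
              unfolding u_def v_def by auto
          qed
        qed (use U in auto)
        also have "\<dots> < \<delta>" by (rule U4)
        finally have "(\<Sum>i<n. norm (f (v i) - f (u i))) < e / 2"
          using disj K[OF hp(2)] by (intro \<delta>) (auto simp: u_def v_def)
        moreover have "(\<Sum>z\<in>p1. norm (\<Delta> (snd z))) = (\<Sum>i<n. norm (\<Delta> (snd (h i))))"
          using sum.reindex_bij_betw[OF h, of "\<lambda>z. norm (\<Delta> (snd z))"] by (simp add: atLeast0LessThan)
        ultimately show ?thesis by (simp add: \<Delta>_def u_def v_def)
      qed
      have "f b - f a = (\<Sum>z\<in>p. \<Delta> (snd z))"
        using additive_tagged_division_1[OF \<open>a \<le> b\<close>, of p f] p
        by (simp add: \<Delta>_def case_prod_unfold)
      then have "(\<Sum>(x, k)\<in>p. measure lborel k *\<^sub>R g x) - (f b - f a)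
          = (\<Sum>z\<in>p. measure lborel (snd z) *\<^sub>R g (fst z) - \<Delta> (snd z))"
        by (simp add: case_prod_unfold sum_subtractf)
      also have "\<dots> = (\<Sum>z\<in>p1. measure lborel (snd z) *\<^sub>R g (fst z) - \<Delta> (snd z)) +
          (\<Sum>z\<in>p2. measure lborel (snd z) *\<^sub>R g (fst z) - \<Delta> (snd z))"
        unfolding p12(1) using fin12 p12(2) by (rule sum.union_disjoint)
      also have "norm \<dots> < e / 2 + e / 2"
      proof (intro norm_add_less sum2)
        have "norm (\<Sum>z\<in>p1. measure lborel (snd z) *\<^sub>R g (fst z) - \<Delta> (snd z)) \<le> (\<Sum>z\<in>p1. norm (\<Delta> (snd z)))"
          by (intro sum_norm_le) (auto simp: p1_def g_def)
        then show "norm (\<Sum>z\<in>p1. measure lborel (snd z) *\<^sub>R g (fst z) - \<Delta> (snd z)) < e / 2"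
          using sum1 by simp
      qed
      finally show "norm ((\<Sum>(x, k)\<in>p. measure lborel k *\<^sub>R g x) - (f b - f a)) < e" by simp
    qed
  qed
  then show ?thesis
    using has_integral_spike[OF N, of "{a..b}" f' g "f b - f a"] by (simp add: g_def)
qed

text \<open>Jensen's inequality for sublinear \<open>q\<close>: it passes through a Riemann sum term
  by term, as the weights are nonnegative, and continuity of \<open>q\<close> carries it to the
  integral. One division fine for both gauges serves \<open>f\<close> and \<open>h\<close>.\<close>

lemma sublinear_has_integral_le:
  fixes f :: "real \<Rightarrow> 'a::euclidean_space" and q :: "'a \<Rightarrow> real"
  assumes f: "(f has_integral I) {a..b}" and h: "(h has_integral J) {a..b}"
    and le: "\<And>s. s \<in> {a..b} \<Longrightarrow> q (f s) \<le> h s"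
    and add: "\<And>x y. q (x + y) \<le> q x + q y" and scale: "\<And>c x. 0 \<le> c \<Longrightarrow> q (c *\<^sub>R x) = c * q x"
    and cont: "continuous_on UNIV q"
  shows "q I \<le> J"
proof (rule ccontr)
  assume "\<not> q I \<le> J"
  define \<epsilon> where "\<epsilon> = q I - J"
  have "\<epsilon> > 0" using \<open>\<not> q I \<le> J\<close> by (simp add: \<epsilon>_def)
  have "isCont q I" using cont by (simp add: continuous_on_eq_continuous_at)
  then obtain \<delta> where "\<delta> > 0" and \<delta>: "\<And>y. dist y I < \<delta> \<Longrightarrow> dist (q y) (q I) < \<epsilon> / 2"
    unfolding continuous_at_eps_delta using \<open>\<epsilon> > 0\<close> by (meson half_gt_zero)
  obtain \<gamma>1 where \<gamma>1: "gauge \<gamma>1" "\<And>p. p tagged_division_of {a..b} \<Longrightarrow> \<gamma>1 fine p \<Longrightarrow>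
      norm ((\<Sum>(x, k)\<in>p. measure lborel k *\<^sub>R f x) - I) < \<delta>"
    using f[unfolded has_integral_real, rule_format, OF \<open>\<delta> > 0\<close>] by (elim exE conjE) (metis (no_types, lifting))
  have "\<epsilon> / 2 > 0" using \<open>\<epsilon> > 0\<close> by simp
  obtain \<gamma>2 where \<gamma>2: "gauge \<gamma>2" "\<And>p. p tagged_division_of {a..b} \<Longrightarrow> \<gamma>2 fine p \<Longrightarrow>
      norm ((\<Sum>(x, k)\<in>p. measure lborel k *\<^sub>R h x) - J) < \<epsilon> / 2"
    using h[unfolded has_integral_real, rule_format, OF \<open>\<epsilon> / 2 > 0\<close>] by (elim exE conjE) (metis (no_types, lifting))
  obtain p where p: "p tagged_division_of {a..b}" "(\<lambda>x. \<gamma>1 x \<inter> \<gamma>2 x) fine p"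
    using fine_division_exists_real[OF gauge_Int[OF \<gamma>1(1) \<gamma>2(1)]] by blast
  have q0: "q 0 = 0" using scale[of 0 0] by simp
  have sum: "q (\<Sum>z\<in>A. measure lborel (snd z) *\<^sub>R f (fst z)) \<le> (\<Sum>z\<in>A. measure lborel (snd z) * q (f (fst z)))"
    if "finite A" for A :: "(real \<times> real set) set"
    using that
  proof induction
    case (insert z A)
    have "q (measure lborel (snd z) *\<^sub>R f (fst z) + (\<Sum>z\<in>A. measure lborel (snd z) *\<^sub>R f (fst z))) \<le>
        measure lborel (snd z) * q (f (fst z)) + (\<Sum>z\<in>A. measure lborel (snd z) * q (f (fst z)))"
      using insert.IH by (intro order_trans[OF add] add_mono) (auto simp: scale)
    then show ?case using insert by simp
  qed (simp add: q0)
  have "dist (q (\<Sum>(x, k)\<in>p. measure lborel k *\<^sub>R f x)) (q I) < \<epsilon> / 2"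
    using \<gamma>1(2)[OF p(1)] p(2) by (intro \<delta>) (auto simp: fine_Int dist_norm)
  then have "q I - \<epsilon> / 2 < q (\<Sum>z\<in>p. measure lborel (snd z) *\<^sub>R f (fst z))"
    unfolding dist_real_def case_prod_unfold by linarith
  also have "\<dots> \<le> (\<Sum>z\<in>p. measure lborel (snd z) * q (f (fst z)))"
    using p(1) by (intro sum) blast
  also have "\<dots> \<le> (\<Sum>z\<in>p. measure lborel (snd z) * h (fst z))"
    using tagged_division_ofD(2,3)[OF p(1)] by (intro sum_mono mult_left_mono le) fastforce+
  also have "\<dots> < J + \<epsilon> / 2"
    using \<gamma>2(2)[OF p(1)] p(2)
    unfolding fine_Int case_prod_unfold real_norm_def real_scaleR_def abs_less_iff by linarith
  finally show False by (simp add: \<epsilon>_def field_simps)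
qed

subsection \<open>Lebesgue differentiation on the line\<close>

text \<open>The points where the density of \<open>g\<close> exceeds \<open>q\<close> on small intervals although \<open>g < p < q\<close> are
  covered, up to a null set, by disjoint such intervals of total length \<open>l\<close> inside an open set that
  exceeds \<open>{g < p}\<close> by at most \<open>\<eta>\<close>; integrating \<open>g\<close> gives \<open>q l \<le> p l + M \<eta>\<close>.\<close>

lemma negligible_upper_density:
  fixes g :: "real \<Rightarrow> real"
  assumes g[measurable]: "g \<in> borel_measurable borel" and gM: "\<And>s. 0 \<le> g s \<and> g s \<le> M" and pq: "0 < p" "p < q"
  shows "negligible {s\<in>{-n<..<n}. g s < p \<and> (\<forall>d>0. \<exists>u v. u \<le> s \<and> s \<le> v \<and> u < v \<and> v - u < d \<and>
     ennreal (q * (v - u)) \<le> (\<integral>\<^sup>+x\<in>{u..v}. ennreal (g x) \<partial>lborel))}" (is "negligible ?E")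
  unfolding negligible_outer_le
proof (intro allI impI)
  fix e :: real assume "e > 0"
  have "M \<ge> 0" using gM[of 0] by linarith
  \<comment> \<open>Makes \<open>M * \<eta>\<close> at most \<open>(q - p) * e\<close>, which turns
    the final estimate into \<open>l \<le> e\<close>; \<open>M + 1\<close> keeps the quotient
    defined for \<open>M = 0\<close>.\<close>
  define \<eta> where "\<eta> = e * (q - p) / (M + 1)"
  have "\<eta> > 0" using \<open>e > 0\<close> pq \<open>M \<ge> 0\<close> by (simp add: \<eta>_def)
  define A where "A = {s\<in>{-n<..<n}. g s < p}"
  have A[measurable]: "A \<in> sets borel" unfolding A_def by measurable
  have "A \<in> lmeasurable"
    by (intro bounded_set_imp_lmeasurable bounded_subset[OF bounded_box[of "-n" n]]) (auto simp: A_def)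
  from lmeasurable_outer_open[OF this \<open>\<eta> > 0\<close>]
  obtain U where U: "open U" "A \<subseteq> U" "U \<in> lmeasurable" "measure lebesgue (U - A) < \<eta>" by auto
  define \<mu> where "\<mu> = density lborel (\<lambda>x. ennreal (g x))"
  have \<mu>: "emeasure \<mu> B = (\<integral>\<^sup>+x\<in>B. ennreal (g x) \<partial>lborel)" if "B \<in> sets borel" for B
    using that by (simp add: \<mu>_def emeasure_density)
  define K where "K = {(u, v). u < v \<and> {u..v} \<subseteq> U \<and> ennreal (q * (v - u)) \<le> emeasure \<mu> {u..v}}"
  \<comment> \<open>The covering theorem speaks of balls, so each interval is encoded by its
    midpoint and half-length.\<close>
  define c r where "c z = (fst z + snd z) / 2" and "r z = (snd z - fst z) / 2" for z :: "real \<times> real"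
  have cb: "cball (c z) (r z) = {fst z..snd z}" for z
    by (auto simp: c_def r_def cball_eq_atLeastAtMost field_simps)
  obtain C where C: "countable C" "C \<subseteq> K"
     "pairwise (\<lambda>i j. disjnt (cball (c i) (r i)) (cball (c j) (r j))) C"
     "negligible (?E - (\<Union>i \<in> C. cball (c i) (r i)))"
  proof (rule Vitali_covering_theorem_cballs[of K r ?E c])
    show "0 < r i" if "i \<in> K" for i using that by (auto simp: K_def r_def)
    fix s d :: real assume s: "s \<in> ?E" and "0 < d"
    then have "s \<in> U" using U(2) by (auto simp: A_def)
    then obtain d' where d': "d' > 0" "ball s d' \<subseteq> U" using U(1) open_contains_ball by blast
    define d'' where "d'' = min d d'"
    have "d'' > 0" using d' \<open>0 < d\<close> by (simp add: d''_def)
    then obtain u v where uv: "u \<le> s" "s \<le> v" "u < v" "v - u < d''"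
        "ennreal (q * (v - u)) \<le> (\<integral>\<^sup>+x\<in>{u..v}. ennreal (g x) \<partial>lborel)"
      using s by blast
    then have "{u..v} \<subseteq> ball s d'" by (auto simp: dist_real_def d''_def)
    then have "(u, v) \<in> K" using uv d' by (auto simp: K_def \<mu>)
    moreover have "s \<in> cball (c (u, v)) (r (u, v))" using uv by (simp add: cb)
    moreover have "r (u, v) < d" using uv by (auto simp: r_def d''_def)
    ultimately show "\<exists>i. i \<in> K \<and> s \<in> cball (c i) (r i) \<and> r i < d" by blast
  qed
  define W where "W = (\<Union>z\<in>C. {fst z..snd z})"
  have W[measurable]: "W \<in> sets borel" unfolding W_def using C(1) by (intro sets.countable_UN') auto
  have WU: "W \<subseteq> U" using C(2) unfolding W_def K_def by fastforce
  have disj: "disjoint_family_on (\<lambda>z. {fst z..snd z}) C"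
    using C(3) by (auto simp: pairwise_def disjoint_family_on_def disjnt_def cb)
  have Wfin: "emeasure lborel W < \<infinity>"
  proof -
    have "emeasure lborel W = emeasure lebesgue W" by simp
    also have "\<dots> \<le> emeasure lebesgue U" using WU U(3) by (intro emeasure_mono) auto
    also have "\<dots> < \<infinity>" using U(3) by (auto simp: fmeasurable_def)
    finally show ?thesis .
  qed
  \<comment> \<open>The density bounds of the single intervals are summed over the disjoint
    countable family \<open>C\<close>.\<close>
  have "ennreal q * emeasure lborel W = (\<integral>\<^sup>+z. ennreal q * emeasure lborel {fst z..snd z} \<partial>count_space C)"
    unfolding W_def using disj C(1) by (subst emeasure_UN_countable) (auto simp: nn_integral_cmult)
  also have "\<dots> \<le> (\<integral>\<^sup>+z. emeasure \<mu> {fst z..snd z} \<partial>count_space C)"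
    using C(2) pq by (intro nn_integral_mono) (auto simp: K_def ennreal_mult[symmetric])
  also have "\<dots> = emeasure \<mu> W"
    unfolding W_def using disj C(1) by (subst emeasure_UN_countable) (auto simp: \<mu>_def)
  also have "\<dots> = (\<integral>\<^sup>+x\<in>W. ennreal (g x) \<partial>lborel)" by (simp add: \<mu>)
  also have "\<dots> \<le> (\<integral>\<^sup>+x. ennreal p * indicator W x + ennreal M * indicator (U - A) x \<partial>lborel)"
  proof (intro nn_integral_mono)
    fix x
    show "ennreal (g x) * indicator W x \<le> ennreal p * indicator W x + ennreal M * indicator (U - A) x"
    proof (cases "x \<in> W")
      case True
      then show ?thesis
        using WU gM[of x]
      proof (cases "x \<in> A")
        case False
        then have "x \<in> U - A" using True WU by auto
        then show ?thesis
          using True gM[of x] by (auto intro!: order_trans[OF ennreal_leI[of "g x" M]] add_increasing)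
      next
        case True': True
        then have "g x \<le> p" by (auto simp: A_def)
        then show ?thesis using True True' by (auto intro: ennreal_leI)
      qed
    qed simp
  qed
  also have "\<dots> = ennreal p * emeasure lborel W + ennreal M * emeasure lborel (U - A)"
    using borel_open[OF U(1)] by (subst nn_integral_add) (auto simp: nn_integral_cmult_indicator)
  also have "emeasure lborel (U - A) \<le> ennreal \<eta>"
  proof -
    have "U - A \<in> lmeasurable" using U(3) \<open>A \<in> lmeasurable\<close> by blast
    then have "emeasure lebesgue (U - A) = ennreal (measure lebesgue (U - A))"
      by (simp add: emeasure_eq_measure2)
    then show ?thesis using U(1,4) by (simp add: ennreal_leI)
  qed
  finally have le: "ennreal q * emeasure lborel W \<le> ennreal p * emeasure lborel W + ennreal M * ennreal \<eta>"
    by (simp add: add_left_mono mult_left_mono)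
  define l where "l = measure lborel W"
  have l: "emeasure lborel W = ennreal l" "l \<ge> 0"
    using Wfin by (simp_all add: l_def emeasure_eq_ennreal_measure top.not_eq_extremum)
  have "ennreal (q * l) \<le> ennreal (p * l + M * \<eta>)"
    using le pq l(2) \<open>\<eta> > 0\<close> \<open>M \<ge> 0\<close> by (simp add: l(1) ennreal_mult ennreal_plus)
  then have "(q - p) * l \<le> M * \<eta>"
    using pq l(2) \<open>\<eta> > 0\<close> \<open>M \<ge> 0\<close> by (subst (asm) ennreal_le_iff) (auto simp: algebra_simps)
  also have "\<dots> \<le> (M + 1) * \<eta>" using \<open>\<eta> > 0\<close> by simp
  also have "\<dots> = (q - p) * e" using \<open>M \<ge> 0\<close> by (simp add: \<eta>_def)
  finally have "l \<le> e" using pq by simp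
  define Z where "Z = ?E - W"
  have Z: "negligible Z" using C(4) by (simp add: Z_def W_def cb)
  have Wl: "W \<in> lmeasurable"
    using Wfin by (auto simp: fmeasurable_def)
  show "\<exists>T. ?E \<subseteq> T \<and> T \<in> lmeasurable \<and> measure lebesgue T \<le> e"
  proof (intro exI[of _ "W \<union> Z"] conjI)
    show "?E \<subseteq> W \<union> Z" by (auto simp: Z_def)
    show "W \<union> Z \<in> lmeasurable" using Wl Z negligible_iff_measure by blast
    have "measure lebesgue (W \<union> Z) = measure lebesgue W"
      by (rule measure_Un_null_set) (use Z in \<open>auto simp: negligible_iff_null_sets\<close>)
    then show "measure lebesgue (W \<union> Z) \<le> e" using \<open>l \<le> e\<close> by (simp add: l_def)
  qed
qed

text \<open>If the claim fails at \<open>s\<close> for some \<open>e\<close>, rationals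
  \<open>p < q\<close> strictly between \<open>g s\<close> and \<open>g s + e\<close> and a natural
  number exceeding \<open>\<bar>s\<bar>\<close> put \<open>s\<close> into one of countably many
  negligible sets.\<close>

lemma AE_upper_density:
  fixes g :: "real \<Rightarrow> real"
  assumes g: "g \<in> borel_measurable borel" and gM: "\<And>s. 0 \<le> g s \<and> g s \<le> M"
  shows "AE s in lborel. \<forall>e>0. \<exists>d>0. \<forall>u v. u \<le> s \<and> s \<le> v \<and> u < v \<and> v - u < d \<longrightarrow>
     (\<integral>\<^sup>+x\<in>{u..v}. ennreal (g x) \<partial>lborel) \<le> ennreal ((g s + e) * (v - u))"
proof -
  define E where "E p q n = {s\<in>{-n<..<n}. g s < p \<and> (\<forall>d>0. \<exists>u v. u \<le> s \<and> s \<le> v \<and> u < v \<and> v - u < d \<and>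
     ennreal (q * (v - u)) \<le> (\<integral>\<^sup>+x\<in>{u..v}. ennreal (g x) \<partial>lborel))}" for p q n :: real
  define I where "I = {(p :: real, q :: real, n :: real). p \<in> \<rat> \<and> q \<in> \<rat> \<and> n \<in> \<nat> \<and> 0 < p \<and> p < q}"
  have "countable I"
    by (rule countable_subset[of _ "\<rat> \<times> \<rat> \<times> \<nat>"]) (auto simp: I_def countable_rat Nats_def)
  moreover have "negligible (E p q n)" if "(p, q, n) \<in> I" for p q n
    unfolding E_def using that by (intro negligible_upper_density[OF g gM]) (auto simp: I_def)
  ultimately have "negligible (\<Union>(p, q, n)\<in>I. E p q n)"
    by (intro negligible_countable_Union[of "(\<lambda>(p, q, n). E p q n) ` I", simplified]) auto
  then have "AE s in lebesgue. s \<notin> (\<Union>(p, q, n)\<in>I. E p q n)"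
    unfolding negligible_iff_null_sets by (rule AE_not_in)
  then have "AE s in lborel. s \<notin> (\<Union>(p, q, n)\<in>I. E p q n)"
    by (simp add: AE_completion_iff)
  then show ?thesis
  proof eventually_elim
    case (elim s)
    show ?case
    proof (rule ccontr)
      assume "\<not> ?thesis"
      then obtain e where "e > 0" and e: "\<And>d. d > 0 \<Longrightarrow> \<exists>u v. u \<le> s \<and> s \<le> v \<and> u < v \<and> v - u < d \<and>
         ennreal ((g s + e) * (v - u)) < (\<integral>\<^sup>+x\<in>{u..v}. ennreal (g x) \<partial>lborel)"
        by (metis linorder_not_le)
      obtain p where p: "p \<in> \<rat>" "g s < p" "p < g s + e"
        using Rats_dense_in_real[of "g s" "g s + e"] \<open>e > 0\<close> by auto
      obtain q where q: "q \<in> \<rat>" "p < q" "q < g s + e"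
        using Rats_dense_in_real[OF p(3)] by auto
      obtain n :: nat where n: "\<bar>s\<bar> < n" using reals_Archimedean2 by blast
      have "s \<in> E p q n"
        unfolding E_def
      proof (intro CollectI conjI allI impI)
        fix d :: real assume "d > 0"
        from e[OF this] obtain u v where uv: "u \<le> s" "s \<le> v" "u < v" "v - u < d"
          "ennreal ((g s + e) * (v - u)) < (\<integral>\<^sup>+x\<in>{u..v}. ennreal (g x) \<partial>lborel)" by blast
        have "ennreal (q * (v - u)) \<le> ennreal ((g s + e) * (v - u))"
          using q uv by (intro ennreal_leI mult_right_mono) auto
        then show "\<exists>u v. u \<le> s \<and> s \<le> v \<and> u < v \<and> v - u < d \<and>
            ennreal (q * (v - u)) \<le> (\<integral>\<^sup>+x\<in>{u..v}. ennreal (g x) \<partial>lborel)"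
          using uv by (intro exI[of _ u] exI[of _ v]) auto
      qed (use p n in auto)
      moreover have "(p, q, real n) \<in> I" using p q gM[of s] by (auto simp: I_def intro: le_less_trans)
      ultimately show False using elim by blast
    qed
  qed
qed

text \<open>An affine substitution; \<open>min\<close> and \<open>max\<close> treat both signs of
  \<open>t\<close>, as the limit in the metric derivative is two-sided.\<close>

lemma nn_integral_segment:
  fixes g :: "real \<Rightarrow> real"
  assumes [measurable]: "g \<in> borel_measurable borel" and "t \<noteq> 0"
  shows "ennreal \<bar>t\<bar> * (\<integral>\<^sup>+r\<in>{0..1}. ennreal (g (s + r * t)) \<partial>lborel) =
    (\<integral>\<^sup>+x\<in>{min s (s + t)..max s (s + t)}. ennreal (g x) \<partial>lborel)"
proof -
  have "(\<integral>\<^sup>+x\<in>{min s (s + t)..max s (s + t)}. ennreal (g x) \<partial>lborel) = ennreal \<bar>t\<bar> *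
      (\<integral>\<^sup>+r. ennreal (g (s + t * r)) * indicator {min s (s + t)..max s (s + t)} (s + t * r) \<partial>lborel)"
    using assms by (subst nn_integral_real_affine[of _ t s]) auto
  also have "(\<lambda>r. indicator {min s (s + t)..max s (s + t)} (s + t * r)) = (indicator {0..1} :: real \<Rightarrow> ennreal)"
  proof
    fix r
    have "s + t * r \<in> {min s (s + t)..max s (s + t)} \<longleftrightarrow> r \<in> {0..1}"
    proof (cases "t > 0")
      case True
      then have "t * r \<le> t * 1 \<longleftrightarrow> r \<le> 1" "0 \<le> t * r \<longleftrightarrow> 0 \<le> r"
        by (simp_all only: mult_le_cancel_left_pos zero_le_mult_iff) auto
      with True show ?thesis by (simp add: min_def max_def)
    next
      case False
      then have "t < 0" using assms by simp
      then have "t * 1 \<le> t * r \<longleftrightarrow> r \<le> 1" "t * r \<le> 0 \<longleftrightarrow> 0 \<le> r"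
        by (simp_all only: mult_le_cancel_left_neg mult_le_0_iff) auto
      with \<open>t < 0\<close> show ?thesis by (auto simp: min_def max_def)
    qed
    then show "indicator {min s (s + t)..max s (s + t)} (s + t * r) = (indicator {0..1} r :: ennreal)"
      by (simp add: indicator_def)
  qed
  finally show ?thesis by (simp add: mult.commute)
qed

text \<open>Rescaling to the unit interval removes the quotient by \<open>t\<close> and gives the
  form in which means along rays occur later. At \<open>t = 0\<close> the integrand is the constant
  \<open>g s\<close>.\<close>

lemma AE_lebesgue_upper_derivative:
  fixes g :: "real \<Rightarrow> real"
  assumes g[measurable]: "g \<in> borel_measurable borel" and gM: "\<And>s. 0 \<le> g s \<and> g s \<le> M"
  shows "AE s in lborel. \<forall>e>0. \<exists>d>0. \<forall>t. \<bar>t\<bar> < d \<longrightarrow>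
     (\<integral>\<^sup>+r\<in>{0..1}. ennreal (g (s + r * t)) \<partial>lborel) \<le> ennreal (g s + e)"
  using AE_upper_density[OF g gM]
proof eventually_elim
  case (elim s)
  show ?case
  proof (intro allI impI)
    fix e :: real assume "e > 0"
    with elim obtain d where "d > 0" and d: "\<forall>u v. u \<le> s \<and> s \<le> v \<and> u < v \<and> v - u < d \<longrightarrow>
        (\<integral>\<^sup>+x\<in>{u..v}. ennreal (g x) \<partial>lborel) \<le> ennreal ((g s + e) * (v - u))" by metis
    show "\<exists>d>0. \<forall>t. \<bar>t\<bar> < d \<longrightarrow> (\<integral>\<^sup>+r\<in>{0..1}. ennreal (g (s + r * t)) \<partial>lborel) \<le> ennreal (g s + e)"
    proof (intro exI[of _ d] conjI allI impI)
      fix t assume t: "\<bar>t\<bar> < d"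
      show "(\<integral>\<^sup>+r\<in>{0..1}. ennreal (g (s + r * t)) \<partial>lborel) \<le> ennreal (g s + e)"
      proof (cases "t = 0")
        case True
        then show ?thesis using \<open>e > 0\<close> by (auto simp: nn_integral_cmult intro!: ennreal_leI)
      next
        case False
        have "ennreal \<bar>t\<bar> * (\<integral>\<^sup>+r\<in>{0..1}. ennreal (g (s + r * t)) \<partial>lborel)
            \<le> ennreal ((g s + e) * (max s (s + t) - min s (s + t)))"
          unfolding nn_integral_segment[OF g False] using t False
          by (intro d[rule_format]) (auto simp: min_def max_def)
        also have "max s (s + t) - min s (s + t) = \<bar>t\<bar>" by (auto simp: min_def max_def)
        also have "ennreal ((g s + e) * \<bar>t\<bar>) = ennreal \<bar>t\<bar> * ennreal (g s + e)"
          using gM[of s] \<open>e > 0\<close> by (simp add: ennreal_mult mult.commute)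
        finally show ?thesis
          using False by (simp add: ennreal_mult_le_mult_iff)
      qed
    qed (rule \<open>d > 0\<close>)
  qed
qed

section \<open>Derivatives of curves\<close>

lemma has_vector_derivative_shift0:
  assumes "((\<lambda>s. p (t + s)) has_vector_derivative d) (at (0::real))"
  shows "(p has_vector_derivative d) (at t)"
proof -
  have "((\<lambda>s. s - t) has_derivative (\<lambda>h. h)) (at t)"
    by (auto intro!: derivative_eq_intros)
  from has_derivative_compose[OF this, of "\<lambda>s. p (t + s)" "\<lambda>h. h *\<^sub>R d"] assms
  show ?thesis by (simp add: has_vector_derivative_def)
qed

lemma has_vector_derivative_eq_unique:
  fixes p q :: "real \<Rightarrow> 'b::real_normed_vector"
  assumes "\<And>t. (p has_vector_derivative d t) (at t)" "\<And>t. (q has_vector_derivative d t) (at t)"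
    and "p 0 = q 0"
  shows "p t = q t"
proof -
  have "((\<lambda>t. p t - q t) has_derivative (\<lambda>h. 0)) (at t)" for t
    using has_vector_derivative_diff[OF assms(1,2)] by (simp add: has_vector_derivative_def)
  then have "p t - q t = p 0 - q 0"
    using has_derivative_zero_unique[of UNIV "\<lambda>t. p t - q t" t 0] by simp
  then show ?thesis using assms(3) by simp
qed

text \<open>For a curve reparametrised by square roots the derivative at \<open>0\<close> is
  accessible only as a limit of difference quotients.\<close>

lemma has_vector_derivative_zero_iff:
  fixes f :: "real \<Rightarrow> 'b::real_normed_vector"
  assumes "f 0 = 0"
  shows "(f has_vector_derivative d) (at 0) \<longleftrightarrow> (\<lambda>t. f t /\<^sub>R t) \<midarrow>0\<rightarrow> d"
proof -
  have "norm (f (0 + t) - f 0 - t *\<^sub>R d) / norm t = norm (f t /\<^sub>R t - d)" if "t \<noteq> 0" for t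
  proof -
    have "f (0 + t) - f 0 - t *\<^sub>R d = t *\<^sub>R (f t /\<^sub>R t - d)"
      using that assms by (simp add: scaleR_diff_right)
    then show ?thesis using that by simp
  qed
  then have "((\<lambda>t. norm (f (0 + t) - f 0 - t *\<^sub>R d) / norm t) \<midarrow>0\<rightarrow> 0) \<longleftrightarrow>
      ((\<lambda>t. norm (f t /\<^sub>R t - d)) \<midarrow>0\<rightarrow> 0)"
    by (intro tendsto_cong) (auto simp: eventually_at_filter)
  then show ?thesis
    by (simp add: has_vector_derivative_def has_derivative_at bounded_linear_scaleR_left
        LIM_zero_iff tendsto_norm_zero_iff)
qed

section \<open>Exponential coordinates\<close>

sublocale carnot_group \<subseteq> gr: group "gmult G" 0 "ginv G" by (rule grp)

context carnot_group
begin

abbreviation gm (infixl "\<odot>" 70) where "x \<odot> y \<equiv> gmult G x y"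

definition M :: "'a \<times> 'a \<Rightarrow> 'a" where "M = (\<lambda>(x, y). x \<odot> y)"

abbreviation DM :: "'a \<times> 'a \<Rightarrow> 'a \<times> 'a \<Rightarrow> 'a" where "DM p \<equiv> frechet_derivative M (at p)"

lemma M_has_derivative: "(M has_derivative DM p) (at p)"
  using mult_differentiable frechet_derivative_works unfolding M_def by blast

lemma DM_differentiable: "(\<lambda>p. DM p v) differentiable (at p)"
proof -
  have "C_k (Suc (Suc 0)) M"
    using smooth_mult unfolding smooth_def M_def by blast
  then show ?thesis unfolding C_k.simps by blast
qed

lemma line_mult: "(s *\<^sub>R v) \<odot> (t *\<^sub>R v) = (s + t) *\<^sub>R v"
  using exp_coords[of v] by (simp add: one_parameter_subgroup_def)

lemma ginv_eq: "ginv G x = - x"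
proof -
  have "x \<odot> (- x) = 0"
    using line_mult[of 1 x "-1"] by simp
  then show ?thesis by (rule gr.inverse_unique)
qed

lemma mult_minus [simp]: "x \<odot> (- x) = 0" "(- x) \<odot> x = 0"
  using gr.right_inverse[of x] gr.left_inverse[of x] by (simp_all add: ginv_eq)

lemma mult_minus_cancel [simp]: "x \<odot> ((- x) \<odot> y) = y" "(- x) \<odot> (x \<odot> y) = y"
  by (simp_all add: gr.assoc[symmetric])

lemma minus_mult: "- (x \<odot> y) = (- y) \<odot> (- x)"
  using gr.inverse_distrib_swap[of x y] by (simp add: ginv_eq)

lemma mult_has_derivative:
  assumes "(f has_derivative f') (at x within S)" "(g has_derivative g') (at x within S)"
  shows "((\<lambda>x. f x \<odot> g x) has_derivative (\<lambda>h. DM (f x, g x) (f' h, g' h))) (at x within S)"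
  using has_derivative_compose[OF has_derivative_Pair[OF assms] M_has_derivative]
  by (simp add: M_def)

lemma mult_has_vector_derivative:
  assumes "(f has_vector_derivative f') (at x within S)" "(g has_vector_derivative g') (at x within S)"
  shows "((\<lambda>x. f x \<odot> g x) has_vector_derivative DM (f x, g x) (f', g')) (at x within S)"
proof -
  interpret bounded_linear "DM (f x, g x)"
    using M_has_derivative by (rule has_derivative_bounded_linear)
  show ?thesis
    using mult_has_derivative[OF assms[unfolded has_vector_derivative_def]]
    unfolding has_vector_derivative_def by (simp add: scaleR[symmetric])
qed

lemma mult_differentiable_compose:
  "f differentiable (at x within S) \<Longrightarrow> g differentiable (at x within S) \<Longrightarrow>
    (\<lambda>x. f x \<odot> g x) differentiable (at x within S)"
  unfolding differentiable_def using mult_has_derivative by blast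

lemma linear_DM: "linear (DM p)"
  using M_has_derivative has_derivative_bounded_linear bounded_linear.linear by blast

lemma dtau_eq: "dtau G x y h = DM (x, y) (0, h)"
proof -
  have "((\<lambda>y. x \<odot> y) has_derivative (\<lambda>h. DM (x, y) (0, h))) (at y)"
    by (rule mult_has_derivative) (auto intro!: derivative_eq_intros)
  then show ?thesis
    using left_translation_has_derivative has_derivative_unique by metis
qed

text \<open>\<open>x \<odot> 0 = x\<close> and \<open>0 \<odot> y = y\<close> determine the partial
  derivatives at the identity, so to first order the product there is vector addition.\<close>

lemma DM_zero: "DM (0, 0) (u, v) = u + v"
proof -
  have 1: "((\<lambda>x. x \<odot> 0) has_derivative (\<lambda>h. DM (0, 0) (h, 0))) (at 0)"
    by (rule mult_has_derivative) (auto intro!: derivative_eq_intros)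
  have 2: "((\<lambda>x. 0 \<odot> x) has_derivative (\<lambda>h. DM (0, 0) (0, h))) (at 0)"
    by (rule mult_has_derivative) (auto intro!: derivative_eq_intros)
  have 1: "DM (0, 0) (h, 0) = h" and 2: "DM (0, 0) (0, h) = h" for h
    using has_derivative_unique[OF 1, of "\<lambda>x. x"] has_derivative_unique[OF 2, of "\<lambda>x. x"]
    by (auto simp: fun_eq_iff)
  have "(u, v) = (u, 0) + (0, v)" by simp
  then have "DM (0, 0) (u, v) = DM (0, 0) (u, 0) + DM (0, 0) (0, v)"
    using linear_add[OF linear_DM] by metis
  then show ?thesis using 1 2 by simp
qed

text \<open>The left-invariant field with value \<open>u\<close> at the identity; as a function of
  \<open>u\<close> it is the left trivialisation of the tangent space at \<open>x\<close>.\<close>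

definition X :: "'a \<Rightarrow> 'a \<Rightarrow> 'a" where "X u x = dtau G x 0 u"

lemma X_eq: "X u x = DM (x, 0) (0, u)" by (simp add: X_def dtau_eq)

lemma X_zero: "X u 0 = u" by (simp add: X_eq DM_zero)

lemma linear_X: "linear (\<lambda>u. X u x)"
  unfolding X_def
  using left_translation_has_derivative has_derivative_bounded_linear bounded_linear.linear by blast

lemma to_layer_X: "to_layer G x (X u x) = u" by (simp add: X_def to_layer_dtau)

lemma X_to_layer: "X (to_layer G x v) x = v"
proof -
  have "((\<lambda>y. x \<odot> ((- x) \<odot> y)) has_derivative (\<lambda>h. dtau G x 0 (dtau G (- x) x h))) (at x)"
    using has_derivative_compose[OF left_translation_has_derivative[of "- x" x],
        of "\<lambda>y. x \<odot> y" "dtau G x 0"] left_translation_has_derivative[of x 0] by simp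
  then have "((\<lambda>y. y) has_derivative (\<lambda>h. dtau G x 0 (dtau G (- x) x h))) (at x)"
    by simp
  then have "(\<lambda>h. dtau G x 0 (dtau G (- x) x h)) = (\<lambda>h. h)"
    using has_derivative_ident has_derivative_unique by blast
  then show ?thesis by (simp add: X_def to_layer_def ginv_eq fun_eq_iff)
qed

lemma linear_to_layer: "linear (to_layer G x)"
  unfolding to_layer_def
  using left_translation_has_derivative has_derivative_bounded_linear bounded_linear.linear by blast

lemma hfiber_eq: "hfiber G x = {v. to_layer G x v \<in> layer G 1}"
  unfolding hfiber_def X_def[symmetric]
proof safe
  fix v assume "to_layer G x v \<in> layer G 1"
  then have "X (to_layer G x v) x \<in> (\<lambda>u. X u x) ` layer G 1" by blast
  then show "v \<in> (\<lambda>u. X u x) ` layer G 1" by (simp add: X_to_layer)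
qed (simp add: to_layer_X)

lemma left_mult_has_vector_derivative:
  assumes "(c has_vector_derivative u) (at s within S)" "c s = 0"
  shows "((\<lambda>s. x \<odot> c s) has_vector_derivative X u x) (at s within S)"
  using mult_has_vector_derivative[OF has_vector_derivative_const[of x] assms(1)] assms(2)
  by (simp add: X_eq)

text \<open>The ray is restarted at time \<open>t\<close>: it is the left translate by
  \<open>x \<odot> (t *\<^sub>R w)\<close> of the line \<open>(s - t) *\<^sub>R w\<close>, which is
  at the identity when \<open>s = t\<close>. Rays are thus integral curves of
  \<open>X w\<close>.\<close>

lemma line_has_vector_derivative:
  "((\<lambda>s. x \<odot> (s *\<^sub>R w)) has_vector_derivative X w (x \<odot> (t *\<^sub>R w))) (at t within S)"
proof -
  have "((\<lambda>s. (s - t) *\<^sub>R w) has_vector_derivative w) (at t within S)"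
    by (auto intro!: derivative_eq_intros)
  then have "((\<lambda>s. (x \<odot> (t *\<^sub>R w)) \<odot> ((s - t) *\<^sub>R w)) has_vector_derivative X w (x \<odot> (t *\<^sub>R w))) (at t within S)"
    by (rule left_mult_has_vector_derivative) simp
  moreover have "(x \<odot> (t *\<^sub>R w)) \<odot> ((s - t) *\<^sub>R w) = x \<odot> (s *\<^sub>R w)" for s
    by (simp add: gr.assoc line_mult)
  ultimately show ?thesis by simp
qed

text \<open>Reduces joint regularity in \<open>(x, u)\<close> to that of the finitely many fields
  \<open>X b\<close>.\<close>

lemma X_expand: "X u x = (\<Sum>b\<in>Basis. (u \<bullet> b) *\<^sub>R X b x)"
proof -
  have "X u x = X (\<Sum>b\<in>Basis. (u \<bullet> b) *\<^sub>R b) x" by (simp add: euclidean_representation)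
  also have "\<dots> = (\<Sum>b\<in>Basis. (u \<bullet> b) *\<^sub>R X b x)"
    by (simp add: linear_sum[OF linear_X] linear_cmul[OF linear_X])
  finally show ?thesis .
qed

lemma X_differentiable: "X u differentiable (at x)"
proof -
  have "(\<lambda>x. (\<lambda>p. DM p (0, u)) (x, 0)) differentiable (at x)"
    by (rule differentiable_compose[of "\<lambda>p. DM p (0, u)" "\<lambda>x. (x, 0)", OF DM_differentiable])
      (auto intro!: derivative_eq_intros exI simp: differentiable_def)
  then show ?thesis by (simp add: X_eq[abs_def])
qed

lemma continuous_X: "continuous_on UNIV (\<lambda>(x, u). X u x)"
proof -
  have "continuous_on UNIV (X b)" for b
    using X_differentiable
    by (simp add: continuous_at_imp_continuous_on differentiable_imp_continuous_within)
  then have "continuous_on UNIV (\<lambda>p. X b (fst p))" for b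
    by (rule continuous_on_compose2) (auto intro!: continuous_intros)
  then have "continuous_on UNIV (\<lambda>p. \<Sum>b\<in>Basis. (snd p \<bullet> b) *\<^sub>R X b (fst p))"
    by (auto intro!: continuous_intros)
  moreover have "(\<lambda>(x, u). X u x) = (\<lambda>p. \<Sum>b\<in>Basis. (snd p \<bullet> b) *\<^sub>R X b (fst p))"
    by (subst X_expand[abs_def]) auto
  ultimately show ?thesis by simp
qed

lemma continuous_M: "continuous_on UNIV M"
  using M_has_derivative
  by (meson continuous_at_imp_continuous_on has_derivative_continuous)

lemma continuous_mult [continuous_intros]:
  "continuous_on S f \<Longrightarrow> continuous_on S g \<Longrightarrow> continuous_on S (\<lambda>x. f x \<odot> g x)"
  using continuous_on_compose2[OF continuous_M, of S "\<lambda>x. (f x, g x)"]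
  by (auto simp: M_def intro!: continuous_intros)

subsection \<open>The adjoint action\<close>

definition Ad :: "'a \<Rightarrow> 'a \<Rightarrow> 'a" where "Ad x y = x \<odot> y \<odot> (- x)"

lemma Ad_0 [simp]: "Ad 0 y = y" "Ad x 0 = 0" by (simp_all add: Ad_def)

lemma Ad_comp: "Ad (x \<odot> y) z = Ad x (Ad y z)"
  by (simp add: Ad_def gr.assoc minus_mult)

lemma Ad_mult: "Ad x (y \<odot> z) = Ad x y \<odot> Ad x z"
  by (simp add: Ad_def gr.assoc)

lemma Ad_Ad: "Ad (Ad z x) (Ad z y) = Ad z (Ad x y)"
  by (simp add: Ad_def gr.assoc minus_mult)

lemma Ad_differentiable: "(\<lambda>p. Ad (fst p) (snd p)) differentiable (at p)"
  unfolding Ad_def by (intro mult_differentiable_compose differentiable_minus) (auto intro!: derivative_eq_intros exI simp: differentiable_def)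

text \<open>Conjugation by \<open>x\<close> carries the line through \<open>y\<close> to a
  one-parameter subgroup; uniqueness identifies it with the line along its initial velocity, and
  evaluation at time \<open>1\<close> gives the formula.\<close>

lemma Ad_eq_derivative: "Ad x y = frechet_derivative (Ad x) (at 0) y"
proof -
  have "(\<lambda>y. (\<lambda>p. Ad (fst p) (snd p)) (x, y)) differentiable (at 0)"
    by (rule differentiable_compose[of "\<lambda>p. Ad (fst p) (snd p)" "\<lambda>y. (x, y)", OF Ad_differentiable])
      (auto intro!: derivative_eq_intros exI simp: differentiable_def)
  then have der: "(Ad x has_derivative frechet_derivative (Ad x) (at 0)) (at 0)"
    by (simp add: frechet_derivative_works[symmetric])
  interpret bounded_linear "frechet_derivative (Ad x) (at 0)"
    using der by (rule has_derivative_bounded_linear)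
  have "((\<lambda>t. t *\<^sub>R y) has_derivative (\<lambda>t. t *\<^sub>R y)) (at 0)"
    by (auto intro!: derivative_eq_intros)
  from has_derivative_compose[OF this, of "Ad x" "frechet_derivative (Ad x) (at 0)"] der
  have "((\<lambda>t. Ad x (t *\<^sub>R y)) has_vector_derivative frechet_derivative (Ad x) (at 0) y) (at 0)"
    by (simp add: has_vector_derivative_def scaleR)
  moreover have "Ad x ((s + t) *\<^sub>R y) = Ad x (s *\<^sub>R y) \<odot> Ad x (t *\<^sub>R y)" for s t
    by (metis Ad_mult line_mult)
  ultimately have "one_parameter_subgroup G (\<lambda>t. Ad x (t *\<^sub>R y)) (frechet_derivative (Ad x) (at 0) y)"
    by (simp add: one_parameter_subgroup_def)
  from one_parameter_subgroup_unique[OF this, of 1] show ?thesis by simp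
qed

lemma linear_Ad: "linear (Ad x)"
proof -
  have "(\<lambda>y. (\<lambda>p. Ad (fst p) (snd p)) (x, y)) differentiable (at 0)"
    by (rule differentiable_compose[of "\<lambda>p. Ad (fst p) (snd p)" "\<lambda>y. (x, y)", OF Ad_differentiable])
      (auto intro!: derivative_eq_intros exI simp: differentiable_def)
  then have der: "(Ad x has_derivative frechet_derivative (Ad x) (at 0)) (at 0)"
    by (simp add: frechet_derivative_works[symmetric])
  have "Ad x = frechet_derivative (Ad x) (at 0)"
    using Ad_eq_derivative by blast
  then show ?thesis
    using has_derivative_bounded_linear[OF der] bounded_linear.linear by metis
qed

lemma Ad_expand: "Ad x u = (\<Sum>b\<in>Basis. (u \<bullet> b) *\<^sub>R Ad x b)"
proof -
  have "Ad x u = Ad x (\<Sum>b\<in>Basis. (u \<bullet> b) *\<^sub>R b)" by (simp add: euclidean_representation)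
  also have "\<dots> = (\<Sum>b\<in>Basis. (u \<bullet> b) *\<^sub>R Ad x b)"
    using linear_Ad by (simp add: linear_sum linear_cmul)
  finally show ?thesis .
qed

text \<open>Infinitesimal conjugation. \<open>lie_bracket_eq\<close> identifies it with the bracket
  of left-invariant fields, while its algebraic laws are derived from \<open>Ad\<close>.\<close>

definition ad :: "'a \<Rightarrow> 'a \<Rightarrow> 'a" where "ad x y = frechet_derivative (\<lambda>z. Ad z y) (at 0) x"

lemma Ad_has_derivative: "((\<lambda>z. Ad z y) has_derivative (\<lambda>x. ad x y)) (at 0)"
proof -
  have "(\<lambda>z. (\<lambda>p. Ad (fst p) (snd p)) (z, y)) differentiable (at 0)"
    by (rule differentiable_compose[of "\<lambda>p. Ad (fst p) (snd p)" "\<lambda>z. (z, y)", OF Ad_differentiable])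
      (auto intro!: derivative_eq_intros exI simp: differentiable_def)
  then show ?thesis
    unfolding ad_def by (simp add: frechet_derivative_works[symmetric])
qed

lemma linear_ad_left: "linear (\<lambda>x. ad x y)"
  using Ad_has_derivative has_derivative_bounded_linear bounded_linear.linear by blast

lemma linear_ad_right: "linear (ad x)"
proof (rule linearI)
  fix y z c
  have "((\<lambda>w. Ad w (y + z)) has_derivative (\<lambda>x. ad x y + ad x z)) (at 0)"
    using has_derivative_add[OF Ad_has_derivative Ad_has_derivative, of y z] linear_Ad
    by (simp add: linear_add)
  then show "ad x (y + z) = ad x y + ad x z"
    using has_derivative_unique[OF Ad_has_derivative[of "y + z"]] by metis
  have "((\<lambda>w. Ad w (c *\<^sub>R y)) has_derivative (\<lambda>x. c *\<^sub>R ad x y)) (at 0)"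
    using has_derivative_scaleR_right[OF Ad_has_derivative, of c y] linear_Ad
    by (simp add: linear_cmul)
  then show "ad x (c *\<^sub>R y) = c *\<^sub>R ad x y"
    using has_derivative_unique[OF Ad_has_derivative[of "c *\<^sub>R y"]] by metis
qed

lemma bounded_bilinear_ad: "bounded_bilinear ad"
  using linear_ad_left linear_ad_right
  by (simp add: bilinear_conv_bounded_bilinear[symmetric] bilinear_def)

text \<open>A product rule at a time when \<open>a\<close> is at the identity. Expanding the second
  argument in the basis separates the dependence on \<open>a\<close> from the linear dependence on
  \<open>b\<close>.\<close>

lemma Ad_has_vector_derivative:
  assumes a: "(a has_vector_derivative a') (at s)" and b: "(b has_vector_derivative b') (at s)"
    and a0: "a s = 0"
  shows "((\<lambda>s. Ad (a s) (b s)) has_vector_derivative ad a' (b s) + b') (at s)"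
proof -
  have 1: "((\<lambda>s. Ad (a s) i) has_vector_derivative ad a' i) (at s)" for i
    using has_derivative_compose[OF a[unfolded has_vector_derivative_def], of "\<lambda>z. Ad z i" "\<lambda>x. ad x i"]
      Ad_has_derivative[of i] a0
    by (simp add: has_vector_derivative_def linear_cmul[OF linear_ad_left])
  have "((\<lambda>s. \<Sum>i\<in>Basis. (b s \<bullet> i) *\<^sub>R Ad (a s) i) has_vector_derivative
      (\<Sum>i\<in>Basis. (b s \<bullet> i) *\<^sub>R ad a' i + (b' \<bullet> i) *\<^sub>R Ad (a s) i)) (at s)"
  proof (rule has_vector_derivative_sum)
    fix i :: 'a assume "i \<in> Basis"
    have "((\<lambda>s. b s \<bullet> i) has_field_derivative (b' \<bullet> i)) (at s)"
      using bounded_linear.has_vector_derivative[OF bounded_linear_inner_left b, of i]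
      by (simp add: has_real_derivative_iff_has_vector_derivative)
    from has_vector_derivative_scaleR[OF this 1[of i]]
    show "((\<lambda>s. (b s \<bullet> i) *\<^sub>R Ad (a s) i) has_vector_derivative
      (b s \<bullet> i) *\<^sub>R ad a' i + (b' \<bullet> i) *\<^sub>R Ad (a s) i) (at s)" .
  qed
  moreover have "(\<Sum>i\<in>Basis. (b s \<bullet> i) *\<^sub>R ad a' i + (b' \<bullet> i) *\<^sub>R Ad (a s) i) = ad a' (b s) + b'"
  proof -
    have "(\<Sum>i\<in>Basis. (b s \<bullet> i) *\<^sub>R ad a' i) = ad a' (\<Sum>i\<in>Basis. (b s \<bullet> i) *\<^sub>R i)"
      using linear_ad_right[of a'] by (simp add: linear_sum linear_cmul)
    then show ?thesis
      by (simp add: sum.distrib a0 euclidean_representation)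
  qed
  ultimately show ?thesis by (simp add: Ad_expand[symmetric])
qed

lemma scaled_has_vector_derivative: "((\<lambda>s. s *\<^sub>R x) has_vector_derivative x) (at s within S)"
  by (auto intro!: derivative_eq_intros)

lemma Ad_line: "((\<lambda>s. Ad (s *\<^sub>R x) y) has_vector_derivative ad x y) (at 0)"
  using Ad_has_vector_derivative[OF scaled_has_vector_derivative[of x 0] has_vector_derivative_const[of y]] by simp

text \<open>Conjugation is a linear automorphism, so \<open>Ad_Ad\<close> may be differentiated
  along a line in \<open>x\<close>.\<close>

lemma Ad_ad: "Ad z (ad x y) = ad (Ad z x) (Ad z y)"
proof -
  have "((\<lambda>s. Ad z (Ad (s *\<^sub>R x) y)) has_vector_derivative Ad z (ad x y)) (at 0)"
    by (intro bounded_linear.has_vector_derivative[OF _ Ad_line])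
      (simp add: linear_conv_bounded_linear[symmetric] linear_Ad)
  moreover have "Ad z (Ad (s *\<^sub>R x) y) = Ad (s *\<^sub>R Ad z x) (Ad z y)" for s
    by (simp add: Ad_Ad linear_cmul[OF linear_Ad, symmetric])
  ultimately show ?thesis
    by (intro vector_derivative_unique_at[OF _ Ad_line[of "Ad z x" "Ad z y"]]) simp
qed

text \<open>The derivative of \<open>Ad_ad\<close> along \<open>z = s *\<^sub>R u\<close> at
  \<open>s = 0\<close>.\<close>

lemma jacobi: "ad u (ad x y) = ad (ad u x) y + ad x (ad u y)"
proof -
  have "((\<lambda>s. ad (Ad (s *\<^sub>R u) x) (Ad (s *\<^sub>R u) y)) has_vector_derivative
      ad (Ad (0 *\<^sub>R u) x) (ad u y) + ad (ad u x) (Ad (0 *\<^sub>R u) y)) (at 0)"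
    by (rule bounded_bilinear.has_vector_derivative[OF bounded_bilinear_ad Ad_line Ad_line])
  then have "((\<lambda>s. Ad (s *\<^sub>R u) (ad x y)) has_vector_derivative
      ad x (ad u y) + ad (ad u x) y) (at 0)"
    by (simp add: Ad_ad)
  from vector_derivative_unique_at[OF this Ad_line] show ?thesis by (simp add: add.commute)
qed

text \<open>Points on one line through the identity commute, so the conjugation curve is
  constant.\<close>

lemma ad_self: "ad x x = 0"
proof -
  have "Ad (s *\<^sub>R x) x = x" for s
    using line_mult[of s x 1] line_mult[of "s + 1" x "- s"] by (simp add: Ad_def)
  then have "((\<lambda>s. x) has_vector_derivative ad x x) (at (0::real))"
    using Ad_line[of x x] by simp
  then show ?thesis using vector_derivative_unique_at has_vector_derivative_const by blast
qed

lemma ad_skew: "ad x y = - ad y x"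
proof -
  interpret bounded_bilinear ad by (rule bounded_bilinear_ad)
  have "ad (x + y) (x + y) = ad x y + ad y x"
    unfolding add_left add_right by (simp add: ad_self)
  then show ?thesis by (simp add: ad_self eq_neg_iff_add_eq_0 del: add_eq_0_iff)
qed

text \<open>Inversion is negation and turns right multiplication by \<open>y\<close> into left
  multiplication by \<open>- y\<close>; this is why the field is evaluated at
  \<open>- y\<close>.\<close>

lemma right_mult_has_vector_derivative:
  "((\<lambda>r. (r *\<^sub>R u) \<odot> y) has_vector_derivative X u (- y)) (at 0)"
proof -
  have "((\<lambda>r. - ((- y) \<odot> (r *\<^sub>R (- u)))) has_vector_derivative - X (- u) (- y)) (at 0)"
    using has_vector_derivative_minus[OF line_has_vector_derivative[of "- y" "- u" 0]] by simp
  then show ?thesis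
    using linear_neg[OF linear_X[of "- y"], of u] by (simp add: minus_mult)
qed

text \<open>The curve \<open>v \<odot> (r *\<^sub>R w)\<close> is also
  \<open>(r *\<^sub>R Ad v w) \<odot> v\<close>; the two sides are its velocity at
  \<open>r = 0\<close>, computed from a left and from a right translate.\<close>

lemma X_Ad: "X w v = X (Ad v w) (- v)"
proof -
  have "v \<odot> (r *\<^sub>R w) = (r *\<^sub>R Ad v w) \<odot> v" for r
    using linear_Ad[of v] by (simp add: linear_cmul[symmetric]) (simp add: Ad_def gr.assoc)
  then have "((\<lambda>r. v \<odot> (r *\<^sub>R w)) has_vector_derivative X (Ad v w) (- v)) (at 0)"
    using right_mult_has_vector_derivative by simp
  moreover have "((\<lambda>r. v \<odot> (r *\<^sub>R w)) has_vector_derivative X w v) (at 0)"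
    using line_has_vector_derivative[of v w 0] by simp
  ultimately show ?thesis using vector_derivative_unique_at by blast
qed

text \<open>Differentiating \<open>X w (s v) = X (Ad (s v) w) (- s v)\<close> at \<open>s = 0\<close> shows that the derivative of
  \<open>X w\<close> at \<open>0\<close> is half the adjoint action, without using symmetry of second derivatives.\<close>

lemma frechet_derivative_X: "2 *\<^sub>R frechet_derivative (X w) (at 0) v = ad v w"
proof -
  define \<beta> where "\<beta> u = frechet_derivative (X u) (at 0)" for u
  have \<beta>: "(X u has_derivative \<beta> u) (at 0)" for u
    using X_differentiable frechet_derivative_works unfolding \<beta>_def by blast
  have lin: "linear (\<beta> u)" for u
    using \<beta> has_derivative_bounded_linear bounded_linear.linear by blast
  have \<beta>v: "((\<lambda>s. X u (s *\<^sub>R z)) has_vector_derivative \<beta> u z) (at 0)" for u z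
    using has_derivative_compose[OF scaled_has_vector_derivative[of z 0 UNIV, unfolded has_vector_derivative_def], of "X u" "\<beta> u"]
      \<beta>[of u] lin[of u] by (simp add: has_vector_derivative_def linear_cmul)
  have 1: "((\<lambda>s. \<Sum>i\<in>Basis. (Ad (s *\<^sub>R v) w \<bullet> i) *\<^sub>R X i (s *\<^sub>R (- v))) has_vector_derivative
      (\<Sum>i\<in>Basis. (Ad (0 *\<^sub>R v) w \<bullet> i) *\<^sub>R \<beta> i (- v) + (ad v w \<bullet> i) *\<^sub>R X i (0 *\<^sub>R (- v)))) (at 0)"
  proof (rule has_vector_derivative_sum)
    fix i :: 'a assume "i \<in> Basis"
    have "((\<lambda>s. Ad (s *\<^sub>R v) w \<bullet> i) has_field_derivative (ad v w \<bullet> i)) (at 0)"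
      using bounded_linear.has_vector_derivative[OF bounded_linear_inner_left Ad_line, of v w i]
      by (simp add: has_real_derivative_iff_has_vector_derivative)
    from has_vector_derivative_scaleR[OF this \<beta>v[of i "- v"]]
    show "((\<lambda>s. (Ad (s *\<^sub>R v) w \<bullet> i) *\<^sub>R X i (s *\<^sub>R (- v))) has_vector_derivative
       (Ad (0 *\<^sub>R v) w \<bullet> i) *\<^sub>R \<beta> i (- v) + (ad v w \<bullet> i) *\<^sub>R X i (0 *\<^sub>R (- v))) (at 0)" .
  qed
  have 2: "(\<Sum>i\<in>Basis. (Ad (s *\<^sub>R v) w \<bullet> i) *\<^sub>R X i (s *\<^sub>R (- v))) = X w (s *\<^sub>R v)" for s
    using X_Ad[of w "s *\<^sub>R v"] X_expand[of "Ad (s *\<^sub>R v) w" "- (s *\<^sub>R v)"] by simp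
  have "\<beta> w z = (\<Sum>i\<in>Basis. (w \<bullet> i) *\<^sub>R \<beta> i z)" for z
  proof -
    have "((\<lambda>x. \<Sum>i\<in>Basis. (w \<bullet> i) *\<^sub>R X i x) has_derivative (\<lambda>z. \<Sum>i\<in>Basis. (w \<bullet> i) *\<^sub>R \<beta> i z)) (at 0)"
      using \<beta> by (auto intro!: derivative_eq_intros)
    moreover have "(\<lambda>x. \<Sum>i\<in>Basis. (w \<bullet> i) *\<^sub>R X i x) = X w" using X_expand[of w] by auto
    ultimately show ?thesis using has_derivative_unique[OF \<beta>[of w]] by metis
  qed
  then have "(\<Sum>i\<in>Basis. (Ad (0 *\<^sub>R v) w \<bullet> i) *\<^sub>R \<beta> i (- v) + (ad v w \<bullet> i) *\<^sub>R X i (0 *\<^sub>R (- v)))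
      = - \<beta> w v + ad v w"
    using lin by (simp add: sum.distrib sum_subtractf linear_neg X_zero euclidean_representation sum_negf)
  with 1 2 have "((\<lambda>s. X w (s *\<^sub>R v)) has_vector_derivative - \<beta> w v + ad v w) (at 0)"
    by simp
  \<comment> \<open>The sign coming from \<open>- v\<close> brings a second copy of
    \<open>\<beta> w v\<close> to the left side, hence the factor two.\<close>
  from vector_derivative_unique_at[OF this \<beta>v] have "\<beta> w v + \<beta> w v = ad v w"
    by (simp add: algebra_simps)
  then show ?thesis unfolding \<beta>_def by (simp add: scaleR_2)
qed

text \<open>Each derivative in the bracket of fields is half of \<open>ad\<close>, and skew symmetry
  adds the two halves up.\<close>

lemma lie_bracket_eq: "lie_bracket G v w = ad v w"
proof -
  have *: "left_invariant_field G u = X u" for u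
    by (simp add: left_invariant_field_def X_def fun_eq_iff)
  have "2 *\<^sub>R lie_bracket G v w = ad v w - ad w v"
    unfolding lie_bracket_def vector_field_bracket_def *
    by (simp add: scaleR_diff_right frechet_derivative_X X_zero)
  also have "\<dots> = 2 *\<^sub>R ad v w" using ad_skew[of w v] by (simp add: scaleR_2)
  finally show ?thesis by simp
qed


section \<open>Flows of left-invariant fields, the derivative of exp, and homomorphisms\<close>

lemma flow_unique:
  assumes c: "\<And>s. (c has_vector_derivative X w (c s)) (at s)"
  shows "c s = c 0 \<odot> (s *\<^sub>R w)"
proof -
  \<comment> \<open>The expected motion is undone, so that \<open>p\<close> should be constant. Its
    derivative is computed after translating \<open>c s\<close> to the identity, where
    \<open>DM_zero\<close> applies.\<close>
  define p where "p s = c s \<odot> ((- s) *\<^sub>R w)" for s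
  have "(p has_vector_derivative 0) (at s)" for s
  proof (rule has_vector_derivative_shift0)
    define e where "e q = (- c s) \<odot> c (s + q)" for q
    have "((\<lambda>q. s + q) has_vector_derivative 1) (at 0)"
      by (auto intro!: derivative_eq_intros)
    then have "((\<lambda>q. c (s + q)) has_vector_derivative X w (c s)) (at 0)"
      using vector_diff_chain_at[of "\<lambda>q. s + q" 1 0 c "X w (c s)"] c[of s] by (simp add: o_def)
    from mult_has_vector_derivative[OF has_vector_derivative_const[of "- c s"] this]
    have e: "(e has_vector_derivative w) (at 0)"
      using to_layer_X[of "c s" w] by (simp add: e_def[abs_def] to_layer_def ginv_eq dtau_eq)
    have "((\<lambda>q. (- q) *\<^sub>R w) has_vector_derivative - w) (at 0)"
      by (auto intro!: derivative_eq_intros)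
    from mult_has_vector_derivative[OF e this]
    have "((\<lambda>q. e q \<odot> ((- q) *\<^sub>R w)) has_vector_derivative 0) (at 0)"
      by (simp add: e_def DM_zero)
    then have "((\<lambda>q. c s \<odot> (e q \<odot> ((- q) *\<^sub>R w))) has_vector_derivative X 0 (c s)) (at 0)"
      by (rule left_mult_has_vector_derivative) (simp add: e_def)
    from mult_has_vector_derivative[OF this has_vector_derivative_const[of "(- s) *\<^sub>R w"]]
    have "((\<lambda>q. c s \<odot> (e q \<odot> ((- q) *\<^sub>R w)) \<odot> ((- s) *\<^sub>R w)) has_vector_derivative 0) (at 0)"
      using linear_0[OF linear_X] linear_0[OF linear_DM] by (simp add: zero_prod_def)
    moreover have "c s \<odot> (e q \<odot> ((- q) *\<^sub>R w)) \<odot> ((- s) *\<^sub>R w) = p (s + q)" for q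
    proof -
      have "(- q *\<^sub>R w) \<odot> (- s *\<^sub>R w) = (- s - q) *\<^sub>R w"
        by (subst line_mult) (simp add: algebra_simps)
      then show ?thesis
        by (simp add: p_def e_def gr.assoc)
    qed
    ultimately show "((\<lambda>q. p (s + q)) has_vector_derivative 0) (at 0)" by simp
  qed
  then have "p s = p 0"
    using has_vector_derivative_eq_unique[of p "\<lambda>_. 0" "\<lambda>_. p 0" s] by simp
  then have "p s \<odot> (s *\<^sub>R w) = c 0 \<odot> (s *\<^sub>R w)" by (simp add: p_def)
  then show ?thesis by (simp add: p_def gr.assoc line_mult)
qed

lemma continuous_to_layer_line: "isCont (\<lambda>q. to_layer G (q *\<^sub>R y) h) 0"
proof -
  have "isCont (\<lambda>p. DM p (0, h)) (- (0 *\<^sub>R y), 0 *\<^sub>R y)"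
    by (rule differentiable_imp_continuous_within[OF DM_differentiable])
  moreover have "isCont (\<lambda>q. (- (q *\<^sub>R y), q *\<^sub>R y)) 0"
    by (auto intro!: continuous_intros)
  ultimately have "isCont (\<lambda>q. DM (- (q *\<^sub>R y), q *\<^sub>R y) (0, h)) 0"
    using isCont_o2[of 0 "\<lambda>q. (- (q *\<^sub>R y), q *\<^sub>R y)" "\<lambda>p. DM p (0, h)"] by blast
  then show ?thesis by (simp add: to_layer_def ginv_eq dtau_eq)
qed

text \<open>The derivative of the exponential map: \<open>to_layer (r y) (r h)\<close> is the derivative at \<open>\<epsilon> = 0\<close> of
  \<open>exp (- r y) exp (r (y + \<epsilon> h))\<close>, which is a cocycle in \<open>r\<close> for the adjoint action.\<close>

lemma to_layer_line_has_vector_derivative: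
  "((\<lambda>r. to_layer G (r *\<^sub>R y) (r *\<^sub>R h)) has_vector_derivative Ad ((- r) *\<^sub>R y) h) (at r)"
proof (rule has_vector_derivative_shift0)
  define A where "A r = to_layer G (r *\<^sub>R y) (r *\<^sub>R h)" for r
  have A: "((\<lambda>e. ((- r) *\<^sub>R y) \<odot> (r *\<^sub>R (y + e *\<^sub>R h))) has_vector_derivative A r) (at 0)" for r
  proof -
    have "((\<lambda>e. r *\<^sub>R (y + e *\<^sub>R h)) has_vector_derivative r *\<^sub>R h) (at 0)"
      by (auto intro!: derivative_eq_intros)
    from mult_has_vector_derivative[OF has_vector_derivative_const[of "(- r) *\<^sub>R y"] this]
    show ?thesis by (simp add: A_def to_layer_def ginv_eq dtau_eq)
  qed
  \<comment> \<open>With \<open>z = y + e *\<^sub>R h\<close>, the product for \<open>r + q\<close>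
    splits into the product for \<open>q\<close> conjugated by \<open>(- r) *\<^sub>R y\<close>,
    times the product for \<open>r\<close>; this is differentiated in \<open>e\<close>.\<close>
  have cocycle: "A (r + q) = A r + Ad ((- r) *\<^sub>R y) (A q)" for r q
  proof -
    define g where "g r e = ((- r) *\<^sub>R y) \<odot> (r *\<^sub>R (y + e *\<^sub>R h))" for r e
    have "((\<lambda>e. Ad ((- r) *\<^sub>R y) (g q e)) has_vector_derivative Ad ((- r) *\<^sub>R y) (A q)) (at 0)"
      using A[of q] unfolding g_def
      by (intro bounded_linear.has_vector_derivative[where f = "Ad ((- r) *\<^sub>R y)"])
        (simp_all add: linear_conv_bounded_linear[symmetric] linear_Ad)
    from mult_has_vector_derivative[OF this A[of r]]
    have "((\<lambda>e. Ad ((- r) *\<^sub>R y) (g q e) \<odot> g r e) has_vector_derivative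
        Ad ((- r) *\<^sub>R y) (A q) + A r) (at 0)"
      by (simp add: g_def DM_zero)
    moreover have "Ad ((- r) *\<^sub>R y) (g q e) \<odot> g r e = g (r + q) e" for e
    proof -
      define z where "z = y + e *\<^sub>R h"
      have "(q *\<^sub>R z) \<odot> (r *\<^sub>R z) = (r + q) *\<^sub>R z" by (subst line_mult) (simp add: add.commute)
      moreover have "((- r) *\<^sub>R y) \<odot> (((- q) *\<^sub>R y) \<odot> w) = ((- (r + q)) *\<^sub>R y) \<odot> w" for w
        by (subst gr.assoc[symmetric], subst line_mult) simp
      moreover have "(r *\<^sub>R y) \<odot> (((- r) *\<^sub>R y) \<odot> w) = w" for w
        by (subst gr.assoc[symmetric], subst line_mult) simp
      ultimately show ?thesis
        unfolding g_def z_def[symmetric] Ad_def by (simp add: gr.assoc)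
    qed
    ultimately have "((\<lambda>e. g (r + q) e) has_vector_derivative Ad ((- r) *\<^sub>R y) (A q) + A r) (at 0)"
      by simp
    then show ?thesis
      using A[of "r + q"] vector_derivative_unique_at unfolding g_def by (metis add.commute)
  qed
  \<comment> \<open>The cocycle identity reduces the derivative at any \<open>r\<close> to the one
    at \<open>0\<close>, where the difference quotient of \<open>A\<close> is
    \<open>to_layer G (q *\<^sub>R y) h\<close> by linearity.\<close>
  have "(A has_vector_derivative h) (at 0)"
  proof -
    have "(\<lambda>q. to_layer G (q *\<^sub>R y) h) \<midarrow>0\<rightarrow> h"
      using continuous_to_layer_line[of y h] to_layer_X[of 0 h]
      by (simp add: isCont_def X_zero)
    then have lim: "(\<lambda>q. norm (to_layer G (q *\<^sub>R y) h - h)) \<midarrow>0\<rightarrow> 0"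
      by (intro tendsto_norm_zero LIM_zero)
    have "norm (A (0 + q) - A 0 - q *\<^sub>R h) / norm q = norm (to_layer G (q *\<^sub>R y) h - h)" if "q \<noteq> 0" for q
    proof -
      have "A (0 + q) - A 0 - q *\<^sub>R h = q *\<^sub>R (to_layer G (q *\<^sub>R y) h - h)"
        by (simp add: A_def linear_cmul[OF linear_to_layer] linear_0[OF linear_to_layer] scaleR_diff_right)
      then show ?thesis using that by simp
    qed
    then have "(\<lambda>q. norm (A (0 + q) - A 0 - q *\<^sub>R h) / norm q) \<midarrow>0\<rightarrow> 0"
      by (intro Lim_transform_eventually[OF lim]) (auto simp: eventually_at_filter)
    then show ?thesis
      by (simp add: has_vector_derivative_def has_derivative_at bounded_linear_scaleR_left)
  qed
  then have "((\<lambda>q. Ad ((- r) *\<^sub>R y) (A q)) has_vector_derivative Ad ((- r) *\<^sub>R y) h) (at 0)"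
    by (intro bounded_linear.has_vector_derivative[where f = "Ad ((- r) *\<^sub>R y)"])
      (simp_all add: linear_conv_bounded_linear[symmetric] linear_Ad)
  from has_vector_derivative_add[OF has_vector_derivative_const[of "A r"] this]
  have "((\<lambda>q. A (r + q)) has_vector_derivative Ad ((- r) *\<^sub>R y) h) (at 0)"
    by (simp add: cocycle)
  then show "((\<lambda>q. to_layer G ((r + q) *\<^sub>R y) ((r + q) *\<^sub>R h)) has_vector_derivative
      Ad ((- r) *\<^sub>R y) h) (at 0)"
    by (simp add: A_def)
qed

text \<open>Compatibility with \<open>ad\<close> is integrated along lines to compatibility with
  \<open>Ad\<close>, then to compatibility with the derivative of the exponential map and so with
  the fields \<open>X\<close>. Hence \<open>D\<close> sends integral curves to integral curves, and
  \<open>flow_unique\<close> identifies the images.\<close>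

lemma Lie_hom_imp_group_hom:
  assumes lin: "linear D" and hom: "\<And>x y. D (ad x y) = ad (D x) (D y)"
  shows "D (x \<odot> y) = D x \<odot> D y"
proof -
  have bl: "bounded_linear D" using lin by (simp add: linear_conv_bounded_linear)
  have Ad: "D (Ad x v) = Ad (D x) (D v)" for x v
  proof -
    \<comment> \<open>Undoing the expected conjugation should leave a constant; the derivative
      vanishes because \<open>D\<close> respects \<open>ad\<close>.\<close>
    define p where "p t = Ad ((- t) *\<^sub>R D x) (D (Ad (t *\<^sub>R x) v))" for t
    have "(p has_vector_derivative 0) (at t)" for t
    proof (rule has_vector_derivative_shift0)
      define u where "u = Ad (t *\<^sub>R x) v"
      have 1: "((\<lambda>s. (- s) *\<^sub>R D x) has_vector_derivative - D x) (at 0)"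
        by (auto intro!: derivative_eq_intros)
      have 2: "((\<lambda>s. D (Ad (s *\<^sub>R x) u)) has_vector_derivative D (ad x u)) (at 0)"
        by (rule bounded_linear.has_vector_derivative[OF bl Ad_line])
      have "((\<lambda>s. Ad ((- s) *\<^sub>R D x) (D (Ad (s *\<^sub>R x) u))) has_vector_derivative 0) (at 0)"
        using Ad_has_vector_derivative[OF 1 2] linear_neg[OF linear_ad_left] by (simp add: hom)
      then have "((\<lambda>s. Ad ((- t) *\<^sub>R D x) (Ad ((- s) *\<^sub>R D x) (D (Ad (s *\<^sub>R x) u))))
          has_vector_derivative Ad ((- t) *\<^sub>R D x) 0) (at 0)"
        by (intro bounded_linear.has_vector_derivative[where f = "Ad ((- t) *\<^sub>R D x)"])
          (simp_all add: linear_conv_bounded_linear[symmetric] linear_Ad)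
      moreover have "Ad ((- t) *\<^sub>R D x) (Ad ((- s) *\<^sub>R D x) (D (Ad (s *\<^sub>R x) u))) = p (t + s)" for s
        unfolding u_def p_def Ad_comp[symmetric] line_mult by (simp add: add.commute)
      ultimately show "((\<lambda>s. p (t + s)) has_vector_derivative 0) (at 0)" by simp
    qed
    then have "p 1 = p 0"
      using has_vector_derivative_eq_unique[of p "\<lambda>_. 0" "\<lambda>_. p 0" 1] by simp
    then have "Ad (D x) (Ad (- D x) (D (Ad x v))) = Ad (D x) (D v)" by (simp add: p_def)
    then show ?thesis by (simp add: Ad_comp[symmetric])
  qed
  have "D (to_layer G y h) = to_layer G (D y) (D h)" for y h
  proof -
    have "D (to_layer G (r *\<^sub>R y) (r *\<^sub>R h)) = to_layer G (r *\<^sub>R D y) (r *\<^sub>R D h)" for r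
    proof (rule has_vector_derivative_eq_unique)
      show "((\<lambda>r. D (to_layer G (r *\<^sub>R y) (r *\<^sub>R h))) has_vector_derivative D (Ad ((- t) *\<^sub>R y) h)) (at t)" for t
        by (rule bounded_linear.has_vector_derivative[OF bl to_layer_line_has_vector_derivative])
      show "((\<lambda>r. to_layer G (r *\<^sub>R D y) (r *\<^sub>R D h)) has_vector_derivative D (Ad ((- t) *\<^sub>R y) h)) (at t)" for t
        using to_layer_line_has_vector_derivative[of "D y" "D h" t] by (simp add: Ad linear_cmul[OF lin] linear_neg[OF lin])
    qed (simp add: linear_0[OF linear_to_layer] linear_0[OF lin])
    from this[of 1] show ?thesis by simp
  qed
  from this[of z "X w z" for z w] have DX: "D (X w z) = X (D w) (D z)" for w z
    using X_to_layer[of "D z" "D (X w z)"] by (simp add: to_layer_X)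
  have "D (x \<odot> (s *\<^sub>R y)) = D (x \<odot> (0 *\<^sub>R y)) \<odot> (s *\<^sub>R D y)" for s
  proof (rule flow_unique)
    show "((\<lambda>s. D (x \<odot> (s *\<^sub>R y))) has_vector_derivative X (D y) (D (x \<odot> (s *\<^sub>R y)))) (at s)" for s
      using bounded_linear.has_vector_derivative[OF bl line_has_vector_derivative[of x y s UNIV]] by (simp add: DX)
  qed
  from this[of 1] show ?thesis by simp
qed

subsection \<open>Grading and dilations\<close>

text \<open>Extended by \<open>{0}\<close> outside the index range, so that the grading rule
  \<open>ad_L\<close> also covers sums of indices beyond the step.\<close>

definition L :: "nat \<Rightarrow> 'a set" where "L i = (if i \<in> {1..step G} then layer G i else {0})"

lemma subspace_L: "subspace (L i)" using layer_subspace by (auto simp: L_def)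

lemma ad_L1:
  assumes "v \<in> L 1" "w \<in> L j" "1 \<le> j" shows "ad v w \<in> L (Suc j)"
proof -
  have v: "v \<in> layer G 1" using assms(1) step_pos by (simp add: L_def)
  consider "j < step G" | "j = step G" | "j > step G" by linarith
  then show ?thesis
  proof cases
    case 1
    then have "ad v w \<in> {lie_bracket G v w |v w. v \<in> layer G 1 \<and> w \<in> layer G j}"
      using v assms by (auto simp: L_def lie_bracket_eq)
    then have "ad v w \<in> layer G (Suc j)"
      unfolding bracket_layer[OF assms(3) 1, symmetric] by (rule span_base)
    then show ?thesis using 1 by (simp add: L_def)
  next
    case 2
    then have "w \<in> layer G (step G)" using assms by (auto simp: L_def)
    then show ?thesis using bracket_last[OF v] 2 by (simp add: L_def lie_bracket_eq)
  next
    case 3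
    then show ?thesis using assms linear_0[OF linear_ad_right] by (simp add: L_def)
  qed
qed

text \<open>The axioms control brackets with the first layer only. Layer \<open>Suc i\<close> is
  spanned by elements \<open>ad a b\<close> with \<open>a\<close> in the first layer, and Jacobi
  rewrites \<open>ad (ad a b) w\<close> by brackets that the induction hypothesis controls; one of
  them has \<open>ad a w\<close> in place of \<open>w\<close>, so \<open>j\<close> and
  \<open>w\<close> stay general.\<close>

lemma ad_L:
  assumes "1 \<le> i" "1 \<le> j" "v \<in> L i" "w \<in> L j" shows "ad v w \<in> L (i + j)"
  using assms
proof (induction i arbitrary: j v w rule: nat_induct_at_least)
  case base
  then show ?case using ad_L1 by simp
next
  case (Suc i)
  show ?case
  proof (cases "Suc i \<le> step G")
    case False
    then show ?thesis
      using Suc.prems linear_0[OF linear_ad_left] subspace_0[OF subspace_L] by (simp add: L_def)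
  next
    case True
    define S where "S = {v. ad v w \<in> L (Suc i + j)}"
    have "subspace S"
      unfolding S_def subspace_def
      using subspace_L[of "Suc i + j"] linear_0[OF linear_ad_left] linear_add[OF linear_ad_left]
        linear_cmul[OF linear_ad_left] by (simp add: subspace_def)
    moreover have "{lie_bracket G v w |v w. v \<in> layer G 1 \<and> w \<in> layer G i} \<subseteq> S"
    proof safe
      fix a b assume a: "a \<in> layer G 1" and b: "b \<in> layer G i"
      have a: "a \<in> L 1" and b: "b \<in> L i"
        using a b True Suc.hyps by (auto simp: L_def)
      have "ad a (ad b w) \<in> L (Suc (i + j))"
        using ad_L1[OF a Suc.IH[OF Suc.prems(1) b Suc.prems(3)]] Suc.prems(1) by simp
      moreover have "ad b (ad a w) \<in> L (i + Suc j)"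
        using Suc.IH[OF _ b ad_L1[OF a Suc.prems(3,1)]] by simp
      ultimately have "ad a (ad b w) - ad b (ad a w) \<in> L (Suc i + j)"
        using subspace_diff[OF subspace_L] by simp
      then show "lie_bracket G a b \<in> S"
        using jacobi[of a b w] by (simp add: S_def lie_bracket_eq)
    qed
    ultimately have "layer G (Suc i) \<subseteq> S"
      using span_minimal[of _ S] bracket_layer[OF Suc.hyps Suc_le_lessD[OF True]] by (metis (no_types, lifting))
    then show ?thesis using Suc.prems True by (auto simp: S_def L_def)
  qed
qed

definition component :: "'a \<Rightarrow> nat \<Rightarrow> 'a" where
  "component x = (THE f. f \<in> (\<Pi>\<^sub>E i\<in>{1..step G}. layer G i) \<and> x = (\<Sum>i=1..step G. f i))"

lemma component: "component x \<in> (\<Pi>\<^sub>E i\<in>{1..step G}. layer G i)" "x = (\<Sum>i=1..step G. component x i)"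
  using theI'[OF direct_sum, of x] unfolding component_def by auto

lemma component_eqI:
  assumes "\<And>i. i \<in> {1..step G} \<Longrightarrow> f i \<in> layer G i" "x = (\<Sum>i=1..step G. f i)" "i \<in> {1..step G}"
  shows "component x i = f i"
proof -
  let ?P = "\<lambda>f. f \<in> (\<Pi>\<^sub>E i\<in>{1..step G}. layer G i) \<and> x = (\<Sum>i=1..step G. f i)"
  have "?P (restrict f {1..step G})" using assms by auto
  moreover have "?P (component x)" using component[of x] by auto
  ultimately have "component x = restrict f {1..step G}"
    using direct_sum[of x] by blast
  then show ?thesis using assms(3) by simp
qed

text \<open>Weight \<open>i\<close> on layer \<open>i\<close> is what compatibility with brackets
  asks for; on the first layer this is plain scaling, the dilation of the metric derivative.\<close>

definition dil :: "real \<Rightarrow> 'a \<Rightarrow> 'a" where "dil t x = (\<Sum>i=1..step G. t ^ i *\<^sub>R component x i)"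

lemma component_layer: "i \<in> {1..step G} \<Longrightarrow> component x i \<in> layer G i"
  using component(1)[of x] by auto

lemma linear_component:
  assumes i: "i \<in> {1..step G}" shows "linear (\<lambda>x. component x i)"
proof (rule linearI)
  fix x y c
  show "component (x + y) i = component x i + component y i"
    using i component(2)[of x] component(2)[of y]
    by (intro component_eqI) (auto simp: sum.distrib intro!: subspace_add layer_subspace component_layer)
  show "component (c *\<^sub>R x) i = c *\<^sub>R component x i"
    using i component(2)[of x]
    by (intro component_eqI) (auto simp: scaleR_sum_right[symmetric] intro!: subspace_scale layer_subspace component_layer)
qed

lemma component_of_layer:
  assumes "i \<in> {1..step G}" "j \<in> {1..step G}" "v \<in> layer G i"
  shows "component v j = (if j = i then v else 0)"
  using assms by (intro component_eqI) (auto simp: sum.delta intro!: subspace_0 layer_subspace)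

lemma linear_dil: "linear (dil t)"
  unfolding dil_def by (intro linear_compose_sum ballI linear_compose_scale_right linear_component) auto

lemma dil_L:
  assumes "v \<in> L i" shows "dil t v = t ^ i *\<^sub>R v"
proof (cases "i \<in> {1..step G}")
  case True
  then have "dil t v = (\<Sum>j=1..step G. if j = i then t ^ i *\<^sub>R v else 0)"
    unfolding dil_def using assms by (intro sum.cong) (auto simp: L_def component_of_layer)
  then show ?thesis using True by (simp add: sum.delta)
qed (use assms linear_0[OF linear_dil] in \<open>auto simp: L_def\<close>)

text \<open>Bilinearity reduces to homogeneous components, where both sides carry the factor
  \<open>t ^ (i + j)\<close>; beyond the step both vanish.\<close>

lemma dil_ad: "dil t (ad x y) = ad (dil t x) (dil t y)"
proof -
  interpret bounded_bilinear ad by (rule bounded_bilinear_ad)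
  have c: "component z i \<in> L i" if "i \<in> {1..step G}" for z i
    using that component_layer by (simp add: L_def)
  have "dil t (ad x y) = dil t (ad (\<Sum>i=1..step G. component x i) (\<Sum>j=1..step G. component y j))"
    using component(2) by metis
  also have "\<dots> = (\<Sum>i=1..step G. \<Sum>j=1..step G. dil t (ad (component x i) (component y j)))"
    by (subst sum.swap) (simp add: sum_left sum_right linear_sum[OF linear_dil])
  also have "\<dots> = (\<Sum>i=1..step G. \<Sum>j=1..step G. ad (t ^ i *\<^sub>R component x i) (t ^ j *\<^sub>R component y j))"
  proof (intro sum.cong refl)
    fix i j assume "i \<in> {1..step G}" "j \<in> {1..step G}"
    then have "ad (component x i) (component y j) \<in> L (i + j)" using ad_L c by auto
    from dil_L[OF this] show "dil t (ad (component x i) (component y j)) = ad (t ^ i *\<^sub>R component x i) (t ^ j *\<^sub>R component y j)"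
      by (simp add: scaleR_left scaleR_right power_add)
  qed
  also have "\<dots> = ad (dil t x) (dil t y)"
    unfolding dil_def by (subst sum.swap) (simp only: sum_left sum_right)
  finally show ?thesis .
qed

lemma dil_mult: "dil t (x \<odot> y) = dil t x \<odot> dil t y"
  by (rule Lie_hom_imp_group_hom[OF linear_dil dil_ad])

subsection \<open>Horizontal accessibility\<close>


text \<open>Endpoints of horizontal polygons from the identity: finite products of first-layer
  elements, with \<open>l\<close> the sum of their Euclidean norms.\<close>

inductive reach :: "'a \<Rightarrow> real \<Rightarrow> bool" where
  reach_0: "reach 0 0"
| reach_step: "reach p l \<Longrightarrow> w \<in> layer G 1 \<Longrightarrow> reach (p \<odot> w) (l + norm w)"

lemma subspace_layer1: "subspace (layer G 1)"
  using layer_subspace step_pos by simp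

lemma reach_nonneg: "reach p l \<Longrightarrow> 0 \<le> l"
  by (induction rule: reach.induct) auto

lemma reach_mult: "reach q b \<Longrightarrow> reach p a \<Longrightarrow> reach (p \<odot> q) (a + b)"
proof (induction rule: reach.induct)
  case (reach_step q l w)
  then have "reach ((p \<odot> q) \<odot> w) (a + l + norm w)" by (intro reach.reach_step) auto
  then show ?case by (simp add: gr.assoc add.assoc)
qed simp

lemma reach_layer: "w \<in> layer G 1 \<Longrightarrow> reach w (norm w)"
  using reach_step[OF reach_0, of w] by simp

lemma reach_minus: "reach p a \<Longrightarrow> reach (- p) a"
proof (induction rule: reach.induct)
  case (reach_step p l w)
  then have "reach ((- w) \<odot> (- p)) (norm (- w) + l)"
    using reach_mult reach_layer subspace_neg[OF subspace_layer1] by blast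
  then show ?case by (simp add: minus_mult add.commute)
qed (simp add: reach_0)

text \<open>Dilations are automorphisms and scale the first layer by \<open>t\<close>, so they map
  polygons to polygons.\<close>

lemma reach_dil: "reach p a \<Longrightarrow> reach (dil t p) (\<bar>t\<bar> * a)"
proof (induction rule: reach.induct)
  case (reach_step p l w)
  have "dil t w = t *\<^sub>R w" using dil_L[of w 1 t] reach_step.hyps step_pos by (simp add: L_def)
  moreover have "reach (dil t p \<odot> (t *\<^sub>R w)) (\<bar>t\<bar> * l + norm (t *\<^sub>R w))"
    using reach_step subspace_scale[OF subspace_layer1] by (intro reach.reach_step) auto
  ultimately show ?case by (simp add: dil_mult algebra_simps)
qed (simp add: linear_0[OF linear_dil] reach_0)

definition small :: "real \<Rightarrow> 'a \<Rightarrow> bool" where "small e p \<longleftrightarrow> (\<exists>a<e. reach p a)"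

lemma small_mult: "small a p \<Longrightarrow> small b q \<Longrightarrow> small (a + b) (p \<odot> q)"
  unfolding small_def using reach_mult add_strict_mono by metis

lemma small_minus: "small a p \<Longrightarrow> small a (- p)"
  unfolding small_def using reach_minus by blast

text \<open>The error vanishes at \<open>x = b\<close> and its derivative in \<open>x\<close> is
  small near the identity, so the mean value inequality bounds it relative to
  \<open>norm (x - b)\<close>. The commutator estimate relies on this relative form, as there
  \<open>x - b\<close> is of smaller order than \<open>b\<close>.\<close>

lemma mult_minus_approx:
  assumes "\<epsilon> > 0"
  obtains \<delta> where "\<delta> > 0"
    "\<And>x b. norm x < \<delta> \<Longrightarrow> norm b < \<delta> \<Longrightarrow> norm (x \<odot> (- b) - (x - b)) \<le> \<epsilon> * norm (x - b)"
proof -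
  \<comment> \<open>A sum over the basis that dominates the operator norm of the deviation from the
    identity and is continuous in \<open>p\<close> term by term.\<close>
  define F where "F p = (\<Sum>i\<in>Basis. norm (DM p (i, 0) - i))" for p
  have "isCont F (0, 0)"
    unfolding F_def[abs_def]
    by (intro continuous_intros differentiable_imp_continuous_within[OF DM_differentiable])
  moreover have "F (0, 0) = 0" by (simp add: F_def DM_zero)
  ultimately obtain d where d: "d > 0" "\<And>p. dist p (0, 0) < d \<Longrightarrow> \<bar>F p\<bar> < \<epsilon>"
    unfolding continuous_at_eps_delta dist_real_def using assms by auto
  show ?thesis
  proof
    show "d / 2 > 0" using d(1) by simp
    fix x b :: 'a assume x: "norm x < d / 2" and b: "norm b < d / 2"
    \<comment> \<open>\<open>\<phi> b = - b\<close>, so \<open>\<phi> x - \<phi> b\<close> is the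
      error to be bounded.\<close>
    define \<phi> where "\<phi> x = x \<odot> (- b) - x" for x
    have der: "(\<phi> has_derivative (\<lambda>h. DM (x, - b) (h, 0) - h)) (at x within ball 0 (d / 2))" for x
      unfolding \<phi>_def[abs_def]
      by (intro has_derivative_diff mult_has_derivative) (auto intro!: derivative_eq_intros)
    have "norm (\<phi> x - \<phi> b) \<le> \<epsilon> * norm (x - b)"
    proof (rule differentiable_bound[OF convex_ball der])
      fix x :: 'a assume "x \<in> ball 0 (d / 2)"
      then have "dist (x, - b) (0, 0) < d"
        using b norm_Pair_le[of x "- b"] by (simp add: dist_norm zero_prod_def[symmetric])
      then have F: "F (x, - b) \<le> \<epsilon>" using d(2) by force
      show "onorm (\<lambda>h. DM (x, - b) (h, 0) - h) \<le> \<epsilon>"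
      proof (rule onorm_le)
        fix h
        have lin: "linear (\<lambda>h. DM (x, - b) (h, 0) - h)"
          using der has_derivative_bounded_linear bounded_linear.linear by blast
        have "norm (DM (x, - b) (h, 0) - h) = norm (\<Sum>i\<in>Basis. (h \<bullet> i) *\<^sub>R (DM (x, - b) (i, 0) - i))"
          using linear_sum[OF lin, of "\<lambda>i. (h \<bullet> i) *\<^sub>R i" Basis] linear_cmul[OF lin]
          by (simp add: euclidean_representation)
        also have "\<dots> \<le> (\<Sum>i\<in>Basis. norm h * norm (DM (x, - b) (i, 0) - i))"
          by (intro sum_norm_le) (auto intro!: mult_right_mono Basis_le_norm)
        also have "\<dots> \<le> \<epsilon> * norm h"
          using mult_right_mono[OF F norm_ge_zero[of h]] by (simp add: F_def sum_distrib_left mult.commute)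
        finally show "norm (DM (x, - b) (h, 0) - h) \<le> \<epsilon> * norm h" .
      qed
    qed (use x b in auto)
    then show "norm (x \<odot> (- b) - (x - b)) \<le> \<epsilon> * norm (x - b)"
      by (simp add: \<phi>_def algebra_simps)
  qed
qed

text \<open>Directions in which one can leave the identity along paths of vanishing horizontal length.
  They form a subspace that is stable under brackets with the first layer: the bracket direction
  is reached by commutators with both factors of size \<open>sqrt t\<close>.\<close>

definition accessible :: "'a set" where
  "accessible = {e. \<exists>c. continuous_on UNIV c \<and> c 0 = 0 \<and> (c has_vector_derivative e) (at (0::real)) \<and>
     (\<forall>\<eta>>0. eventually (\<lambda>t. small \<eta> (c t)) (nhds 0))}"

lemma layer1_accessible:
  assumes "w \<in> layer G 1" shows "w \<in> accessible"
proof -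
  have "eventually (\<lambda>t. small \<eta> (t *\<^sub>R w)) (nhds 0)" if "\<eta> > 0" for \<eta>
  proof -
    have "((\<lambda>t. norm (t *\<^sub>R w)) \<longlongrightarrow> norm (0 *\<^sub>R w)) (nhds 0)"
      by (intro tendsto_intros filterlim_ident)
    then have "eventually (\<lambda>t. norm (t *\<^sub>R w) < \<eta>) (nhds 0)"
      using that by (intro order_tendstoD) auto
    then show ?thesis
      by eventually_elim
        (use reach_layer[OF subspace_scale[OF subspace_layer1 assms]] in \<open>auto simp: small_def\<close>)
  qed
  then show ?thesis
    unfolding accessible_def by (auto intro!: exI[of _ "\<lambda>t. t *\<^sub>R w"] continuous_intros scaled_has_vector_derivative)
qed

text \<open>At the identity the product of two curves adds velocities to first order, and lengths
  add; a scalar multiple is a change of time.\<close>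

lemma subspace_accessible: "subspace accessible"
proof (rule subspaceI)
  show "0 \<in> accessible" using layer1_accessible subspace_0[OF subspace_layer1] by blast
next
  fix d e assume "d \<in> accessible" "e \<in> accessible"
  then obtain a b where
    a: "continuous_on UNIV a" "a 0 = 0" "(a has_vector_derivative d) (at 0)"
      "\<And>\<eta>. \<eta> > 0 \<Longrightarrow> eventually (\<lambda>t. small \<eta> (a t)) (nhds 0)" and
    b: "continuous_on UNIV b" "b 0 = 0" "(b has_vector_derivative e) (at 0)"
      "\<And>\<eta>. \<eta> > 0 \<Longrightarrow> eventually (\<lambda>t. small \<eta> (b t)) (nhds 0)"
    unfolding accessible_def by blast
  have "((\<lambda>t. a t \<odot> b t) has_vector_derivative d + e) (at 0)"
    using mult_has_vector_derivative[OF a(3) b(3)] a(2) b(2) by (simp add: DM_zero)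
  moreover have "eventually (\<lambda>t. small \<eta> (a t \<odot> b t)) (nhds 0)" if "\<eta> > 0" for \<eta>
  proof -
    have "\<eta> / 2 > 0" using that by simp
    from a(4)[OF this] b(4)[OF this] show ?thesis
      by eventually_elim (use small_mult in force)
  qed
  ultimately show "d + e \<in> accessible"
    unfolding accessible_def using a b
    by (auto intro!: exI[of _ "\<lambda>t. a t \<odot> b t"] continuous_intros)
next
  fix k e assume "e \<in> accessible"
  then obtain a where
    a: "continuous_on UNIV a" "a 0 = 0" "(a has_vector_derivative e) (at 0)"
      "\<And>\<eta>. \<eta> > 0 \<Longrightarrow> eventually (\<lambda>t. small \<eta> (a t)) (nhds 0)"
    unfolding accessible_def by blast
  have "((\<lambda>t. k * t) has_vector_derivative k) (at 0)"
    by (auto intro!: derivative_eq_intros)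
  from vector_diff_chain_at[OF this, of a e]
  have "((\<lambda>t. a (k * t)) has_vector_derivative k *\<^sub>R e) (at 0)"
    using a(3) by (simp add: o_def)
  moreover have "((\<lambda>t. k * t) \<longlongrightarrow> 0) (nhds (0::real))"
    using tendsto_mult[OF tendsto_const[of k] filterlim_ident[of "nhds 0"]] by simp
  then have "eventually (\<lambda>t. small \<eta> (a (k * t))) (nhds 0)" if "\<eta> > 0" for \<eta>
    using eventually_compose_filterlim[OF a(4)[OF that]] by blast
  moreover have "continuous_on UNIV (\<lambda>t. a (k * t))"
    by (rule continuous_on_compose2[OF a(1)]) (auto intro!: continuous_intros)
  ultimately show "k *\<^sub>R e \<in> accessible"
    unfolding accessible_def using a(2) by (auto intro!: exI[of _ "\<lambda>t. a (k * t)"])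
qed

lemma ad_accessible:
  assumes w: "w \<in> layer G 1" and e: "e \<in> accessible"
  shows "ad w e \<in> accessible"
proof -
  obtain c where
    c: "continuous_on UNIV c" "c 0 = 0" "(c has_vector_derivative e) (at 0)"
      "\<And>\<eta>. \<eta> > 0 \<Longrightarrow> eventually (\<lambda>t. small \<eta> (c t)) (nhds 0)"
    using e unfolding accessible_def by blast
  \<comment> \<open>\<open>\<sigma>\<close> carries the sign of \<open>t\<close>, so that
    \<open>\<sigma> t * s t = t\<close> on both sides of \<open>0\<close> and the commutator has a
    two-sided derivative.\<close>
  define s \<sigma> where "s t = sqrt \<bar>t\<bar>" and "\<sigma> t = sgn t * sqrt \<bar>t\<bar>" for t :: real
  have \<sigma>s: "\<sigma> t * s t = t" for t by (simp add: s_def \<sigma>_def sgn_if)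
  have s0: "s 0 = 0" "\<sigma> 0 = 0" by (simp_all add: s_def \<sigma>_def)
  have nz: "s t \<noteq> 0" "\<sigma> t \<noteq> 0" if "t \<noteq> 0" for t
    using that by (auto simp: s_def \<sigma>_def sgn_if)
  have cs: "continuous_on UNIV s" by (auto simp: s_def[abs_def] intro!: continuous_intros)
  have "\<sigma> = (\<lambda>t. root 2 t)" 
    by (auto simp: fun_eq_iff \<sigma>_def sqrt_def sgn_if real_root_minus)
  then have c\<sigma>: "continuous_on UNIV \<sigma>" by (simp add: continuous_intros)
  have lim: "s \<midarrow>0\<rightarrow> 0" "\<sigma> \<midarrow>0\<rightarrow> 0"
    using continuous_on_tendsto_compose[OF cs tendsto_ident_at[of 0 UNIV]]
      continuous_on_tendsto_compose[OF c\<sigma> tendsto_ident_at[of 0 UNIV]] s0 by simp_all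
  have s: "filterlim s (at 0) (at 0)" and \<sigma>: "filterlim \<sigma> (at 0) (at 0)"
    using lim nz by (simp_all add: filterlim_at eventually_at_filter)
  have sn: "filterlim s (nhds 0) (nhds 0)" and \<sigma>n: "filterlim \<sigma> (nhds 0) (nhds 0)"
    using lim s0 by (simp_all add: tendsto_nhds_iff)
  \<comment> \<open>\<open>K t\<close> is the commutator of \<open>\<sigma> t *\<^sub>R w\<close>
    and \<open>b t\<close>, written as a conjugate times an inverse so that linearity of
    \<open>Ad\<close> applies.\<close>
  define b z K where "b t = c (s t)" and "z t = Ad (\<sigma> t *\<^sub>R w) (b t)" and "K t = z t \<odot> (- b t)" for t
  \<comment> \<open>The additive model of \<open>K t /\<^sub>R t\<close>; it factors into one
    difference quotient in \<open>s t\<close> and one in \<open>\<sigma> t\<close>.\<close>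
  define r where "r t = (z t - b t) /\<^sub>R t" for t
  have "(\<lambda>t. \<Sum>i\<in>Basis. ((c (s t) /\<^sub>R s t) \<bullet> i) *\<^sub>R ((Ad (\<sigma> t *\<^sub>R w) i - i) /\<^sub>R \<sigma> t)) \<midarrow>0\<rightarrow>
      (\<Sum>i\<in>Basis. (e \<bullet> i) *\<^sub>R ad w i)"
  proof (intro tendsto_intros)
    show "(\<lambda>t. c (s t) /\<^sub>R s t) \<midarrow>0\<rightarrow> e"
      using c(3) by (intro filterlim_compose[OF _ s]) (simp add: has_vector_derivative_zero_iff c(2))
    fix i :: 'a
    have "((\<lambda>s. Ad (s *\<^sub>R w) i - i) has_vector_derivative ad w i) (at 0)"
      using has_vector_derivative_diff[OF Ad_line has_vector_derivative_const] by simp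
    then show "(\<lambda>t. (Ad (\<sigma> t *\<^sub>R w) i - i) /\<^sub>R \<sigma> t) \<midarrow>0\<rightarrow> ad w i"
      by (intro filterlim_compose[OF _ \<sigma>]) (simp add: has_vector_derivative_zero_iff)
  qed
  moreover have "(\<Sum>i\<in>Basis. (e \<bullet> i) *\<^sub>R ad w i) = ad w e"
    using linear_sum[OF linear_ad_right, of w "\<lambda>i. (e \<bullet> i) *\<^sub>R i" Basis]
    by (simp add: linear_cmul[OF linear_ad_right] euclidean_representation)
  moreover have "(\<Sum>i\<in>Basis. ((c (s t) /\<^sub>R s t) \<bullet> i) *\<^sub>R ((Ad (\<sigma> t *\<^sub>R w) i - i) /\<^sub>R \<sigma> t)) = r t"
    (is "?l = _") for t
  proof -
    have "?l = (\<Sum>i\<in>Basis. inverse (\<sigma> t * s t) *\<^sub>R ((b t \<bullet> i) *\<^sub>R (Ad (\<sigma> t *\<^sub>R w) i - i)))"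
      by (intro sum.cong) (auto simp: b_def mult_ac)
    also have "\<dots> = inverse t *\<^sub>R (\<Sum>i\<in>Basis. (b t \<bullet> i) *\<^sub>R (Ad (\<sigma> t *\<^sub>R w) i - i))"
      unfolding \<sigma>s scaleR_sum_right ..
    also have "(\<Sum>i\<in>Basis. (b t \<bullet> i) *\<^sub>R (Ad (\<sigma> t *\<^sub>R w) i - i)) = z t - b t"
      using Ad_expand[of "\<sigma> t *\<^sub>R w" "b t"]
      by (simp add: z_def scaleR_diff_right sum_subtractf euclidean_representation)
    also have "inverse t *\<^sub>R (z t - b t) = r t" by (simp add: r_def)
    finally show ?thesis .
  qed
  ultimately have r: "r \<midarrow>0\<rightarrow> ad w e" by simp
  have b0: "b \<midarrow>0\<rightarrow> 0"
  proof -
    have "c \<midarrow>0\<rightarrow> 0"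
      using continuous_on_tendsto_compose[OF c(1) tendsto_ident_at[of 0 UNIV]] c(2) by simp
    then show ?thesis unfolding b_def[abs_def] by (rule filterlim_compose[OF _ s])
  qed
  have z0: "z \<midarrow>0\<rightarrow> 0"
  proof -
    have "(\<lambda>t. b t + t *\<^sub>R r t) \<midarrow>0\<rightarrow> 0 + 0 *\<^sub>R ad w e"
      by (intro tendsto_intros b0 r)
    moreover have "eventually (\<lambda>t. b t + t *\<^sub>R r t = z t) (at 0)"
      by (auto simp: r_def eventually_at_filter)
    ultimately show ?thesis by (simp add: tendsto_cong)
  qed
  \<comment> \<open>From the additive model to the group product: \<open>z t - b t\<close> is of
    order \<open>t\<close>, so the relative error of \<open>mult_minus_approx\<close> is of smaller
    order than \<open>t\<close>.\<close>
  have "(\<lambda>t. K t /\<^sub>R t - r t) \<midarrow>0\<rightarrow> 0"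
  proof (rule tendstoI)
    fix \<epsilon> :: real assume "\<epsilon> > 0"
    define R where "R = norm (ad w e) + 1"
    have "\<epsilon> / (2 * R) > 0" using \<open>\<epsilon> > 0\<close> by (simp add: R_def add_nonneg_pos)
    from mult_minus_approx[OF this] obtain \<delta> where \<delta>: "\<delta> > 0"
      "\<And>x b. norm x < \<delta> \<Longrightarrow> norm b < \<delta> \<Longrightarrow> norm (x \<odot> (- b) - (x - b)) \<le> \<epsilon> / (2 * R) * norm (x - b)"
      by blast
    have "eventually (\<lambda>t. norm (r t) < R) (at 0)"
      using tendsto_norm[OF r] by (rule order_tendstoD) (simp add: R_def)
    moreover have "eventually (\<lambda>t. norm (b t) < \<delta>) (at 0)" "eventually (\<lambda>t. norm (z t) < \<delta>) (at 0)"
      using tendsto_norm[OF b0] tendsto_norm[OF z0] \<delta>(1) by (auto intro: order_tendstoD)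
    moreover have "eventually (\<lambda>t. t \<noteq> 0) (at (0::real))" by (simp add: eventually_at_filter)
    ultimately show "eventually (\<lambda>t. dist (K t /\<^sub>R t - r t) 0 < \<epsilon>) (at 0)"
    proof eventually_elim
      case (elim t)
      have nr: "norm (r t) = norm (z t - b t) / \<bar>t\<bar>"
        unfolding r_def norm_scaleR by (simp add: divide_inverse)
      have "K t /\<^sub>R t - r t = (z t \<odot> (- b t) - (z t - b t)) /\<^sub>R t"
        by (simp add: K_def r_def scaleR_diff_right)
      then have "norm (K t /\<^sub>R t - r t) = norm (z t \<odot> (- b t) - (z t - b t)) / \<bar>t\<bar>"
        by (simp only: norm_scaleR) (simp add: divide_inverse)
      also have "\<dots> \<le> \<epsilon> / (2 * R) * norm (z t - b t) / \<bar>t\<bar>"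
        using \<delta>(2) elim by (intro divide_right_mono) auto
      also have "\<dots> = \<epsilon> / (2 * R) * norm (r t)"
        unfolding nr by (simp only: times_divide_eq_right)
      also have "\<dots> \<le> \<epsilon> / (2 * R) * R"
        using elim \<open>\<epsilon> / (2 * R) > 0\<close> by (intro mult_left_mono) auto
      also have "\<dots> < \<epsilon>"
      proof -
        have "R > 0" by (simp add: R_def add_nonneg_pos)
        then show ?thesis using \<open>\<epsilon> > 0\<close> by simp
      qed
      finally show ?case by simp
    qed
  qed
  from tendsto_add[OF this r] have lim: "(\<lambda>t. K t /\<^sub>R t) \<midarrow>0\<rightarrow> ad w e" by simp
  have K0: "K 0 = 0" by (simp add: K_def z_def b_def s0 c)
  have "(K has_vector_derivative ad w e) (at 0)"
    using lim K0 by (simp add: has_vector_derivative_zero_iff)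
  moreover have "continuous_on UNIV K"
    unfolding K_def[abs_def] z_def b_def Ad_def
    by (intro continuous_intros c\<sigma> continuous_on_compose2[OF c(1) cs]) auto
  moreover have "eventually (\<lambda>t. small \<eta> (K t)) (nhds 0)" if "\<eta> > 0" for \<eta>
  proof -
    \<comment> \<open>A quarter for each of the four factors of the commutator.\<close>
    have "\<eta> / 4 > 0" using that by simp
    have b: "eventually (\<lambda>t. small (\<eta>/4) (b t)) (nhds 0)"
      unfolding b_def using eventually_compose_filterlim[OF c(4)[OF \<open>\<eta> / 4 > 0\<close>] sn] .
    have "eventually (\<lambda>t. norm (\<sigma> t *\<^sub>R w) < \<eta>/4) (nhds 0)"
    proof (rule order_tendstoD(2))
      show "((\<lambda>t. norm (\<sigma> t *\<^sub>R w)) \<longlongrightarrow> norm (0 *\<^sub>R w)) (nhds 0)"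
        by (intro tendsto_intros \<sigma>n)
    qed (use that in simp)
    with b show ?thesis
    proof eventually_elim
      case (elim t)
      have \<sigma>: "small (\<eta>/4) (\<sigma> t *\<^sub>R w)"
        using elim reach_layer[OF subspace_scale[OF subspace_layer1 w]] by (auto simp: small_def)
      have "small (\<eta>/4 + \<eta>/4 + \<eta>/4 + \<eta>/4) (\<sigma> t *\<^sub>R w \<odot> b t \<odot> (- (\<sigma> t *\<^sub>R w)) \<odot> (- b t))"
        using elim \<sigma> by (intro small_mult small_minus)
      then show ?case by (simp add: K_def z_def Ad_def)
    qed
  qed
  ultimately show ?thesis
    unfolding accessible_def using K0 by blast
qed

text \<open>Bracket generation: each layer is obtained from the preceding one by brackets with the
  first, and together they span.\<close>

lemma accessible_UNIV: "accessible = UNIV"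
proof -
  have layer: "layer G i \<subseteq> accessible" if "1 \<le> i" "i \<le> step G" for i
    using that
  proof (induction i rule: nat_induct_at_least)
    case base
    then show ?case using layer1_accessible by auto
  next
    case (Suc i)
    have "{lie_bracket G v w |v w. v \<in> layer G 1 \<and> w \<in> layer G i} \<subseteq> accessible"
      using Suc ad_accessible by (auto simp: lie_bracket_eq)
    then have "span {lie_bracket G v w |v w. v \<in> layer G 1 \<and> w \<in> layer G i} \<subseteq> accessible"
      by (rule span_minimal[OF _ subspace_accessible])
    then show ?case using bracket_layer[of i] Suc by simp
  qed
  have "x \<in> accessible" for x
  proof -
    have "(\<Sum>i=1..step G. component x i) \<in> accessible"
      using layer component_layer by (intro subspace_sum[OF subspace_accessible]) fastforce
    then show ?thesis using component(2)[of x] by simp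
  qed
  then show ?thesis by blast
qed

text \<open>Accessible curves along basis vectors are multiplied, each run for the corresponding
  coordinate of \<open>x\<close> as its time. For the whole basis the derivative at \<open>0\<close>
  is the identity.\<close>

lemma accessible_map:
  assumes "finite B"
  shows "\<exists>f. continuous_on UNIV f \<and> f (0::'a) = 0 \<and> (f has_derivative (\<lambda>x. \<Sum>b\<in>B. (x \<bullet> b) *\<^sub>R b)) (at 0) \<and>
     (\<forall>\<eta>>0. eventually (\<lambda>x. small \<eta> (f x)) (nhds 0))"
  using assms
proof (induction B rule: finite_induct)
  case empty
  show ?case
    by (auto intro!: exI[of _ "\<lambda>_. 0"] always_eventually exI[of _ 0] reach_0 simp: small_def)
next
  case (insert b B)
  then obtain f where
    f: "continuous_on UNIV f" "f 0 = 0" "(f has_derivative (\<lambda>x. \<Sum>b\<in>B. (x \<bullet> b) *\<^sub>R b)) (at 0)"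
      "\<And>\<eta>. \<eta> > 0 \<Longrightarrow> eventually (\<lambda>x. small \<eta> (f x)) (nhds 0)" by blast
  obtain c where
    c: "continuous_on UNIV c" "c 0 = 0" "(c has_vector_derivative b) (at 0)"
      "\<And>\<eta>. \<eta> > 0 \<Longrightarrow> eventually (\<lambda>t. small \<eta> (c t)) (nhds 0)"
    using accessible_UNIV unfolding accessible_def by blast
  have "((\<lambda>x. x \<bullet> b) has_derivative (\<lambda>x. x \<bullet> b)) (at 0)"
    by (auto intro!: derivative_eq_intros)
  from has_derivative_compose[OF this, of c "\<lambda>h. h *\<^sub>R b"] c(3)
  have "((\<lambda>x. c (x \<bullet> b)) has_derivative (\<lambda>x. (x \<bullet> b) *\<^sub>R b)) (at 0)"
    by (simp add: has_vector_derivative_def)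
  from mult_has_derivative[OF f(3) this]
  have "((\<lambda>x. f x \<odot> c (x \<bullet> b)) has_derivative (\<lambda>x. \<Sum>b\<in>insert b B. (x \<bullet> b) *\<^sub>R b)) (at 0)"
    using insert.hyps by (simp add: f c DM_zero add.commute)
  moreover have "filterlim (\<lambda>x. x \<bullet> b) (nhds 0) (nhds 0)"
    using tendsto_inner[OF filterlim_ident[of "nhds 0"] tendsto_const[of b]] by simp
  then have "eventually (\<lambda>x. small \<eta> (f x \<odot> c (x \<bullet> b))) (nhds 0)" if "\<eta> > 0" for \<eta>
  proof -
    assume lim: "filterlim (\<lambda>x. x \<bullet> b) (nhds 0) (nhds 0)"
    have "\<eta> / 2 > 0" using that by simp
    from f(4)[OF this] eventually_compose_filterlim[OF c(4)[OF this] lim] show ?thesis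
      by eventually_elim (use small_mult in force)
  qed
  moreover have "continuous_on UNIV (\<lambda>x. f x \<odot> c (x \<bullet> b))"
    by (intro continuous_intros f continuous_on_compose2[OF c(1)]) auto
  ultimately show ?case
    using f(2) c(2) by (intro exI[of _ "\<lambda>x. f x \<odot> c (x \<bullet> b)"]) auto
qed

text \<open>The map from \<open>accessible_map\<close> is known to be differentiable at
  \<open>0\<close> only, because of the square roots. Sussmann's open mapping theorem asks for
  continuity and an invertible derivative at one point, and shows that a neighbourhood of
  \<open>0\<close> has a neighbourhood of \<open>0\<close> as its image.\<close>

lemma eventually_small:
  assumes "\<eta> > 0" shows "eventually (small \<eta>) (nhds 0)"
proof -
  obtain f where
    f: "continuous_on UNIV f" "f (0::'a) = 0" "(f has_derivative (\<lambda>x. \<Sum>b\<in>Basis. (x \<bullet> b) *\<^sub>R b)) (at 0)"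
      "\<And>\<eta>. \<eta> > 0 \<Longrightarrow> eventually (\<lambda>x. small \<eta> (f x)) (nhds 0)"
    using accessible_map[OF finite_Basis] by blast
  define T where "T = {x. small \<eta> (f x)}"
  have "0 \<in> interior T"
    using f(4)[OF assms] by (simp add: T_def eventually_nhds interior_def) blast
  then have "f 0 \<in> interior (f ` T)"
    using f(3) by (intro sussmann_open_mapping[of UNIV f 0 "\<lambda>x. x" "\<lambda>x. x"])
      (auto simp: f(1) euclidean_representation bounded_linear_ident fun_eq_iff)
  then show ?thesis
    unfolding eventually_nhds f(2) interior_def T_def by auto
qed

text \<open>\<open>\<delta>\<close> is fixed at scale one by continuity at \<open>w = w0\<close>;
  dilation turns that smallness into a bound proportional to \<open>\<bar>t\<bar>\<close>, so one
  \<open>\<delta>\<close> serves all \<open>t\<close>.\<close>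

lemma reach_between_rays:
  assumes w0: "w0 \<in> layer G 1" and "\<eta> > 0"
  obtains \<delta> where "\<delta> > 0" "\<And>w t. w \<in> layer G 1 \<Longrightarrow> norm (w - w0) < \<delta> \<Longrightarrow>
     \<exists>a\<le>\<bar>t\<bar> * \<eta>. reach ((- (t *\<^sub>R w)) \<odot> (t *\<^sub>R w0)) a"
proof -
  have "continuous_on UNIV (\<lambda>w. (- w) \<odot> w0)" by (intro continuous_intros)
  then have "(\<lambda>w. (- w) \<odot> w0) \<midarrow>w0\<rightarrow> (- w0) \<odot> w0"
    by (simp add: continuous_on_eq_continuous_at isCont_def del: mult_minus)
  then have "((\<lambda>w. (- w) \<odot> w0) \<longlongrightarrow> 0) (nhds w0)"
    by (simp add: tendsto_nhds_iff)
  from eventually_compose_filterlim[OF eventually_small[OF assms(2)] this]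
  obtain \<delta> where \<delta>: "\<delta> > 0" "\<And>w. dist w w0 < \<delta> \<Longrightarrow> small \<eta> ((- w) \<odot> w0)"
    unfolding eventually_nhds_metric by blast
  show ?thesis
  proof
    fix w t assume w: "w \<in> layer G 1" "norm (w - w0) < \<delta>"
    have d: "dil t w = t *\<^sub>R w" "dil t w0 = t *\<^sub>R w0"
      using dil_L[of _ 1 t] w w0 step_pos by (simp_all add: L_def)
    obtain a where "a < \<eta>" "reach ((- w) \<odot> w0) a"
      using \<delta>(2)[of w] w by (auto simp: small_def dist_norm)
    then have "reach (dil t ((- w) \<odot> w0)) (\<bar>t\<bar> * a)" "\<bar>t\<bar> * a \<le> \<bar>t\<bar> * \<eta>"
      using reach_dil by (auto intro: mult_left_mono)
    then show "\<exists>a\<le>\<bar>t\<bar> * \<eta>. reach ((- (t *\<^sub>R w)) \<odot> (t *\<^sub>R w0)) a"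
      by (auto simp: dil_mult d linear_neg[OF linear_dil])
  qed (rule \<delta>)
qed

end

section \<open>Sub-Finsler metrics\<close>

declare One_nat_def [simp del]

section \<open>Absolutely continuous curves\<close>

lemma lipschitz_imp_absolutely_continuous_curve:
  fixes \<gamma> :: "real \<Rightarrow> 'a::euclidean_space"
  assumes "L-lipschitz_on {a..b} \<gamma>"
  shows "absolutely_continuous_curve a b \<gamma>"
  unfolding absolutely_continuous_curve_def
proof (intro allI impI)
  fix \<epsilon> :: real assume "\<epsilon> > 0"
  have "L \<ge> 0" using assms by (rule lipschitz_on_nonneg)
  show "\<exists>\<delta>>0. \<forall>(n::nat) u v. (\<forall>i<n. a \<le> u i \<and> u i \<le> v i \<and> v i \<le> b) \<and>
        disjoint_family_on (\<lambda>i. {u i<..<v i}) {..<n} \<and> (\<Sum>i<n. v i - u i) < \<delta> \<longrightarrow>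
        (\<Sum>i<n. norm (\<gamma> (v i) - \<gamma> (u i))) < \<epsilon>"
  proof (intro exI[of _ "\<epsilon> / (L + 1)"] conjI allI impI, goal_cases)
    case 1
    then show ?case using \<open>\<epsilon> > 0\<close> \<open>L \<ge> 0\<close> by simp
  next
    case (2 n u v)
    then have uv: "\<And>i. i < n \<Longrightarrow> a \<le> u i \<and> u i \<le> v i \<and> v i \<le> b" and
      s: "(\<Sum>i<n. v i - u i) < \<epsilon> / (L + 1)" by auto
    have "(\<Sum>i<n. norm (\<gamma> (v i) - \<gamma> (u i))) \<le> (\<Sum>i<n. (L + 1) * (v i - u i))"
    proof (rule sum_mono)
      fix i assume "i \<in> {..<n}"
      then have i: "a \<le> u i" "u i \<le> v i" "v i \<le> b" using uv by auto
      then have "norm (\<gamma> (v i) - \<gamma> (u i)) \<le> L * (v i - u i)"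
        using lipschitz_onD[OF assms, of "v i" "u i"] by (auto simp: dist_norm)
      also have "\<dots> \<le> (L + 1) * (v i - u i)" using i by (intro mult_right_mono) auto
      finally show "norm (\<gamma> (v i) - \<gamma> (u i)) \<le> (L + 1) * (v i - u i)" .
    qed
    also have "\<dots> = (L + 1) * (\<Sum>i<n. v i - u i)" by (simp add: sum_distrib_left)
    also have "\<dots> < (L + 1) * (\<epsilon> / (L + 1))" using s \<open>L \<ge> 0\<close> by (intro mult_strict_left_mono) auto
    also have "\<dots> = \<epsilon>" using \<open>L \<ge> 0\<close> by simp
    finally show ?case .
  qed
qed

lemma absolutely_continuous_curve_subinterval:
  assumes "absolutely_continuous_curve a b \<gamma>" "a \<le> c" "d \<le> b"
  shows "absolutely_continuous_curve c d \<gamma>"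
  unfolding absolutely_continuous_curve_def
proof (intro allI impI)
  fix \<epsilon> :: real assume "\<epsilon> > 0"
  with assms(1) obtain \<delta> where "\<delta> > 0" and \<delta>: "\<forall>(n::nat) u v.
        (\<forall>i<n. a \<le> u i \<and> u i \<le> v i \<and> v i \<le> b) \<and>
        disjoint_family_on (\<lambda>i. {u i<..<v i}) {..<n} \<and> (\<Sum>i<n. v i - u i) < \<delta> \<longrightarrow>
        (\<Sum>i<n. norm (\<gamma> (v i) - \<gamma> (u i))) < \<epsilon>"
    unfolding absolutely_continuous_curve_def by meson
  show "\<exists>\<delta>>0. \<forall>(n::nat) u v. (\<forall>i<n. c \<le> u i \<and> u i \<le> v i \<and> v i \<le> d) \<and>
        disjoint_family_on (\<lambda>i. {u i<..<v i}) {..<n} \<and> (\<Sum>i<n. v i - u i) < \<delta> \<longrightarrow>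
        (\<Sum>i<n. norm (\<gamma> (v i) - \<gamma> (u i))) < \<epsilon>"
  proof (intro exI[of _ \<delta>] conjI allI impI \<open>\<delta> > 0\<close>)
    fix n :: nat and u v :: "nat \<Rightarrow> real"
    assume *: "(\<forall>i<n. c \<le> u i \<and> u i \<le> v i \<and> v i \<le> d) \<and>
        disjoint_family_on (\<lambda>i. {u i<..<v i}) {..<n} \<and> (\<Sum>i<n. v i - u i) < \<delta>"
    then have "\<forall>i<n. a \<le> u i \<and> u i \<le> v i \<and> v i \<le> b" using assms(2,3) by force
    with * \<delta> show "(\<Sum>i<n. norm (\<gamma> (v i) - \<gamma> (u i))) < \<epsilon>" by blast
  qed
qed

lemma absolutely_continuous_curve_continuous_on:
  assumes "absolutely_continuous_curve a b \<gamma>"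
  shows "continuous_on {a..b} \<gamma>"
  unfolding continuous_on_iff
proof (intro ballI allI impI)
  fix x \<epsilon> :: real assume x: "x \<in> {a..b}" and "\<epsilon> > 0"
  with assms obtain \<delta> where "\<delta> > 0" and \<delta>: "\<forall>(n::nat) u v.
        (\<forall>i<n. a \<le> u i \<and> u i \<le> v i \<and> v i \<le> b) \<and>
        disjoint_family_on (\<lambda>i. {u i<..<v i}) {..<n} \<and> (\<Sum>i<n. v i - u i) < \<delta> \<longrightarrow>
        (\<Sum>i<n. norm (\<gamma> (v i) - \<gamma> (u i))) < \<epsilon>"
    unfolding absolutely_continuous_curve_def by meson
  have *: "norm (\<gamma> v - \<gamma> u) < \<epsilon>" if "a \<le> u" "u \<le> v" "v \<le> b" "v - u < \<delta>" for u v
    using \<delta>[rule_format, of 1 "\<lambda>_. u" "\<lambda>_. v"] that by (simp add: disjoint_family_on_def)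
  show "\<exists>d>0. \<forall>x'\<in>{a..b}. dist x' x < d \<longrightarrow> dist (\<gamma> x') (\<gamma> x) < \<epsilon>"
  proof (intro exI[of _ \<delta>] conjI ballI impI \<open>\<delta> > 0\<close>)
    fix y assume "y \<in> {a..b}" "dist y x < \<delta>"
    then show "dist (\<gamma> y) (\<gamma> x) < \<epsilon>"
      using *[of x y] *[of y x] x by (cases "x \<le> y") (auto simp: dist_norm norm_minus_commute)
  qed
qed

locale subfinsler = carnot_group G for G :: "'a::euclidean_space carnot" +
  fixes \<alpha> :: real and \<psi> :: "'a \<times> 'a \<Rightarrow> real"
  assumes \<alpha>: "\<alpha> \<ge> 1" and convex: "subfinsler_convex G \<alpha> \<psi>"
begin

abbreviation V :: "'a set" where "V \<equiv> layer G 1"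

section \<open>Scalar product and metric in the left trivialisation\<close>

definition layer_norm :: "'a \<Rightarrow> real" where "layer_norm w = sqrt (hinner G w w)"

lemma hnorm_X: "hnorm G x (X w x) = layer_norm w"
  by (simp add: hnorm_def layer_norm_def to_layer_X)

lemma X_hbundle: "w \<in> V \<Longrightarrow> (x, X w x) \<in> hbundle G"
  by (simp add: hbundle_def hfiber_eq to_layer_X)

text \<open>Projection to the first layer extends the scalar product to a bilinear form on the whole
  space, where finite dimension gives boundedness.\<close>

lemma hinner_bilinear: "bounded_bilinear (\<lambda>x y. hinner G (component x 1) (component y 1))"
proof -
  have 1: "1 \<in> {1..step G}" using step_pos by simp
  note c = component_layer[OF 1] linear_add[OF linear_component[OF 1]] linear_cmul[OF linear_component[OF 1]]
  have l: "linear (\<lambda>x. hinner G (component x 1) (component y 1))" for y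
    by (rule linearI) (simp_all only: c hinner_add hinner_scale real_scaleR_def)
  moreover have "(\<lambda>y. hinner G (component x 1) (component y 1)) = (\<lambda>y. hinner G (component y 1) (component x 1))" for x
    using hinner_sym c(1) by (simp add: fun_eq_iff)
  ultimately show ?thesis
    by (simp add: bilinear_conv_bounded_bilinear[symmetric] bilinear_def)
qed

lemma hinner_component: "w \<in> V \<Longrightarrow> hinner G w w = hinner G (component w 1) (component w 1)"
  using component_of_layer[of 1 1 w] step_pos by simp

text \<open>Compactness of the unit sphere of the first layer. As \<open>hnorm\<close> is
  left-invariant, one pair of constants serves all base points.\<close>

lemma layer_norm_bounds: "\<exists>m>0. \<exists>M>0. \<forall>w\<in>V. m * norm w \<le> layer_norm w \<and> layer_norm w \<le> M * norm w"
proof -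
  define H where "H x y = hinner G (component x 1) (component y 1)" for x y
  interpret H: bounded_bilinear H unfolding H_def[abs_def] by (rule hinner_bilinear)
  obtain B where B: "B > 0" "\<And>x y. norm (H x y) \<le> norm x * norm y * B" using H.pos_bounded by blast
  have Hpos: "H w w > 0" if "w \<in> V" "w \<noteq> 0" for w
    using hinner_pos[OF that] hinner_component[OF that(1)] by (simp add: H_def)
  have "\<exists>m>0. \<forall>w\<in>V. norm w = 1 \<longrightarrow> m \<le> H w w"
  proof (cases "V \<inter> sphere 0 1 = {}")
    case True
    then show ?thesis by (intro exI[of _ 1]) auto
  next
    case False
    have "compact (V \<inter> sphere 0 1)"
      by (intro closed_Int_compact closed_subspace subspace_layer1 compact_sphere)
    moreover have "continuous_on (V \<inter> sphere 0 1) (\<lambda>w. H w w)" by (intro H.continuous_on continuous_intros)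
    ultimately obtain w0 where w0: "w0 \<in> V \<inter> sphere 0 1" "\<And>w. w \<in> V \<inter> sphere 0 1 \<Longrightarrow> H w0 w0 \<le> H w w"
      using continuous_attains_inf[OF _ False] by blast
    then have "H w0 w0 > 0" by (intro Hpos) auto
    then show ?thesis using w0(2) by auto
  qed
  then obtain m where m: "m > 0" "\<And>w. w \<in> V \<Longrightarrow> norm w = 1 \<Longrightarrow> m \<le> H w w" by blast
  have "sqrt m * norm w \<le> layer_norm w \<and> layer_norm w \<le> sqrt B * norm w" if w: "w \<in> V" for w
  proof (cases "w = 0")
    case True
    then show ?thesis using hinner_component[OF w] H.zero_left[of 0] by (simp add: layer_norm_def H_def)
  next
    case False
    have "m \<le> H (w /\<^sub>R norm w) (w /\<^sub>R norm w)"
      using False w by (intro m) (auto intro!: subspace_scale subspace_layer1)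
    also have "\<dots> = H w w / (norm w)\<^sup>2"
      using False by (simp add: H.scaleR_left H.scaleR_right power2_eq_square divide_inverse)
    finally have "m * (norm w)\<^sup>2 \<le> H w w" using False by (simp add: field_simps)
    then have "sqrt (m * (norm w)\<^sup>2) \<le> sqrt (H w w)" by simp
    moreover have "sqrt (H w w) \<le> sqrt (B * (norm w)\<^sup>2)"
      using B(2)[of w w] by (simp add: power2_eq_square mult_ac)
    ultimately show ?thesis
      using hinner_component[OF w] by (simp add: layer_norm_def H_def real_sqrt_mult)
  qed
  then show ?thesis using m(1) B(1) by (intro exI[of _ "sqrt m"] exI[of _ "sqrt B"] conjI) auto
qed

text \<open>\<open>\<psi>\<close> in the left trivialisation. Off the first layer, where
  \<open>\<psi>\<close> is unconstrained, the value \<open>0\<close> makes \<open>\<Psi>\<close> a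
  nonnegative Borel function on the whole product.\<close>

definition \<Psi> :: "'a \<Rightarrow> 'a \<Rightarrow> real" where "\<Psi> x w = (if w \<in> V then \<psi> (x, X w x) else 0)"

lemma metric_class: "\<psi> \<in> metric_class G \<alpha>"
  using convex by (simp add: subfinsler_convex_def)

lemma \<Psi>_nonneg: "0 \<le> \<Psi> x w"
  using metric_class X_hbundle[of w x] by (auto simp: \<Psi>_def metric_class_def)

lemma \<Psi>_scale: "\<Psi> x (c *\<^sub>R w) = \<bar>c\<bar> * \<Psi> x w" if "w \<in> V"
proof -
  have "\<psi> (x, c *\<^sub>R X w x) = \<bar>c\<bar> * \<psi> (x, X w x)"
    using metric_class X_hbundle[OF that, of x] unfolding metric_class_def by blast
  then show ?thesis
    using that subspace_scale[OF subspace_layer1 that] by (simp add: \<Psi>_def linear_cmul[OF linear_X])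
qed

lemma \<Psi>_add: "\<Psi> x (v + w) \<le> \<Psi> x v + \<Psi> x w" if "v \<in> V" "w \<in> V"
proof -
  have "\<psi> (x, X v x + X w x) \<le> \<psi> (x, X v x) + \<psi> (x, X w x)"
    using convex that by (simp add: subfinsler_convex_def hfiber_eq to_layer_X)
  then show ?thesis
    using that subspace_add[OF subspace_layer1 that] by (simp add: \<Psi>_def linear_add[OF linear_X])
qed

lemma \<Psi>_bounds:
  obtains k K where "k > 0" "K > 0"
    "\<And>x w. w \<in> V \<Longrightarrow> k * norm w \<le> \<Psi> x w" "\<And>x w. w \<in> V \<Longrightarrow> \<Psi> x w \<le> K * norm w"
proof -
  obtain m M where mM: "m > 0" "M > 0" "\<And>w. w \<in> V \<Longrightarrow> m * norm w \<le> layer_norm w \<and> layer_norm w \<le> M * norm w"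
    using layer_norm_bounds by blast
  have b: "1 / \<alpha> * layer_norm w \<le> \<Psi> x w" "\<Psi> x w \<le> \<alpha> * layer_norm w" if "w \<in> V" for x w
  proof -
    have "1 / \<alpha> * hnorm G x (X w x) \<le> \<psi> (x, X w x) \<and> \<psi> (x, X w x) \<le> \<alpha> * hnorm G x (X w x)"
      using metric_class X_hbundle[OF that, of x] unfolding metric_class_def by blast
    then show "1 / \<alpha> * layer_norm w \<le> \<Psi> x w" "\<Psi> x w \<le> \<alpha> * layer_norm w" by (simp_all add: \<Psi>_def hnorm_X that)
  qed
  show thesis
  proof
    show "m / \<alpha> > 0" "\<alpha> * M > 0" using mM \<alpha> by auto
    fix x w assume w: "w \<in> V"
    have "1 / \<alpha> * (m * norm w) \<le> 1 / \<alpha> * layer_norm w" using mM(3)[OF w] \<alpha> by (intro mult_left_mono) auto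
    then show "m / \<alpha> * norm w \<le> \<Psi> x w" using b(1)[OF w, of x] by simp
    have "\<alpha> * layer_norm w \<le> \<alpha> * (M * norm w)" using mM(3)[OF w] \<alpha> by (intro mult_left_mono) auto
    then show "\<Psi> x w \<le> \<alpha> * M * norm w" using b(2)[OF w, of x] by simp
  qed
qed

lemma \<Psi>_eq: "v \<in> hfiber G x \<Longrightarrow> \<psi> (x, v) = \<Psi> x (to_layer G x v)"
  by (simp add: \<Psi>_def hfiber_eq X_to_layer)

text \<open>The bundle topology is itself pulled back along the left trivialisation, so inverting
  the trivialisation returns the open set it came from. Semicontinuity and measurability pass from
  \<open>\<psi>\<close> to \<open>\<Psi>\<close> this way.\<close>

lemma openin_hbundle_pullback:
  assumes "openin (hbundle_topology G) U"
  shows "openin (top_of_set (UNIV \<times> V)) {z \<in> UNIV \<times> V. (fst z, X (snd z) (fst z)) \<in> U}"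
proof -
  obtain W where W: "openin (prod_topology euclidean (top_of_set V)) W"
    "U = (\<lambda>(x, v). (x, to_layer G x v)) -` W \<inter> hbundle G"
    using assms by (auto simp: hbundle_topology_def openin_pullback_topology)
  have W1: "openin (top_of_set (UNIV \<times> V)) W"
    using W(1) prod_topology_subtopology_eu[of "UNIV :: 'a set" V] by simp
  then have "W \<subseteq> UNIV \<times> V" using openin_imp_subset by blast
  then have "{z \<in> UNIV \<times> V. (fst z, X (snd z) (fst z)) \<in> U} = W"
    by (auto simp: W(2) to_layer_X X_hbundle)
  then show ?thesis using W1 by simp
qed

lemma borel_UNIV_V: "UNIV \<times> V \<in> sets (borel :: ('a \<times> 'a) measure)"
  by (intro borel_closed closed_Times closed_UNIV closed_subspace subspace_layer1)

lemma \<Psi>_measurable: "(\<lambda>z. \<Psi> (fst z) (snd z)) \<in> borel_measurable borel"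
proof -
  let ?S = "UNIV \<times> V :: ('a \<times> 'a) set" and ?f = "\<lambda>z. (fst z, X (snd z) (fst z))"
  have "?f \<in> measurable (restrict_space borel ?S) (hbundle_borel G)"
    unfolding hbundle_borel_def
  proof (rule measurable_measure_of)
    show "{U. openin (hbundle_topology G) U} \<subseteq> Pow (hbundle G)"
      using openin_subset topspace_hbundle by fastforce
    show "?f \<in> space (restrict_space borel ?S) \<rightarrow> hbundle G"
      by (auto simp: space_restrict_space X_hbundle)
    fix U assume "U \<in> {U. openin (hbundle_topology G) U}"
    then have "openin (top_of_set ?S) {z \<in> ?S. ?f z \<in> U}"
      using openin_hbundle_pullback by blast
    then obtain T where "open T" "{z \<in> ?S. ?f z \<in> U} = ?S \<inter> T"
      unfolding openin_open by blast
    moreover have "?f -` U \<inter> space (restrict_space borel ?S) = {z \<in> ?S. ?f z \<in> U}"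
      by (auto simp: space_restrict_space)
    ultimately show "?f -` U \<inter> space (restrict_space borel ?S) \<in> sets (restrict_space borel ?S)"
      by (simp add: sets_restrict_space)
  qed
  moreover have "\<psi> \<in> borel_measurable (hbundle_borel G)"
    using metric_class by (simp add: metric_class_def)
  ultimately have "(\<lambda>z. \<psi> (?f z)) \<in> borel_measurable (restrict_space borel ?S)"
    by (rule measurable_compose)
  then have "(\<lambda>z. if z \<in> ?S then \<psi> (?f z) else 0) \<in> borel_measurable borel"
    using borel_UNIV_V by (subst (asm) measurable_restrict_space_iff) auto
  moreover have "(\<lambda>z. if z \<in> ?S then \<psi> (?f z) else 0) = (\<lambda>z. \<Psi> (fst z) (snd z))"
    by (auto simp: \<Psi>_def)
  ultimately show ?thesis by simp
qed

lemma \<Psi>_measurable_comp [measurable (raw)]: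
  assumes "f \<in> borel_measurable N" "g \<in> borel_measurable N"
  shows "(\<lambda>x. \<Psi> (f x) (g x)) \<in> borel_measurable N"
  using measurable_compose[OF borel_measurable_Pair[OF assms] \<Psi>_measurable] by simp

subsection \<open>Piecewise smooth controlled paths\<close>

text \<open>A control defined everywhere and a finite exceptional set stand in for velocity and null
  sets, which makes concatenation and measurability elementary; the Lipschitz bound provides
  absolute continuity.\<close>

definition ctrl_path :: "(real \<Rightarrow> 'a) \<Rightarrow> (real \<Rightarrow> 'a) \<Rightarrow> bool" where
  "ctrl_path u \<gamma> \<longleftrightarrow> (\<exists>L. L-lipschitz_on {0..1} \<gamma>) \<and> \<gamma> \<in> borel_measurable borel \<and>
     u \<in> borel_measurable borel \<and> range u \<subseteq> V \<and> bounded (range u) \<and>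
     (\<exists>F. finite F \<and> (\<forall>t\<in>{0<..<1} - F. (\<gamma> has_vector_derivative X (u t) (\<gamma> t)) (at t)))"

lemma ctrl_pathE:
  assumes "ctrl_path u \<gamma>"
  obtains L F where "L-lipschitz_on {0..1} \<gamma>" "finite F"
    "\<And>t. t \<in> {0<..<1} - F \<Longrightarrow> (\<gamma> has_vector_derivative X (u t) (\<gamma> t)) (at t)"
    "\<gamma> \<in> borel_measurable borel" "u \<in> borel_measurable borel" "\<And>t. u t \<in> V" "bounded (range u)"
  using assms unfolding ctrl_path_def by blast

definition cost :: "(real \<Rightarrow> 'a) \<Rightarrow> (real \<Rightarrow> 'a) \<Rightarrow> ennreal" where
  "cost u \<gamma> = (\<integral>\<^sup>+t\<in>{0..1}. ennreal (\<Psi> (\<gamma> t) (u t)) \<partial>lborel)"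

definition joins :: "'a \<Rightarrow> 'a \<Rightarrow> ennreal \<Rightarrow> bool" where
  "joins x y c \<longleftrightarrow> (\<exists>u \<gamma>. ctrl_path u \<gamma> \<and> \<gamma> 0 = x \<and> \<gamma> 1 = y \<and> cost u \<gamma> \<le> c)"

text \<open>Off finitely many times the velocity is \<open>X (u t) (\<gamma> t)\<close>, so speed
  and integrand are expressed by the control; a finite set affects neither measurability nor the
  integral.\<close>

lemma joins_imp_intrinsic_distance_le:
  assumes "joins x y c" shows "intrinsic_distance G \<psi> x y \<le> c"
proof -
  obtain u \<gamma> where p: "ctrl_path u \<gamma>" and xy: "\<gamma> 0 = x" "\<gamma> 1 = y" and c: "cost u \<gamma> \<le> c"
    using assms by (auto simp: joins_def)
  obtain L F where L: "L-lipschitz_on {0..1} \<gamma>" and F: "finite F"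
      "\<And>t. t \<in> {0<..<1} - F \<Longrightarrow> (\<gamma> has_vector_derivative X (u t) (\<gamma> t)) (at t)"
    and [measurable]: "\<gamma> \<in> borel_measurable borel" "u \<in> borel_measurable borel"
    and uV: "\<And>t. u t \<in> V" and "bounded (range u)"
    using p by (rule ctrl_pathE) blast
  \<comment> \<open>The endpoints join the exceptional set, as the two-sided derivative is given in
    the open interval only.\<close>
  define F' where "F' = insert 0 (insert 1 F)"
  have F': "finite F'" using F by (simp add: F'_def)
  have vel: "velocity 0 1 \<gamma> t = X (u t) (\<gamma> t)" and dif: "\<gamma> differentiable (at t within {0..1})"
    if "t \<in> {0..1}" "t \<notin> F'" for t
  proof -
    have "(\<gamma> has_vector_derivative X (u t) (\<gamma> t)) (at t within {0..1})"
      using F(2)[of t] that by (auto simp: F'_def intro: has_vector_derivative_at_within)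
    then show "velocity 0 1 \<gamma> t = X (u t) (\<gamma> t)" "\<gamma> differentiable (at t within {0..1})"
      using that by (auto intro: vector_derivative_within_closed_interval
        simp: has_vector_derivative_def differentiable_def)
  qed
  have "AE t in lebesgue. t \<notin> F'"
    using F' by (intro AE_not_in negligible_iff_null_sets[THEN iffD1] negligible_finite)
  then have AE: "AE t in lebesgue_on {0..1}. t \<in> {0..1} \<and> t \<notin> F'"
    by (simp add: AE_restrict_space_iff) (auto elim: eventually_mono)
  obtain M where M: "M > 0" "\<And>w. w \<in> V \<Longrightarrow> layer_norm w \<le> M * norm w" using layer_norm_bounds by blast
  obtain B where B: "\<And>t. norm (u t) \<le> B" using \<open>bounded (range u)\<close> by (auto simp: bounded_iff)
  have "horizontal_curve G 0 1 \<gamma>"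
    unfolding horizontal_curve_def
  proof (intro conjI)
    show "absolutely_continuous_curve 0 1 \<gamma>" by (rule lipschitz_imp_absolutely_continuous_curve[OF L])
    show "AE t in lebesgue_on {0..1}. \<gamma> differentiable (at t within {0..1}) \<and> velocity 0 1 \<gamma> t \<in> hfiber G (\<gamma> t)"
      using AE by eventually_elim (use dif vel uV in \<open>auto simp: hfiber_eq to_layer_X\<close>)
    have "layer_norm \<circ> u \<in> borel_measurable borel"
    proof -
      interpret H: bounded_bilinear "\<lambda>x y. hinner G (component x 1) (component y 1)" by (rule hinner_bilinear)
      have "continuous_on UNIV (\<lambda>w. sqrt (hinner G (component w 1) (component w 1)))"
        by (intro continuous_intros H.continuous_on)
      then have "(\<lambda>w. sqrt (hinner G (component w 1) (component w 1))) \<in> borel_measurable borel"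
        by (rule borel_measurable_continuous_onI)
      then have "(\<lambda>t. sqrt (hinner G (component (u t) 1) (component (u t) 1))) \<in> borel_measurable borel"
        by measurable
      then show ?thesis using uV hinner_component by (simp add: layer_norm_def o_def)
    qed
    then have layer_norm: "layer_norm \<circ> u \<in> borel_measurable (lebesgue_on {0..1})"
      by (intro measurable_restrict_space1 measurable_completion) simp
    show "(\<lambda>t. hnorm G (\<gamma> t) (velocity 0 1 \<gamma> t)) \<in> borel_measurable (lebesgue_on {0..1})"
    proof (rule measurable_discrete_difference[OF layer_norm, of "F' \<inter> {0..1}"])
      show "countable (F' \<inter> {0..1})" using F' by (simp add: countable_finite)
      show "{t} \<in> sets (lebesgue_on {0..1})" if "t \<in> F' \<inter> {0..1}" for t
        using that by (simp add: sets_restrict_space_iff)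
      show "(layer_norm \<circ> u) t = hnorm G (\<gamma> t) (velocity 0 1 \<gamma> t)"
        if "t \<in> space (lebesgue_on {0..1})" "t \<notin> F' \<inter> {0..1}" for t
        using that vel[of t] by (simp add: hnorm_X)
    qed simp
    have "layer_norm (u t) \<le> M * B" for t
      using M(2)[OF uV, of t] mult_left_mono[OF B, of M t] M(1) by linarith
    note hnB = this
    have "AE t in lebesgue_on {0..1}. hnorm G (\<gamma> t) (velocity 0 1 \<gamma> t) \<le> M * B"
      using AE by eventually_elim (simp add: vel hnorm_X hnB)
    then show "\<exists>C. AE t in lebesgue_on {0..1}. hnorm G (\<gamma> t) (velocity 0 1 \<gamma> t) \<le> C" ..
  qed
  moreover have "(\<integral>\<^sup>+t. ennreal (\<psi> (\<gamma> t, velocity 0 1 \<gamma> t)) \<partial>lebesgue_on {0..1}) = cost u \<gamma>"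
  proof -
    have "AE t in lebesgue_on {0..1}. ennreal (\<psi> (\<gamma> t, velocity 0 1 \<gamma> t)) = ennreal (\<Psi> (\<gamma> t) (u t))"
      using AE by eventually_elim (simp add: vel \<Psi>_def uV)
    then have "(\<integral>\<^sup>+t. ennreal (\<psi> (\<gamma> t, velocity 0 1 \<gamma> t)) \<partial>lebesgue_on {0..1}) =
        (\<integral>\<^sup>+t. ennreal (\<Psi> (\<gamma> t) (u t)) \<partial>lebesgue_on {0..1})"
      by (rule nn_integral_cong_AE)
    then show ?thesis
      by (simp add: cost_def nn_integral_restrict_space nn_integral_completion)
  qed
  ultimately have "intrinsic_distance G \<psi> x y \<le> cost u \<gamma>"
    unfolding intrinsic_distance_def using xy by (intro INF_lower2[of \<gamma>]) auto
  then show ?thesis using c by simp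
qed

text \<open>Each half runs at double speed, and homogeneity of \<open>\<Psi>\<close> compensates for
  the halved time.\<close>

lemma joins_trans:
  assumes "joins x y a" "joins y z b" shows "joins x z (a + b)"
proof -
  obtain u1 g1 u2 g2 where p1: "ctrl_path u1 g1" and e1: "g1 0 = x" "g1 1 = y" "cost u1 g1 \<le> a"
    and p2: "ctrl_path u2 g2" and e2: "g2 0 = y" "g2 1 = z" "cost u2 g2 \<le> b"
    using assms unfolding joins_def by blast
  obtain L1 F1 where L1: "L1-lipschitz_on {0..1} g1" and F1: "finite F1"
      "\<And>t. t \<in> {0<..<1} - F1 \<Longrightarrow> (g1 has_vector_derivative X (u1 t) (g1 t)) (at t)"
    and [measurable]: "g1 \<in> borel_measurable borel" "u1 \<in> borel_measurable borel"
    and u1: "\<And>t. u1 t \<in> V" "bounded (range u1)"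
    using p1 by (rule ctrl_pathE) blast
  obtain L2 F2 where L2: "L2-lipschitz_on {0..1} g2" and F2: "finite F2"
      "\<And>t. t \<in> {0<..<1} - F2 \<Longrightarrow> (g2 has_vector_derivative X (u2 t) (g2 t)) (at t)"
    and [measurable]: "g2 \<in> borel_measurable borel" "u2 \<in> borel_measurable borel"
    and u2: "\<And>t. u2 t \<in> V" "bounded (range u2)"
    using p2 by (rule ctrl_pathE) blast
  define g u where "g t = (if t \<le> 1/2 then g1 (2 * t) else g2 (2 * t - 1))"
    and "u t = (if t \<le> 1/2 then 2 *\<^sub>R u1 (2 * t) else 2 *\<^sub>R u2 (2 * t - 1))" for t :: real
  have "ctrl_path u g"
    unfolding ctrl_path_def
  proof (intro conjI)
    have "(2 * L1)-lipschitz_on {0..1/2} (\<lambda>t. g1 (2 * t))"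
    proof (rule lipschitz_onI)
      fix s t :: real assume "s \<in> {0..1/2}" "t \<in> {0..1/2}"
      then show "dist (g1 (2 * s)) (g1 (2 * t)) \<le> 2 * L1 * dist s t"
        using lipschitz_onD[OF L1, of "2 * s" "2 * t"] abs_mult[of 2 "s - t"] by (simp add: dist_real_def)
    qed (use lipschitz_on_nonneg[OF L1] in simp)
    moreover have "(2 * L2)-lipschitz_on {1/2..1} (\<lambda>t. g2 (2 * t - 1))"
    proof (rule lipschitz_onI)
      fix s t :: real assume "s \<in> {1/2..1}" "t \<in> {1/2..1}"
      then show "dist (g2 (2 * s - 1)) (g2 (2 * t - 1)) \<le> 2 * L2 * dist s t"
        using lipschitz_onD[OF L2, of "2 * s - 1" "2 * t - 1"] abs_mult[of 2 "s - t"]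
        by (simp add: dist_real_def)
    qed (use lipschitz_on_nonneg[OF L2] in simp)
    ultimately have "(max (2 * L1) (2 * L2))-lipschitz_on {0..1} g"
      unfolding g_def[abs_def] using e1 e2 by (intro lipschitz_on_concat_max) auto
    then show "\<exists>L. L-lipschitz_on {0..1} g" by blast
    show "g \<in> borel_measurable borel" "u \<in> borel_measurable borel"
      unfolding g_def[abs_def] u_def[abs_def] by measurable
    show "range u \<subseteq> V"
      using u1 u2 by (auto simp: u_def intro!: subspace_scale subspace_layer1)
    obtain B1 B2 where B: "\<And>t. norm (u1 t) \<le> B1" "\<And>t. norm (u2 t) \<le> B2"
      using u1 u2 by (auto simp: bounded_iff)
    have "norm (u t) \<le> 2 * max B1 B2" for t
      using B(1)[of "2 * t"] B(2)[of "2 * t - 1"] by (auto simp: u_def)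
    then show "bounded (range u)" by (auto simp: bounded_iff)
    define F where "F = insert (1/2) ((\<lambda>t. t / 2) ` F1 \<union> (\<lambda>t. (t + 1) / 2) ` F2)"
    have "(g has_vector_derivative X (u t) (g t)) (at t)" if t: "t \<in> {0<..<1} - F" for t
    proof (cases "t < 1/2")
      case True
      have "2 * t \<notin> F1" using t imageI[of "2 * t" F1 "\<lambda>t. t / 2"] by (auto simp: F_def)
      then have "(g1 has_vector_derivative X (u1 (2 * t)) (g1 (2 * t))) (at (2 * t))"
        using True t by (intro F1) auto
      moreover have "((\<lambda>t. 2 * t) has_vector_derivative 2) (at t)" by (auto intro!: derivative_eq_intros)
      ultimately have "((\<lambda>t. g1 (2 * t)) has_vector_derivative 2 *\<^sub>R X (u1 (2 * t)) (g1 (2 * t))) (at t)"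
        using vector_diff_chain_at[of "\<lambda>t. 2 * t" 2 t g1] by (simp add: o_def)
      then have "(g has_vector_derivative 2 *\<^sub>R X (u1 (2 * t)) (g1 (2 * t))) (at t)"
        by (rule has_vector_derivative_transform_within_open[of _ _ _ "{..<1/2}"]) (use True in \<open>auto simp: g_def\<close>)
      then show ?thesis using True by (simp add: g_def u_def linear_cmul[OF linear_X])
    next
      case False
      then have t2: "t > 1/2" using t by (auto simp: F_def)
      have "2 * t - 1 \<notin> F2" using t imageI[of "2 * t - 1" F2 "\<lambda>t. (t + 1) / 2"] by (auto simp: F_def)
      then have "(g2 has_vector_derivative X (u2 (2 * t - 1)) (g2 (2 * t - 1))) (at (2 * t - 1))"
        using t2 t by (intro F2) auto
      moreover have "((\<lambda>t. 2 * t - 1) has_vector_derivative 2) (at t)" by (auto intro!: derivative_eq_intros)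
      ultimately have "((\<lambda>t. g2 (2 * t - 1)) has_vector_derivative 2 *\<^sub>R X (u2 (2 * t - 1)) (g2 (2 * t - 1))) (at t)"
        using vector_diff_chain_at[of "\<lambda>t. 2 * t - 1" 2 t g2] by (simp add: o_def)
      then have "(g has_vector_derivative 2 *\<^sub>R X (u2 (2 * t - 1)) (g2 (2 * t - 1))) (at t)"
        by (rule has_vector_derivative_transform_within_open[of _ _ _ "{1/2<..}"]) (use t2 in \<open>auto simp: g_def\<close>)
      then show ?thesis using t2 by (simp add: g_def u_def linear_cmul[OF linear_X])
    qed
    moreover have "finite F" using F1 F2 by (simp add: F_def)
    ultimately show "\<exists>F. finite F \<and> (\<forall>t\<in>{0<..<1} - F. (g has_vector_derivative X (u t) (g t)) (at t))"
      by blast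
  qed
  moreover have "cost u g \<le> a + b"
  proof -
    define f1 f2 where "f1 s = ennreal (\<Psi> (g1 s) (u1 s)) * indicator {0..1} s"
      and "f2 s = ennreal (\<Psi> (g2 s) (u2 s)) * indicator {0..1} s" for s :: real
    have [measurable]: "f1 \<in> borel_measurable borel" "f2 \<in> borel_measurable borel"
      unfolding f1_def[abs_def] f2_def[abs_def] by measurable
    \<comment> \<open>Only an inequality, since at \<open>t = 1/2\<close> both terms on the right
      may be positive.\<close>
    have "cost u g \<le> (\<integral>\<^sup>+t. 2 * f1 (0 + 2 * t) + 2 * f2 (- 1 + 2 * t) \<partial>lborel)"
      unfolding cost_def
    proof (rule nn_integral_mono)
      fix t :: real
      have "ennreal (\<Psi> x (2 *\<^sub>R w)) = 2 * ennreal (\<Psi> x w)" if "w \<in> V" for x w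
        using \<Psi>_scale[OF that, of x 2] \<Psi>_nonneg[of x w] by (simp add: ennreal_mult)
      then show "ennreal (\<Psi> (g t) (u t)) * indicator {0..1} t \<le> 2 * f1 (0 + 2 * t) + 2 * f2 (- 1 + 2 * t)"
        using u1(1) u2(1) by (auto simp: g_def u_def f1_def f2_def indicator_def algebra_simps)
    qed
    also have "\<dots> = (\<integral>\<^sup>+t. f1 t \<partial>lborel) + (\<integral>\<^sup>+t. f2 t \<partial>lborel)"
      by (simp add: nn_integral_add nn_integral_cmult nn_integral_real_affine[of f1 2 0]
          nn_integral_real_affine[of f2 2 "-1"])
    also have "\<dots> \<le> a + b"
      using e1 e2 by (intro add_mono) (simp_all add: cost_def f1_def f2_def)
    finally show ?thesis .
  qed
  moreover have "g 0 = x" "g 1 = z" using e1 e2 by (simp_all add: g_def)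
  ultimately show ?thesis unfolding joins_def by blast
qed

lemma continuous_line: "continuous_on S (\<lambda>t. x \<odot> (t *\<^sub>R w))"
  by (intro continuous_intros)

lemma joins_line:
  assumes w: "w \<in> V"
  shows "joins x (x \<odot> w) (\<integral>\<^sup>+t\<in>{0..1}. ennreal (\<Psi> (x \<odot> (t *\<^sub>R w)) w) \<partial>lborel)"
proof -
  define g where "g t = x \<odot> (t *\<^sub>R w)" for t
  have der: "(g has_vector_derivative X w (g t)) (at t within S)" for t S
    unfolding g_def by (rule line_has_vector_derivative)
  have "continuous_on {0..1} (\<lambda>t. X w (g t))"
  proof -
    have "continuous_on {0..1} (\<lambda>t. (g t, w))" unfolding g_def by (intro continuous_intros)
    from continuous_on_compose2[OF continuous_X this] show ?thesis by simp
  qed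
  then have "bounded ((\<lambda>t. X w (g t)) ` {0..1})"
    by (intro compact_imp_bounded compact_continuous_image) auto
  then obtain C where C: "C > 0" "\<And>t. t \<in> {0..1} \<Longrightarrow> norm (X w (g t)) \<le> C"
    by (auto simp: bounded_pos)
  have "C-lipschitz_on {0..1} g"
  proof (rule bounded_derivative_imp_lipschitz[OF der[unfolded has_vector_derivative_def]])
    fix t :: real assume "t \<in> {0..1}"
    then show "onorm (\<lambda>h. h *\<^sub>R X w (g t)) \<le> C"
      using mult_left_mono[OF C(2), of t "norm h" for h :: real]
      by (intro onorm_le) (simp add: mult.commute)
  qed (use C in auto)
  moreover have "g \<in> borel_measurable borel"
    unfolding g_def[abs_def] by (intro borel_measurable_continuous_onI continuous_line)
  ultimately have "ctrl_path (\<lambda>_. w) g"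
    unfolding ctrl_path_def using w der by (auto intro!: exI[of _ "{}"] simp: image_constant_conv)
  then show ?thesis
    unfolding joins_def by (intro exI[of _ "\<lambda>_. w"] exI[of _ g]) (simp add: cost_def g_def)
qed

text \<open>The constant is the upper bound of \<open>\<Psi>\<close> relative to
  \<open>norm\<close>, which is independent of the base point, so polygons may be left-translated to
  start at \<open>x\<close>.\<close>

lemma joins_reach: "\<exists>K>0. \<forall>x p l. reach p l \<longrightarrow> joins x (x \<odot> p) (ennreal (K * l))"
proof -
  obtain K where K: "K > 0" "\<And>x w. w \<in> V \<Longrightarrow> \<Psi> x w \<le> K * norm w" using \<Psi>_bounds by metis
  have line: "joins x (x \<odot> w) (ennreal (K * norm w))" if w: "w \<in> V" for x w
  proof -
    have "(\<integral>\<^sup>+t\<in>{0..1}. ennreal (\<Psi> (x \<odot> (t *\<^sub>R w)) w) \<partial>lborel) \<le> (\<integral>\<^sup>+t\<in>{0..1::real}. ennreal (K * norm w) \<partial>lborel)"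
      using K(2)[OF w] by (intro nn_integral_mono mult_right_mono ennreal_leI) auto
    also have "\<dots> = ennreal (K * norm w)" by (simp add: nn_integral_cmult_indicator)
    finally show ?thesis using joins_line[OF w, of x] order_trans unfolding joins_def by blast
  qed
  have "joins x (x \<odot> p) (ennreal (K * l))" if "reach p l" for x p l
    using that
  proof (induction rule: reach.induct)
    case reach_0
    then show ?case using line[OF subspace_0[OF subspace_layer1], of x] by simp
  next
    case (reach_step p l w)
    from joins_trans[OF reach_step.IH line[OF reach_step.hyps(2)]]
    show ?case using K(1) reach_nonneg[OF reach_step.hyps(1)]
      by (simp add: gr.assoc ennreal_plus[symmetric] distrib_left del: ennreal_plus)
  qed
  then show ?thesis using K(1) by blast
qed


section \<open>Difference bounds for the metric derivative\<close>

lemma metric_derivative_eq: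
  "metric_derivative G d (x, v) =
    Limsup (at 0) (\<lambda>t. d x (x \<odot> (t *\<^sub>R to_layer G x v)) / ennreal \<bar>t\<bar>)"
  by (simp add: metric_derivative_def lie_exp_eq)

lemma metric_derivative_le:
  assumes "\<And>e. e > 0 \<Longrightarrow> eventually (\<lambda>t. d x (x \<odot> (t *\<^sub>R to_layer G x v)) \<le> ennreal (\<bar>t\<bar> * (c + e))) (at 0)"
    and "c \<ge> 0"
  shows "metric_derivative G d (x, v) \<le> ennreal c"
  unfolding metric_derivative_eq
proof (rule ennreal_le_epsilon)
  fix e :: real assume "e > 0"
  have "eventually (\<lambda>t::real. t \<noteq> 0) (at 0)" by (simp add: eventually_at_filter)
  with assms(1)[OF \<open>e > 0\<close>]
  have "eventually (\<lambda>t. d x (x \<odot> (t *\<^sub>R to_layer G x v)) / ennreal \<bar>t\<bar> \<le> ennreal c + ennreal e) (at 0)"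
  proof eventually_elim
    case (elim t)
    then show ?case
      using assms(2) \<open>e > 0\<close>
      by (intro divide_le_posI_ennreal) (auto simp: ennreal_mult ennreal_plus[symmetric] simp del: ennreal_plus)
  qed
  then show "Limsup (at 0) (\<lambda>t. d x (x \<odot> (t *\<^sub>R to_layer G x v)) / ennreal \<bar>t\<bar>) \<le> ennreal c + ennreal e"
    by (rule Limsup_bounded)
qed

lemma metric_derivative_ge:
  assumes "\<And>e. e > 0 \<Longrightarrow> eventually (\<lambda>t. ennreal (\<bar>t\<bar> * (c - e)) \<le> d x (x \<odot> (t *\<^sub>R to_layer G x v))) (at 0)"
  shows "ennreal c \<le> metric_derivative G d (x, v)"
  unfolding metric_derivative_eq
proof (rule ennreal_le_epsilon)
  fix e :: real assume "e > 0"
  let ?L = "Limsup (at 0) (\<lambda>t. d x (x \<odot> (t *\<^sub>R to_layer G x v)) / ennreal \<bar>t\<bar>)"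
  have "eventually (\<lambda>t::real. t \<noteq> 0) (at 0)" by (simp add: eventually_at_filter)
  with assms(1)[OF \<open>e > 0\<close>]
  have "eventually (\<lambda>t. ennreal (c - e) \<le> d x (x \<odot> (t *\<^sub>R to_layer G x v)) / ennreal \<bar>t\<bar>) (at 0)"
  proof eventually_elim
    case (elim t)
    \<comment> \<open>If \<open>c - e\<close> is negative, both sides are \<open>0\<close> in
      \<open>ennreal\<close>.\<close>
    then have "ennreal (c - e) = ennreal (\<bar>t\<bar> * (c - e)) / ennreal \<bar>t\<bar>"
      by (cases "c - e \<ge> 0") (auto simp: divide_ennreal ennreal_neg mult_nonneg_nonpos)
    also have "\<dots> \<le> d x (x \<odot> (t *\<^sub>R to_layer G x v)) / ennreal \<bar>t\<bar>"
      using elim by (intro divide_right_mono_ennreal)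
    finally show ?case .
  qed
  then have "ennreal (c - e) \<le> ?L" by (intro le_Limsup) auto
  have "ennreal c \<le> ennreal (c - e) + ennreal e"
  proof (cases "c - e \<ge> 0")
    case True
    then show ?thesis using \<open>e > 0\<close> by (simp add: ennreal_plus[symmetric] del: ennreal_plus)
  next
    case False
    then have "ennreal c \<le> ennreal e" by (intro ennreal_leI) simp
    then show ?thesis by (simp add: add_increasing)
  qed
  also have "\<dots> \<le> ?L + ennreal e" using \<open>ennreal (c - e) \<le> ?L\<close> by (rule add_right_mono)
  finally show "ennreal c \<le> ?L + ennreal e" .
qed

subsection \<open>Upper bounds along rays\<close>

text \<open>The mean of \<open>\<Psi>\<close> over the ray up to time \<open>t\<close>.
  Parametrising by the unit interval covers negative \<open>t\<close> and gives
  \<open>\<Psi> x w\<close> at \<open>t = 0\<close>.\<close>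

definition ray_mean :: "'a \<Rightarrow> 'a \<Rightarrow> real \<Rightarrow> ennreal" where
  "ray_mean x w t = (\<integral>\<^sup>+r\<in>{0..1}. ennreal (\<Psi> (x \<odot> ((r * t) *\<^sub>R w)) w) \<partial>lborel)"

lemma mult_measurable [measurable (raw)]:
  assumes "f \<in> borel_measurable N" "g \<in> borel_measurable N"
  shows "(\<lambda>x. f x \<odot> g x) \<in> borel_measurable N"
  using measurable_compose[OF borel_measurable_Pair[OF assms] borel_measurable_continuous_onI[OF continuous_M]]
  by (simp add: M_def)

lemma joins_ray:
  assumes w: "w \<in> V"
  shows "joins x (x \<odot> (t *\<^sub>R w)) (ennreal \<bar>t\<bar> * ray_mean x w t)"
proof -
  have "(\<integral>\<^sup>+r\<in>{0..1}. ennreal (\<Psi> (x \<odot> (r *\<^sub>R t *\<^sub>R w)) (t *\<^sub>R w)) \<partial>lborel) =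
      (\<integral>\<^sup>+r. ennreal \<bar>t\<bar> * (ennreal (\<Psi> (x \<odot> ((r * t) *\<^sub>R w)) w) * indicator {0..1} r) \<partial>lborel)"
    using \<Psi>_nonneg by (intro nn_integral_cong) (simp add: \<Psi>_scale[OF w] ennreal_mult mult.assoc)
  also have "\<dots> = ennreal \<bar>t\<bar> * ray_mean x w t"
    unfolding ray_mean_def by (intro nn_integral_cmult) measurable
  finally show ?thesis
    using joins_line[OF subspace_scale[OF subspace_layer1 w], of x t] by simp
qed

lemma ray_mean_le:
  assumes "\<And>s. \<bar>s\<bar> \<le> \<bar>t\<bar> \<Longrightarrow> \<Psi> (x \<odot> (s *\<^sub>R w)) w \<le> c"
  shows "ray_mean x w t \<le> ennreal c"
proof -
  have "ray_mean x w t \<le> (\<integral>\<^sup>+r\<in>{0..1::real}. ennreal c \<partial>lborel)"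
    unfolding ray_mean_def
  proof (intro nn_integral_mono)
    fix r :: real
    have "\<bar>r * t\<bar> \<le> \<bar>t\<bar>" if "r \<in> {0..1}" using that by (auto simp: abs_mult mult_left_le_one_le)
    then show "ennreal (\<Psi> (x \<odot> ((r * t) *\<^sub>R w)) w) * indicator {0..1} r \<le> ennreal c * indicator {0..1} r"
      by (cases "r \<in> {0..1}") (auto intro!: ennreal_leI assms)
  qed
  also have "\<dots> = ennreal c" by (simp add: nn_integral_cmult_indicator)
  finally show ?thesis .
qed

theorem usc_metric_derivative_le:
  assumes usc: "upper_semicontinuous_map (hbundle_topology G) \<psi>" and w: "w \<in> V"
  shows "metric_derivative G (intrinsic_distance G \<psi>) (x, X w x) \<le> ennreal (\<Psi> x w)"
proof (rule metric_derivative_le)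
  fix e :: real assume "e > 0"
  define c where "c = \<Psi> x w + e"
  have "openin (top_of_set (UNIV \<times> V)) {z \<in> UNIV \<times> V. (fst z, X (snd z) (fst z)) \<in> {p \<in> hbundle G. \<psi> p < c}}"
    using usc unfolding upper_semicontinuous_map_def topspace_hbundle by (intro openin_hbundle_pullback) blast
  moreover have "(x, w) \<in> {z \<in> UNIV \<times> V. (fst z, X (snd z) (fst z)) \<in> {p \<in> hbundle G. \<psi> p < c}}"
    using w X_hbundle \<open>e > 0\<close> by (auto simp: c_def \<Psi>_def)
  ultimately obtain T where T: "open T" "(x, w) \<in> T"
      "\<And>y. (y, w) \<in> T \<Longrightarrow> \<Psi> y w < c"
    unfolding openin_open using w by (auto simp: \<Psi>_def set_eq_iff)
  have "continuous_on UNIV (\<lambda>s. (x \<odot> (s *\<^sub>R w), w))" by (intro continuous_intros)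
  then have "open ((\<lambda>s. (x \<odot> (s *\<^sub>R w), w)) -` T)"
    using T(1) by (simp add: open_vimage)
  moreover have "0 \<in> (\<lambda>s. (x \<odot> (s *\<^sub>R w), w)) -` T" using T(2) by simp
  ultimately obtain d where d: "d > 0" "ball 0 d \<subseteq> (\<lambda>s. (x \<odot> (s *\<^sub>R w), w)) -` T"
    using open_contains_ball by blast
  have "intrinsic_distance G \<psi> x (x \<odot> (t *\<^sub>R w)) \<le> ennreal (\<bar>t\<bar> * c)" if "\<bar>t\<bar> < d" for t
  proof -
    have "\<Psi> (x \<odot> (s *\<^sub>R w)) w \<le> c" if "\<bar>s\<bar> \<le> \<bar>t\<bar>" for s
      using d(2) T(3) that \<open>\<bar>t\<bar> < d\<close> by (intro less_imp_le) (auto simp: subset_iff)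
    then have "ray_mean x w t \<le> ennreal c" by (rule ray_mean_le)
    then have "ennreal \<bar>t\<bar> * ray_mean x w t \<le> ennreal \<bar>t\<bar> * ennreal c" by (rule mult_left_mono) simp
    then show ?thesis
      using joins_imp_intrinsic_distance_le[OF joins_ray[OF w, of x t]] \<Psi>_nonneg[of x w] \<open>e > 0\<close>
      by (simp add: ennreal_mult c_def)
  qed
  then show "eventually (\<lambda>t. intrinsic_distance G \<psi> x (x \<odot> (t *\<^sub>R to_layer G x (X w x)))
      \<le> ennreal (\<bar>t\<bar> * (\<Psi> x w + e))) (at 0)"
    using d(1) unfolding eventually_at c_def[symmetric] to_layer_X by (intro exI[of _ d]) auto
qed (rule \<Psi>_nonneg)

subsection \<open>Lebesgue points along rays\<close>

text \<open>A one-sided Lebesgue point condition along the ray: in the limit the means do not exceed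
  the value.\<close>

definition ray_point :: "'a \<Rightarrow> 'a \<Rightarrow> bool" where
  "ray_point w x \<longleftrightarrow> (\<forall>e>0. \<exists>d>0. \<forall>t. \<bar>t\<bar> < d \<longrightarrow> ray_mean x w t \<le> ennreal (\<Psi> x w + e))"

text \<open>\<open>\<bar>t\<bar> * ray_mean x w t\<close> is the integral of a nonnegative function
  over the time segment between \<open>0\<close> and \<open>t\<close>, hence monotone in the
  segment. This bridges rational and irrational times.\<close>

lemma ray_mean_mono:
  assumes "w \<in> V" "0 \<le> c" "c \<le> 1"
  shows "ennreal \<bar>c * t\<bar> * ray_mean x w (c * t) \<le> ennreal \<bar>t\<bar> * ray_mean x w t"
proof (cases "c * t = 0")
  case False
  then have nz: "c * t \<noteq> 0" "t \<noteq> 0" by auto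
  define g where "g r = \<Psi> (x \<odot> (r *\<^sub>R w)) w" for r
  have [measurable]: "g \<in> borel_measurable borel" unfolding g_def[abs_def] by measurable
  have rm: "ray_mean x w t = (\<integral>\<^sup>+r\<in>{0..1}. ennreal (g (0 + r * t)) \<partial>lborel)" for t
    by (simp add: ray_mean_def g_def)
  have "{min 0 (0 + c * t)..max 0 (0 + c * t)} \<subseteq> {min 0 (0 + t)..max 0 (0 + t)}"
    using assms(2,3) mult_right_mono[of c 1 t] mult_right_mono_neg[of c 1 t] mult_nonneg_nonneg[of c t]
      mult_nonneg_nonpos[of c t]
    by (cases "t \<ge> 0") (auto simp: min_def max_def)
  then show ?thesis
    unfolding rm nn_integral_segment[OF \<open>g \<in> _\<close> nz(1)] nn_integral_segment[OF \<open>g \<in> _\<close> nz(2)]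
    by (intro nn_integral_mono mult_left_mono) (auto simp: indicator_def)
qed auto

text \<open>Countably many conditions make the set of ray points Borel, as the application of Fubini
  requires.\<close>

lemma ray_point_rational:
  assumes w: "w \<in> V"
  shows "ray_point w x \<longleftrightarrow> (\<forall>n::nat. \<exists>m::nat. \<forall>t\<in>\<rat>. \<bar>t\<bar> < 1 / Suc m \<longrightarrow>
    ray_mean x w t \<le> ennreal (\<Psi> x w + 1 / Suc n))" (is "_ \<longleftrightarrow> ?R")
proof
  assume l: "ray_point w x"
  show ?R
  proof
    fix n :: nat
    have "(0::real) < 1 / Suc n" by simp
    with l obtain d where d: "d > 0" "\<And>t. \<bar>t\<bar> < d \<Longrightarrow> ray_mean x w t \<le> ennreal (\<Psi> x w + 1 / Suc n)"
      unfolding ray_point_def by metis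
    obtain m where "1 / real (Suc m) < d" using d(1) nat_approx_posE by blast
    then show "\<exists>m::nat. \<forall>t\<in>\<rat>. \<bar>t\<bar> < 1 / Suc m \<longrightarrow> ray_mean x w t \<le> ennreal (\<Psi> x w + 1 / Suc n)"
      using d(2) by (intro exI[of _ m]) auto
  qed
next
  assume r: ?R
  show "ray_point w x"
    unfolding ray_point_def
  proof (intro allI impI)
    fix e :: real assume "e > 0"
    define p where "p = \<Psi> x w"
    have "p \<ge> 0" by (simp add: p_def \<Psi>_nonneg)
    have "e / 2 > 0" using \<open>e > 0\<close> by simp
    then obtain n where n: "1 / real (Suc n) < e / 2" using nat_approx_posE by blast
    obtain m where m: "\<And>t. t \<in> \<rat> \<Longrightarrow> \<bar>t\<bar> < 1 / Suc m \<Longrightarrow> ray_mean x w t \<le> ennreal (p + 1 / Suc n)"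
      using r unfolding p_def by blast
    have rat: "ray_mean x w t \<le> ennreal (p + e / 2)" if "t \<in> \<rat>" "\<bar>t\<bar> < 1 / Suc m" for t
      by (rule order_trans[OF m[OF that] ennreal_leI]) (use n in simp)
    show "\<exists>d>0. \<forall>t. \<bar>t\<bar> < d \<longrightarrow> ray_mean x w t \<le> ennreal (\<Psi> x w + e)"
    proof (intro exI[of _ "1 / Suc m"] conjI allI impI)
      fix t :: real assume t: "\<bar>t\<bar> < 1 / Suc m"
      show "ray_mean x w t \<le> ennreal (\<Psi> x w + e)"
      proof (cases "t = 0")
        case True
        then show ?thesis using rat[of t] t n \<open>e > 0\<close> unfolding p_def
          by (intro order_trans[OF rat ennreal_leI]) (auto simp: p_def)
      next
        case False
        \<comment> \<open>A rational \<open>q\<close> between \<open>\<bar>t\<bar>\<close> and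
          \<open>b\<close> satisfies \<open>q * (p + e / 2) \<le> \<bar>t\<bar> * (p + e)\<close>,
          so the slack \<open>e / 2\<close> absorbs the longer segment; the first entry keeps
          \<open>q\<close> in the range of \<open>rat\<close>.\<close>
        define b where "b = min (1 / Suc m) (\<bar>t\<bar> * (p + e) / (p + e / 2))"
        have "\<bar>t\<bar> * (p + e / 2) < \<bar>t\<bar> * (p + e)" using False \<open>e > 0\<close> by simp
        then have "\<bar>t\<bar> < b" using t \<open>e > 0\<close> \<open>p \<ge> 0\<close> by (auto simp: b_def field_simps)
        then obtain q where q: "q \<in> \<rat>" "\<bar>t\<bar> < q" "q < b" using Rats_dense_in_real by blast
        define s where "s = sgn t * q"
        have "s \<in> \<rat>" using q(1) by (auto simp: s_def sgn_if)
        have s: "\<bar>s\<bar> = q" using False q by (auto simp: s_def abs_mult sgn_if)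
        have "t = (\<bar>t\<bar> / q) * s" using q False by (auto simp: s_def sgn_if)
        then have "ennreal \<bar>t\<bar> * ray_mean x w t \<le> ennreal \<bar>s\<bar> * ray_mean x w s"
          using ray_mean_mono[OF w, of "\<bar>t\<bar> / q" s x] q by auto
        also have "\<dots> \<le> ennreal \<bar>s\<bar> * ennreal (p + e / 2)"
          using rat[OF \<open>s \<in> \<rat>\<close>] q s by (intro mult_left_mono) (auto simp: b_def)
        also have "\<dots> = ennreal (q * (p + e / 2))"
          using q s \<open>p \<ge> 0\<close> \<open>e > 0\<close> by (simp add: ennreal_mult)
        also have "\<dots> \<le> ennreal (\<bar>t\<bar> * (p + e))"
        proof (rule ennreal_leI)
          have "q \<le> \<bar>t\<bar> * (p + e) / (p + e / 2)" using q by (simp add: b_def)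
          then show "q * (p + e / 2) \<le> \<bar>t\<bar> * (p + e)"
            using \<open>p \<ge> 0\<close> \<open>e > 0\<close> by (simp add: pos_le_divide_eq add_nonneg_pos)
        qed
        also have "\<dots> = ennreal \<bar>t\<bar> * ennreal (p + e)"
          using \<open>p \<ge> 0\<close> \<open>e > 0\<close> by (simp add: ennreal_mult)
        finally show ?thesis using False by (simp add: ennreal_mult_le_mult_iff p_def)
      qed
    qed simp
  qed
qed

text \<open>On each ray almost every time gives a ray point. Fubini exchanges point and time, so
  some fixed \<open>s\<close> works for almost every \<open>x\<close>. The complement of
  \<open>B\<close> is then the image of a null set under right translation by
  \<open>s *\<^sub>R w\<close>, a differentiable map.\<close>

lemma AE_ray_point:
  assumes w: "w \<in> V"
  shows "AE x in lebesgue. ray_point w x"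
proof -
  define B where "B = {x. ray_point w x}"
  have "{x \<in> space borel. \<forall>n::nat. \<exists>m::nat. \<forall>t\<in>\<rat>. \<bar>t\<bar> < 1 / Suc m \<longrightarrow>
    ray_mean x w t \<le> ennreal (\<Psi> x w + 1 / Suc n)} \<in> sets borel"
  proof -
    have [measurable]: "(\<lambda>x. ray_mean x w t) \<in> borel_measurable borel" for t
      unfolding ray_mean_def by measurable
    have "countable \<rat>" by (rule countable_rat)
    then show ?thesis by measurable
  qed
  then have [measurable]: "B \<in> sets borel" unfolding B_def ray_point_rational[OF w] by simp
  obtain K where K: "\<And>x w. w \<in> V \<Longrightarrow> \<Psi> x w \<le> K * norm w" using \<Psi>_bounds by metis
  have "AE s in lborel. x \<odot> (s *\<^sub>R w) \<in> B" for x
  proof -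
    have "(\<lambda>r. \<Psi> (x \<odot> (r *\<^sub>R w)) w) \<in> borel_measurable borel" by measurable
    from AE_lebesgue_upper_derivative[OF this, of "K * norm w"]
    have "AE s in lborel. \<forall>e>0. \<exists>d>0. \<forall>t. \<bar>t\<bar> < d \<longrightarrow>
        (\<integral>\<^sup>+r\<in>{0..1}. ennreal (\<Psi> (x \<odot> ((s + r * t) *\<^sub>R w)) w) \<partial>lborel) \<le>
        ennreal (\<Psi> (x \<odot> (s *\<^sub>R w)) w + e)"
      using K[OF w] \<Psi>_nonneg by blast
    moreover have "ray_mean (x \<odot> (s *\<^sub>R w)) w t =
        (\<integral>\<^sup>+r\<in>{0..1}. ennreal (\<Psi> (x \<odot> ((s + r * t) *\<^sub>R w)) w) \<partial>lborel)" for s t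
      by (simp add: ray_mean_def gr.assoc line_mult)
    ultimately show ?thesis by (simp add: B_def ray_point_def)
  qed
  then have "AE x in lborel. AE s in lborel. x \<odot> (s *\<^sub>R w) \<in> B" by simp
  then have "AE s in (lborel :: real measure). AE x in (lborel :: 'a measure). x \<odot> (s *\<^sub>R w) \<in> B"
    by (subst (asm) lborel_pair.AE_commute) measurable
  \<comment> \<open>One good time is enough, and it exists because the time axis has positive
    measure.\<close>
  then obtain s :: real where "AE x in (lborel :: 'a measure). x \<odot> (s *\<^sub>R w) \<in> B"
    using eventually_happens'[of "ae_filter (lborel :: real measure)"]
    by (auto simp: ae_filter_eq_bot_iff emeasure_lborel_UNIV)
  then have "AE x in lebesgue. x \<odot> (s *\<^sub>R w) \<in> B" by (simp add: AE_completion)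
  then have "{x. x \<odot> (s *\<^sub>R w) \<notin> B} \<in> null_sets lebesgue"
  proof (subst AE_iff_null_sets)
    have "{x \<in> space borel. x \<odot> (s *\<^sub>R w) \<notin> B} \<in> sets borel" by measurable
    then show "{x. x \<odot> (s *\<^sub>R w) \<notin> B} \<in> sets lebesgue" by simp
  qed simp
  then have "negligible {x. x \<odot> (s *\<^sub>R w) \<notin> B}" by (simp add: negligible_iff_null_sets)
  moreover have "(\<lambda>x. x \<odot> (s *\<^sub>R w)) differentiable_on A" for A
    using right_translation_differentiable by (simp add: differentiable_on_def differentiable_at_withinI)
  ultimately have "negligible ((\<lambda>x. x \<odot> (s *\<^sub>R w)) ` {x. x \<odot> (s *\<^sub>R w) \<notin> B})"
    by (intro negligible_differentiable_image_negligible) auto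
  moreover have "- B \<subseteq> (\<lambda>x. x \<odot> (s *\<^sub>R w)) ` {x. x \<odot> (s *\<^sub>R w) \<notin> B}"
  proof
    fix y assume "y \<in> - B"
    moreover have "y = (y \<odot> (- (s *\<^sub>R w))) \<odot> (s *\<^sub>R w)" by (simp add: gr.assoc)
    ultimately show "y \<in> (\<lambda>x. x \<odot> (s *\<^sub>R w)) ` {x. x \<odot> (s *\<^sub>R w) \<notin> B}" by (metis ComplD image_eqI mem_Collect_eq)
  qed
  ultimately have "- B \<in> null_sets lebesgue"
    using negligible_subset negligible_iff_null_sets by blast
  then have "AE x in lebesgue. x \<notin> - B" by (rule AE_not_in)
  then show ?thesis by (simp add: B_def)
qed

text \<open>Countably many directions suffice: two rays with nearby directions are joined, at time \<open>t\<close>, by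
  a horizontal path of length \<open>o(1) t\<close>.\<close>

lemma ray_points_metric_derivative_le:
  assumes D: "D \<subseteq> V" "V \<subseteq> closure D" and x: "\<And>w. w \<in> D \<Longrightarrow> ray_point w x" and w0: "w0 \<in> V"
  shows "metric_derivative G (intrinsic_distance G \<psi>) (x, X w0 x) \<le> ennreal (\<Psi> x w0)"
proof (rule metric_derivative_le)
  fix e :: real assume "e > 0"
  obtain K where K: "K > 0" "\<And>x p l. reach p l \<Longrightarrow> joins x (x \<odot> p) (ennreal (K * l))"
    using joins_reach by blast
  obtain K' where K': "K' > 0" "\<And>x w. w \<in> V \<Longrightarrow> \<Psi> x w \<le> K' * norm w" using \<Psi>_bounds by metis
  \<comment> \<open>A third of \<open>e\<close> each for the connecting path, the change of
    \<open>\<Psi> x\<close> from \<open>w0\<close> to \<open>w\<close>, and the ray mean.\<close>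
  define \<eta> where "\<eta> = e / (3 * K)"
  have "\<eta> > 0" using \<open>e > 0\<close> K by (simp add: \<eta>_def)
  from reach_between_rays[OF w0 this] obtain \<delta> where \<delta>: "\<delta> > 0" "\<And>w t. w \<in> V \<Longrightarrow> norm (w - w0) < \<delta> \<Longrightarrow>
     \<exists>a\<le>\<bar>t\<bar> * \<eta>. reach ((- (t *\<^sub>R w)) \<odot> (t *\<^sub>R w0)) a" by blast
  have "min \<delta> (e / (3 * K')) > 0" using \<delta>(1) \<open>e > 0\<close> K' by simp
  then obtain w where w: "w \<in> D" "dist w w0 < min \<delta> (e / (3 * K'))"
    using D(2) w0 closure_approachable by blast
  have wV: "w \<in> V" using w D by blast
  \<comment> \<open>Convexity bounds the change of direction by the value on the difference
    \<open>w - w0\<close>.\<close>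
  have "\<Psi> x w \<le> \<Psi> x w0 + \<Psi> x (w - w0)"
    using \<Psi>_add[of w0 "w - w0" x] w0 wV subspace_diff[OF subspace_layer1] by simp
  also have "\<Psi> x (w - w0) \<le> K' * norm (w - w0)"
    using w0 wV by (intro K' subspace_diff[OF subspace_layer1])
  also have "\<dots> \<le> K' * (e / (3 * K'))" using w K' by (intro mult_left_mono) (auto simp: dist_norm)
  also have "\<dots> = e / 3" using K' by simp
  finally have \<Psi>w: "\<Psi> x w \<le> \<Psi> x w0 + e / 3" by simp
  have "e / 3 > 0" using \<open>e > 0\<close> by simp
  with x[OF w(1)] obtain d where d: "d > 0" "\<And>t. \<bar>t\<bar> < d \<Longrightarrow> ray_mean x w t \<le> ennreal (\<Psi> x w + e / 3)"
    unfolding ray_point_def by blast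
  have "intrinsic_distance G \<psi> x (x \<odot> (t *\<^sub>R w0)) \<le> ennreal (\<bar>t\<bar> * (\<Psi> x w0 + e))" if t: "\<bar>t\<bar> < d" for t
  proof -
    obtain a where a: "a \<le> \<bar>t\<bar> * \<eta>" "reach ((- (t *\<^sub>R w)) \<odot> (t *\<^sub>R w0)) a"
      using \<delta>(2)[OF wV, of t] w by (auto simp: dist_norm)
    have "joins (x \<odot> (t *\<^sub>R w)) (x \<odot> (t *\<^sub>R w0)) (ennreal (K * a))"
      using K(2)[OF a(2), of "x \<odot> (t *\<^sub>R w)"] by (simp add: gr.assoc)
    from joins_trans[OF joins_ray[OF wV] this]
    have "intrinsic_distance G \<psi> x (x \<odot> (t *\<^sub>R w0)) \<le> ennreal \<bar>t\<bar> * ray_mean x w t + ennreal (K * a)"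
      by (rule joins_imp_intrinsic_distance_le)
    also have "\<dots> \<le> ennreal \<bar>t\<bar> * ennreal (\<Psi> x w0 + e / 3 + e / 3) + ennreal (\<bar>t\<bar> * (e / 3))"
    proof (intro add_mono mult_left_mono ennreal_leI)
      show "ray_mean x w t \<le> ennreal (\<Psi> x w0 + e / 3 + e / 3)"
        using \<Psi>w by (intro order_trans[OF d(2)[OF t] ennreal_leI]) simp
      have "K * a \<le> K * (\<bar>t\<bar> * \<eta>)" using a K by (intro mult_left_mono) auto
      also have "\<dots> = \<bar>t\<bar> * (e / 3)" using K by (simp add: \<eta>_def)
      finally show "K * a \<le> \<bar>t\<bar> * (e / 3)" .
    qed simp
    also have "\<dots> = ennreal (\<bar>t\<bar> * (\<Psi> x w0 + e / 3 + e / 3) + \<bar>t\<bar> * (e / 3))"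
      using \<Psi>_nonneg[of x w0] \<open>e > 0\<close> by (subst ennreal_mult[symmetric]) (auto simp: ennreal_plus)
    also have "\<bar>t\<bar> * (\<Psi> x w0 + e / 3 + e / 3) + \<bar>t\<bar> * (e / 3) = \<bar>t\<bar> * (\<Psi> x w0 + e)"
      by (simp add: algebra_simps)
    finally show ?thesis .
  qed
  then show "eventually (\<lambda>t. intrinsic_distance G \<psi> x (x \<odot> (t *\<^sub>R to_layer G x (X w0 x)))
      \<le> ennreal (\<bar>t\<bar> * (\<Psi> x w0 + e))) (at 0)"
    using d(1) unfolding eventually_at to_layer_X by (intro exI[of _ d]) auto
qed (rule \<Psi>_nonneg)

theorem AE_metric_derivative_le:
  "AE x in lebesgue. \<forall>v\<in>hfiber G x. metric_derivative G (intrinsic_distance G \<psi>) (x, v) \<le> ennreal (\<psi> (x, v))"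
proof -
  obtain D where D: "countable D" "D \<subseteq> V" "V \<subseteq> closure D" using separable by blast
  have "AE x in lebesgue. \<forall>w\<in>D. ray_point w x"
    using D by (subst AE_ball_countable) (auto intro: AE_ray_point)
  then show ?thesis
  proof eventually_elim
    case (elim x)
    show ?case
    proof
      fix v assume v: "v \<in> hfiber G x"
      then have "to_layer G x v \<in> V" by (simp add: hfiber_eq)
      from ray_points_metric_derivative_le[OF D(2,3) _ this, of x] elim
      show "metric_derivative G (intrinsic_distance G \<psi>) (x, v) \<le> ennreal (\<psi> (x, v))"
        by (simp add: \<Psi>_eq[OF v] X_to_layer)
    qed
  qed
qed


subsection \<open>The lower bound\<close>

lemma lsc_\<Psi>:
  assumes lsc: "lower_semicontinuous_map (hbundle_topology G) \<psi>" and w: "w \<in> V" and "c < \<Psi> x w"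
  obtains T where "open T" "(x, w) \<in> T" "\<And>y u. (y, u) \<in> T \<Longrightarrow> u \<in> V \<Longrightarrow> c < \<Psi> y u"
proof -
  have "openin (top_of_set (UNIV \<times> V)) {z \<in> UNIV \<times> V. (fst z, X (snd z) (fst z)) \<in> {p \<in> hbundle G. \<psi> p > c}}"
    using lsc unfolding lower_semicontinuous_map_def topspace_hbundle by (intro openin_hbundle_pullback) blast
  moreover have "(x, w) \<in> {z \<in> UNIV \<times> V. (fst z, X (snd z) (fst z)) \<in> {p \<in> hbundle G. \<psi> p > c}}"
    using w X_hbundle assms(3) by (auto simp: \<Psi>_def)
  ultimately obtain T where "open T" "(x, w) \<in> T"
      "{z \<in> UNIV \<times> V. (fst z, X (snd z) (fst z)) \<in> {p \<in> hbundle G. \<psi> p > c}} = (UNIV \<times> V) \<inter> T"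
    unfolding openin_open by blast
  then show thesis by (intro that[of T]) (auto simp: \<Psi>_def set_eq_iff)
qed

text \<open>Velocities at points near \<open>x\<close> need not be horizontal at \<open>x\<close>.
  Projecting their trivialised form to the first layer extends \<open>\<Psi> x\<close> to a
  sublinear function on the whole space, applicable to velocities and to increments of curves
  alike.\<close>

definition frozen :: "'a \<Rightarrow> 'a \<Rightarrow> real" where
  "frozen x v = \<Psi> x (component (to_layer G x v) 1)"

lemma one_in_range: "1 \<in> {1..step G}" using step_pos by simp

lemma component_1: "component v 1 \<in> V" using component_layer[OF one_in_range] .

lemma frozen_X: "w \<in> V \<Longrightarrow> frozen x (X w x) = \<Psi> x w"
  using component_of_layer[of 1 1 w] one_in_range by (simp add: frozen_def to_layer_X)

lemma frozen_scale: "frozen x (c *\<^sub>R v) = \<bar>c\<bar> * frozen x v"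
  by (simp add: frozen_def linear_cmul[OF linear_to_layer] linear_cmul[OF linear_component[OF one_in_range]]
      \<Psi>_scale[OF component_1])

lemma frozen_add: "frozen x (v + u) \<le> frozen x v + frozen x u"
  using \<Psi>_add[OF component_1 component_1]
  by (simp add: frozen_def linear_add[OF linear_to_layer] linear_add[OF linear_component[OF one_in_range]])

text \<open>A sublinear function bounded by a multiple of the norm is Lipschitz.\<close>

lemma frozen_continuous: "continuous_on UNIV (frozen x)"
proof -
  have "bounded_linear (\<lambda>v. component (to_layer G x v) 1)"
    using linear_compose[OF linear_to_layer linear_component[OF one_in_range]]
    by (simp add: linear_conv_bounded_linear[symmetric] o_def)
  then obtain B where B: "B > 0" "\<And>v. norm (component (to_layer G x v) 1) \<le> norm v * B"
    using bounded_linear.pos_bounded by blast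
  obtain K where K: "K > 0" "\<And>x w. w \<in> V \<Longrightarrow> \<Psi> x w \<le> K * norm w" using \<Psi>_bounds by metis
  have le: "frozen x v \<le> K * B * norm v" for v
  proof -
    have "frozen x v \<le> K * norm (component (to_layer G x v) 1)" unfolding frozen_def by (rule K(2)[OF component_1])
    also have "\<dots> \<le> K * (norm v * B)" using B(2) K(1) by (intro mult_left_mono) auto
    finally show ?thesis by (simp add: mult_ac)
  qed
  have "(K * B)-lipschitz_on UNIV (frozen x)"
  proof (rule lipschitz_onI)
    fix u v
    have "frozen x u \<le> frozen x (u - v) + frozen x v" "frozen x v \<le> frozen x (v - u) + frozen x u"
      using frozen_add[of x "u - v" v] frozen_add[of x "v - u" u] by simp_all
    then show "dist (frozen x u) (frozen x v) \<le> K * B * dist u v"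
      using le[of "u - v"] le[of "v - u"] by (simp add: dist_norm norm_minus_commute abs_le_iff)
  qed (use K B in simp)
  then show ?thesis by (rule lipschitz_on_continuous_on)
qed

text \<open>Semicontinuity yields an additive error on unit vectors; the uniform lower bound
  \<open>k\<close> of \<open>\<Psi>\<close> there turns it into the factor
  \<open>1 + \<epsilon>\<close>, and homogeneity extends the result to all horizontal
  vectors.\<close>

lemma lsc_frozen_le:
  assumes lsc: "lower_semicontinuous_map (hbundle_topology G) \<psi>" and "\<epsilon> > 0"
  obtains \<delta> where "\<delta> > 0"
    "\<And>y v. dist y x < \<delta> \<Longrightarrow> v \<in> hfiber G y \<Longrightarrow> frozen x v \<le> (1 + \<epsilon>) * \<psi> (y, v)"
proof -
  obtain k where k: "k > 0" "\<And>x w. w \<in> V \<Longrightarrow> k * norm w \<le> \<Psi> x w" using \<Psi>_bounds by metis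
  define P where "P y w \<longleftrightarrow> frozen x (X w y) \<le> (1 + \<epsilon>) * \<Psi> y w" for y w
  have loc: "\<exists>T. open T \<and> (x, w) \<in> T \<and> (\<forall>y u. (y, u) \<in> T \<longrightarrow> u \<in> V \<longrightarrow> norm u = 1 \<longrightarrow> P y u)"
    if w: "w \<in> V" for w
  proof -
    \<comment> \<open>The error enters twice, from \<open>\<psi>\<close> and from
      \<open>frozen x\<close>, and
      \<open>2 * \<eta> = \<epsilon> * k \<le> \<epsilon> * \<Psi> y u\<close> for unit
      \<open>u\<close>.\<close>
    define \<eta> where "\<eta> = \<epsilon> * k / 2"
    have "\<eta> > 0" using \<open>\<epsilon> > 0\<close> k by (simp add: \<eta>_def)
    then have "\<Psi> x w - \<eta> < \<Psi> x w" by simp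
    from lsc_\<Psi>[OF lsc w this] obtain T where T: "open T" "(x, w) \<in> T"
      "\<And>y u. (y, u) \<in> T \<Longrightarrow> u \<in> V \<Longrightarrow> \<Psi> x w - \<eta> < \<Psi> y u" by blast
    define S where "S = (\<lambda>z. frozen x (X (snd z) (fst z))) -` {..< \<Psi> x w + \<eta>}"
    have "continuous_on UNIV (\<lambda>z. frozen x (X (snd z) (fst z)))"
      using continuous_on_compose2[OF frozen_continuous continuous_X] by (simp add: case_prod_unfold)
    then have "open S" unfolding S_def by (rule open_vimage[rotated]) simp
    show ?thesis
    proof (intro exI[of _ "T \<inter> S"] conjI allI impI)
      show "(x, w) \<in> T \<inter> S" using T(2) \<open>\<eta> > 0\<close> by (simp add: S_def frozen_X[OF w])
      fix y u assume *: "(y, u) \<in> T \<inter> S" "u \<in> V" "norm u = 1"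
      then have "frozen x (X u y) < \<Psi> y u + 2 * \<eta>" using T(3)[of y u] by (auto simp: S_def)
      also have "2 * \<eta> = \<epsilon> * k" by (simp add: \<eta>_def)
      also have "\<epsilon> * k \<le> \<epsilon> * \<Psi> y u" using k(2)[OF *(2), of y] *(3) \<open>\<epsilon> > 0\<close> by (intro mult_left_mono) auto
      finally show "P y u" by (simp add: P_def algebra_simps)
    qed (use T \<open>open S\<close> in auto)
  qed
  \<comment> \<open>Uniformity by sequences: counterexamples at distance below
    \<open>1 / Suc n\<close> would accumulate at some \<open>(x, w)\<close> with \<open>w\<close> a
    unit vector, inside the neighbourhood where \<open>P\<close> holds.\<close>
  have "\<exists>\<delta>>0. \<forall>y u. dist y x < \<delta> \<longrightarrow> u \<in> V \<longrightarrow> norm u = 1 \<longrightarrow> P y u"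
  proof (rule ccontr)
    assume "\<not> ?thesis"
    then have no: "\<exists>z. dist (fst z) x < \<delta> \<and> snd z \<in> V \<inter> sphere 0 1 \<and> \<not> P (fst z) (snd z)"
      if "\<delta> > 0" for \<delta> using that by (auto simp: Bex_def)
    have "\<exists>z. \<forall>n::nat. dist (fst (z n)) x < 1 / Suc n \<and> snd (z n) \<in> V \<inter> sphere 0 1 \<and> \<not> P (fst (z n)) (snd (z n))"
      by (rule choice) (use no in simp)
    then obtain z where z: "\<And>n::nat. dist (fst (z n)) x < 1 / Suc n" "\<And>n. snd (z n) \<in> V \<inter> sphere 0 1"
        "\<And>n. \<not> P (fst (z n)) (snd (z n))" by blast
    define y u where "y n = fst (z n)" and "u n = snd (z n)" for n
    note yu = z[folded y_def u_def]
    have "compact (V \<inter> sphere 0 1)"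
      by (intro closed_Int_compact closed_subspace subspace_layer1 compact_sphere)
    then obtain w r where w: "w \<in> V \<inter> sphere 0 1" "strict_mono r" "(u \<circ> r) \<longlonglongrightarrow> w"
      using yu(2) unfolding compact_def by metis
    have "y \<longlonglongrightarrow> x"
      using yu(1) by (intro metric_tendsto_imp_tendsto[OF LIMSEQ_inverse_real_of_nat])
        (auto intro!: always_eventually less_imp_le simp: dist_real_def inverse_eq_divide)
    then have "(y \<circ> r) \<longlonglongrightarrow> x" using w(2) by (rule LIMSEQ_subseq_LIMSEQ)
    then have lim: "(\<lambda>n. (y (r n), u (r n))) \<longlonglongrightarrow> (x, w)"
      using w(3) by (intro tendsto_Pair) (auto simp: o_def)
    obtain T where T: "open T" "(x, w) \<in> T" "\<And>y u. (y, u) \<in> T \<Longrightarrow> u \<in> V \<Longrightarrow> norm u = 1 \<Longrightarrow> P y u"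
      using loc w(1) by blast
    have "eventually (\<lambda>n. (y (r n), u (r n)) \<in> T) sequentially"
      using topological_tendstoD[OF lim T(1,2)] .
    then obtain n where "(y (r n), u (r n)) \<in> T" by (auto simp: eventually_sequentially)
    with T(3) yu(2,3) show False by auto
  qed
  then obtain \<delta> where \<delta>: "\<delta> > 0" "\<And>y u. dist y x < \<delta> \<Longrightarrow> u \<in> V \<Longrightarrow> norm u = 1 \<Longrightarrow> P y u" by blast
  show thesis
  proof (rule that[OF \<delta>(1)])
    fix y v assume y: "dist y x < \<delta>" and v: "v \<in> hfiber G y"
    define w where "w = to_layer G y v"
    have w: "w \<in> V" "v = X w y" using v by (simp_all add: w_def hfiber_eq X_to_layer)
    show "frozen x v \<le> (1 + \<epsilon>) * \<psi> (y, v)"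
    proof (cases "w = 0")
      case True
      then have "v = 0" using w linear_0[OF linear_X] by simp
      then show ?thesis
        using frozen_scale[of x 0 0] \<Psi>_nonneg[of y w] \<Psi>_eq[OF v] \<open>\<epsilon> > 0\<close> by (simp add: w_def)
    next
      case False
      define u where "u = w /\<^sub>R norm w"
      have u: "u \<in> V" "norm u = 1" "w = norm w *\<^sub>R u"
        using False w subspace_scale[OF subspace_layer1] by (auto simp: u_def)
      have "frozen x (X w y) = norm w * frozen x (X u y)"
        using u(3) linear_cmul[OF linear_X, of "norm w" u y] frozen_scale[of x "norm w"] by simp
      also have "\<dots> \<le> norm w * ((1 + \<epsilon>) * \<Psi> y u)"
        using \<delta>(2)[OF y u(1,2)] by (intro mult_left_mono) (auto simp: P_def)
      also have "\<dots> = (1 + \<epsilon>) * \<Psi> y w"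
        using u(3) \<Psi>_scale[OF u(1), of y "norm w"] by simp
      finally show ?thesis
        unfolding \<Psi>_eq[OF v] w_def[symmetric] by (simp only: w(2)[symmetric])
    qed
  qed
qed

text \<open>The fields \<open>X b\<close> are bounded on the unit ball around \<open>x\<close>, and
  \<open>\<Psi>\<close> dominates \<open>k * norm w\<close>. The constant gives the price, in
  length, of moving a Euclidean distance away from \<open>x\<close>.\<close>

lemma norm_le_\<psi>:
  obtains C where "C > 0" "\<And>y v. dist y x \<le> 1 \<Longrightarrow> v \<in> hfiber G y \<Longrightarrow> norm v \<le> C * \<psi> (y, v)"
proof -
  obtain k where k: "k > 0" "\<And>x w. w \<in> V \<Longrightarrow> k * norm w \<le> \<Psi> x w" using \<Psi>_bounds by metis
  have "continuous_on UNIV (\<lambda>y. \<Sum>b\<in>Basis. norm (X b y))"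
    using X_differentiable
    by (intro continuous_intros continuous_at_imp_continuous_on ballI differentiable_imp_continuous_within)
  then have "bounded ((\<lambda>y. \<Sum>b\<in>Basis. norm (X b y)) ` cball x 1)"
    by (intro compact_imp_bounded compact_continuous_image) (auto intro: continuous_on_subset)
  then obtain B where B: "B > 0" "\<And>y. dist y x \<le> 1 \<Longrightarrow> norm (\<Sum>b\<in>Basis. norm (X b y)) \<le> B"
    by (auto simp: bounded_pos dist_commute)
  show thesis
  proof
    show "B / k > 0" using B k by simp
    fix y v assume y: "dist y x \<le> 1" and v: "v \<in> hfiber G y"
    define w where "w = to_layer G y v"
    have w: "w \<in> V" "v = X w y" using v by (simp_all add: w_def hfiber_eq X_to_layer)
    have "norm v = norm (\<Sum>b\<in>Basis. (w \<bullet> b) *\<^sub>R X b y)"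
      by (subst w(2), subst X_expand) (rule refl)
    also have "\<dots> \<le> (\<Sum>b\<in>Basis. norm w * norm (X b y))"
      by (intro sum_norm_le) (auto intro!: mult_right_mono Basis_le_norm)
    also have "\<dots> = norm w * (\<Sum>b\<in>Basis. norm (X b y))" by (simp add: sum_distrib_left)
    also have "\<dots> \<le> norm w * B" using B(2)[OF y] by (intro mult_left_mono) auto
    also have "\<dots> \<le> B / k * \<Psi> y w"
    proof -
      have "norm w \<le> \<Psi> y w / k" using k(2)[OF w(1), of y] k(1) by (simp add: pos_le_divide_eq mult.commute)
      from mult_right_mono[OF this less_imp_le[OF B(1)]] show ?thesis by (simp add: mult.commute)
    qed
    finally show "norm v \<le> B / k * \<psi> (y, v)" 
      unfolding \<Psi>_eq[OF v] w_def .
  qed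
qed

text \<open>The increment of the curve is the integral of its velocity, and sublinearity moves
  \<open>q\<close> inside. Used with \<open>q = frozen x\<close> up to time \<open>1\<close> and
  with \<open>q = norm\<close> up to the first exit from a ball; hence the bound on \<open>q\<close>
  is asked only strictly before \<open>s1\<close>.\<close>

lemma horizontal_curve_sublinear_bound:
  assumes \<gamma>: "horizontal_curve G 0 1 \<gamma>" and s1: "0 \<le> s1" "s1 \<le> 1" and "C > 0"
    and q: "\<And>s v. 0 \<le> s \<Longrightarrow> s < s1 \<Longrightarrow> v \<in> hfiber G (\<gamma> s) \<Longrightarrow> q v \<le> C * \<psi> (\<gamma> s, v)"
    and add: "\<And>x y. q (x + y) \<le> q x + q y" and scale: "\<And>c x. 0 \<le> c \<Longrightarrow> q (c *\<^sub>R x) = c * q x"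
    and cont: "continuous_on UNIV q"
  shows "ennreal (q (\<gamma> s1 - \<gamma> 0)) \<le>
    ennreal C * (\<integral>\<^sup>+t. ennreal (\<psi> (\<gamma> t, velocity 0 1 \<gamma> t)) \<partial>lebesgue_on {0..1})" (is "_ \<le> _ * ?I")
proof (cases "?I = \<infinity>")
  case True
  then show ?thesis using \<open>C > 0\<close> by (simp add: ennreal_mult_top)
next
  case False
  have ac: "absolutely_continuous_curve 0 1 \<gamma>"
    and AE: "AE t in lebesgue_on {0..1}. \<gamma> differentiable (at t within {0..1}) \<and> velocity 0 1 \<gamma> t \<in> hfiber G (\<gamma> t)"
    using \<gamma> by (auto simp: horizontal_curve_def)
  then have "AE t in lebesgue. t \<in> {0..1} \<longrightarrow> \<gamma> differentiable (at t within {0..1}) \<and> velocity 0 1 \<gamma> t \<in> hfiber G (\<gamma> t)"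
    by (subst (asm) AE_restrict_space_iff) auto
  then obtain N0 where N0: "N0 \<in> null_sets lebesgue"
      "{t. \<not> (t \<in> {0..1} \<longrightarrow> \<gamma> differentiable (at t within {0..1}) \<and> velocity 0 1 \<gamma> t \<in> hfiber G (\<gamma> t))} \<subseteq> N0"
    unfolding eventually_ae_filter by auto
  \<comment> \<open>\<open>s1\<close> joins the null set because the bound on \<open>q\<close> holds
    strictly before \<open>s1\<close>.\<close>
  define N where "N = insert s1 N0"
  have N: "negligible N" using N0(1) by (simp add: N_def negligible_iff_null_sets)
  have good: "(\<gamma> has_vector_derivative velocity 0 1 \<gamma> t) (at t within {0..1})" "velocity 0 1 \<gamma> t \<in> hfiber G (\<gamma> t)"
    if "t \<in> {0..s1} - N" for t
    using that N0(2) s1 by (auto simp: N_def vector_derivative_works[symmetric])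
  define g where "g t = (if t \<in> N then 0 else velocity 0 1 \<gamma> t)" for t
  have g: "(g has_integral \<gamma> s1 - \<gamma> 0) {0..s1}"
  proof (rule absolutely_continuous_curve_imp_has_integral[OF _ s1(1) N])
    show "absolutely_continuous_curve 0 s1 \<gamma>"
      using absolutely_continuous_curve_subinterval[OF ac] s1 by simp
    show "(\<gamma> has_vector_derivative g t) (at t within {0..s1})" if "t \<in> {0..s1} - N" for t
      using has_vector_derivative_within_subset[OF good(1)[OF that], of "{0..s1}"] that s1
      by (simp add: g_def)
  qed
  have q0: "q 0 = 0" using scale[of 0 0] by simp
  \<comment> \<open>The positive part is nonnegative and dominates \<open>q\<close> of the velocity.
    It is measurable through \<open>g\<close>, and monotonicity compares it with the integrand of
    \<open>\<psi>\<close> without measurability of the latter.\<close>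
  define h where "h t = max 0 (q (indicator {0..s1} t *\<^sub>R g t))" for t
  have h[measurable]: "h \<in> borel_measurable lebesgue"
  proof -
    have "(\<lambda>t. indicator {0..s1} t *\<^sub>R g t) \<in> borel_measurable lebesgue"
      using has_integral_implies_lebesgue_measurable[OF g] .
    moreover have "q \<in> borel_measurable borel" using cont by (rule borel_measurable_continuous_onI)
    ultimately show ?thesis unfolding h_def[abs_def] by measurable
  qed
  have "(\<integral>\<^sup>+t. ennreal (h t) \<partial>lebesgue) = (\<integral>\<^sup>+t. ennreal C * ennreal (h t / C) \<partial>lebesgue)"
    using \<open>C > 0\<close> by (intro nn_integral_cong) (simp add: ennreal_mult[symmetric] h_def)
  also have "\<dots> = ennreal C * (\<integral>\<^sup>+t. ennreal (h t / C) \<partial>lebesgue)"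
    by (rule nn_integral_cmult) measurable
  also have "(\<integral>\<^sup>+t. ennreal (h t / C) \<partial>lebesgue) \<le>
      (\<integral>\<^sup>+t. ennreal (\<psi> (\<gamma> t, velocity 0 1 \<gamma> t)) * indicator {0..1} t \<partial>lebesgue)"
  proof (rule nn_integral_mono)
    fix t
    show "ennreal (h t / C) \<le> ennreal (\<psi> (\<gamma> t, velocity 0 1 \<gamma> t)) * indicator {0..1} t"
    proof (cases "t \<in> {0..s1} - N")
      case True
      then have "t < s1" "t \<in> {0..1}" using s1 by (auto simp: N_def)
      have "q (velocity 0 1 \<gamma> t) \<le> C * \<psi> (\<gamma> t, velocity 0 1 \<gamma> t)"
        using q[OF _ \<open>t < s1\<close> good(2)[OF True]] True by simp
      moreover have "0 \<le> \<psi> (\<gamma> t, velocity 0 1 \<gamma> t)"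
        using \<Psi>_eq[OF good(2)[OF True]] \<Psi>_nonneg by simp
      ultimately have "h t \<le> C * \<psi> (\<gamma> t, velocity 0 1 \<gamma> t)"
        using True \<open>C > 0\<close> by (simp add: h_def g_def)
      then have "h t / C \<le> \<psi> (\<gamma> t, velocity 0 1 \<gamma> t)"
        using \<open>C > 0\<close> by (simp add: pos_divide_le_eq mult.commute)
      then show ?thesis using \<open>t \<in> {0..1}\<close> by (simp add: ennreal_leI)
    next
      case False
      then have "h t = 0" by (auto simp: h_def g_def q0 indicator_def)
      then show ?thesis by simp
    qed
  qed
  also have "\<dots> = ?I" by (simp add: nn_integral_restrict_space)
  finally have le: "(\<integral>\<^sup>+t. ennreal (h t) \<partial>lebesgue) \<le> ennreal C * ?I"
    by (simp add: mult_left_mono)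
  then have "(\<integral>\<^sup>+t. ennreal (h t) \<partial>lebesgue) < \<infinity>"
    using False by (simp add: ennreal_mult_less_top le_less_trans less_top)
  then obtain J where J: "J \<ge> 0" "(\<integral>\<^sup>+t. ennreal (h t) \<partial>lebesgue) = ennreal J"
    by (metis ennreal_cases infinity_ennreal_def less_irrefl)
  have "(h has_integral J) UNIV"
    using J h by (subst has_integral_iff_nn_integral_lebesgue) (auto simp: h_def)
  moreover have "h = (\<lambda>t. if t \<in> {0..s1} then h t else 0)" by (auto simp: h_def q0 fun_eq_iff)
  ultimately have "((\<lambda>t. if t \<in> {0..s1} then h t else 0) has_integral J) UNIV" by simp
  then have "(h has_integral J) {0..s1}" by (simp only: has_integral_restrict_UNIV)
  from sublinear_has_integral_le[OF g this _ add scale cont]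
  have "q (\<gamma> s1 - \<gamma> 0) \<le> J" by (auto simp: h_def)
  then have "ennreal (q (\<gamma> s1 - \<gamma> 0)) \<le> ennreal J" by (rule ennreal_leI)
  then show ?thesis using J(2) le by simp
qed

theorem lsc_metric_derivative_ge:
  assumes lsc: "lower_semicontinuous_map (hbundle_topology G) \<psi>" and w: "w \<in> V"
  shows "ennreal (\<Psi> x w) \<le> metric_derivative G (intrinsic_distance G \<psi>) (x, X w x)"
proof (rule metric_derivative_ge)
  fix e :: real assume "e > 0"
  define p where "p = \<Psi> x w"
  have "p \<ge> 0" by (simp add: p_def \<Psi>_nonneg)
  \<comment> \<open>Small enough that \<open>p - e / 2\<close> divided by
    \<open>1 + \<epsilon>\<close> is still at least \<open>p - e\<close>; \<open>p + 1\<close>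
    covers \<open>p = 0\<close>.\<close>
  define \<epsilon> where "\<epsilon> = e / (2 * (p + 1))"
  have "\<epsilon> > 0" using \<open>e > 0\<close> \<open>p \<ge> 0\<close> by (simp add: \<epsilon>_def)
  have \<epsilon>p: "(1 + \<epsilon>) * (p - e) \<le> p - e / 2"
  proof -
    have "\<epsilon> * p \<le> \<epsilon> * (p + 1)" using \<open>\<epsilon> > 0\<close> by simp
    also have "\<dots> = e / 2" using \<open>p \<ge> 0\<close> by (simp add: \<epsilon>_def field_simps)
    finally have "\<epsilon> * p \<le> e / 2" .
    moreover have "\<epsilon> * e \<ge> 0" using \<open>\<epsilon> > 0\<close> \<open>e > 0\<close> by simp
    ultimately show ?thesis by (simp add: algebra_simps)
  qed
  obtain \<delta> where \<delta>: "\<delta> > 0"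
    "\<And>y v. dist y x < \<delta> \<Longrightarrow> v \<in> hfiber G y \<Longrightarrow> frozen x v \<le> (1 + \<epsilon>) * \<psi> (y, v)"
    using lsc_frozen_le[OF lsc \<open>\<epsilon> > 0\<close>] by blast
  obtain C where C: "C > 0" "\<And>y v. dist y x \<le> 1 \<Longrightarrow> v \<in> hfiber G y \<Longrightarrow> norm v \<le> C * \<psi> (y, v)"
    using norm_le_\<psi> by blast
  define r where "r = min \<delta> 1"
  have "r > 0" using \<delta>(1) by (simp add: r_def)
  \<comment> \<open>Either the curve stays in the ball of radius \<open>r\<close>, and the
    comparison with \<open>frozen x\<close> applies to all of it, or it leaves the ball and has
    length at least \<open>r / C\<close>.\<close>
  have bound: "ennreal (min (frozen x (y - x) / (1 + \<epsilon>)) (r / C)) \<le> intrinsic_distance G \<psi> x y" for y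
    unfolding intrinsic_distance_def
  proof (rule INF_greatest)
    fix \<gamma> assume "\<gamma> \<in> {\<gamma>. horizontal_curve G 0 1 \<gamma> \<and> \<gamma> 0 = x \<and> \<gamma> 1 = y}"
    then have \<gamma>: "horizontal_curve G 0 1 \<gamma>" "\<gamma> 0 = x" "\<gamma> 1 = y" by auto
    define I where "I = (\<integral>\<^sup>+t. ennreal (\<psi> (\<gamma> t, velocity 0 1 \<gamma> t)) \<partial>lebesgue_on {0..1})"
    have div: "ennreal (a / c) \<le> I" if "ennreal a \<le> ennreal c * I" "c > 0" for a c :: real
    proof (cases "a \<ge> 0")
      case True
      have "ennreal c * ennreal (a / c) \<le> ennreal c * I"
        using that True by (simp add: ennreal_mult[symmetric])
      then show ?thesis using that(2) by (simp add: ennreal_mult_le_mult_iff)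
    next
      case False
      then have "a / c \<le> 0" using that(2) by (simp add: divide_le_0_iff)
      then show ?thesis by (simp add: ennreal_neg)
    qed
    have contg: "continuous_on {0..1} \<gamma>"
      using \<gamma>(1) by (intro absolutely_continuous_curve_continuous_on) (simp add: horizontal_curve_def)
    show "ennreal (min (frozen x (y - x) / (1 + \<epsilon>)) (r / C)) \<le> I"
    proof (cases "\<forall>s\<in>{0..1}. dist (\<gamma> s) x < r")
      case True
      have "ennreal (frozen x (\<gamma> 1 - \<gamma> 0)) \<le> ennreal (1 + \<epsilon>) * I"
        unfolding I_def
        by (rule horizontal_curve_sublinear_bound[OF \<gamma>(1)])
          (use True \<delta>(2) \<open>\<epsilon> > 0\<close> in \<open>auto simp: frozen_add frozen_scale frozen_continuous r_def\<close>)
      then have "ennreal (frozen x (y - x) / (1 + \<epsilon>)) \<le> I" using \<gamma> \<open>\<epsilon> > 0\<close> by (intro div) auto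
      then show ?thesis by (rule order_trans[rotated]) (simp add: ennreal_leI)
    next
      case False
      \<comment> \<open>\<open>Inf E\<close> is the first exit time: attained because
        \<open>E\<close> is closed, so the curve is in the open ball strictly before it and at
        distance at least \<open>r\<close> at it.\<close>
      define E where "E = {s \<in> {0..1}. r \<le> dist (\<gamma> s) x}"
      have "closed ({0..1} \<inter> (\<lambda>s. dist (\<gamma> s) x) -` {r..})"
        by (intro continuous_closed_preimage continuous_intros contg)
      moreover have "E = {0..1} \<inter> (\<lambda>s. dist (\<gamma> s) x) -` {r..}" by (auto simp: E_def)
      ultimately have "closed E" by simp
      moreover have "E \<subseteq> {0..1}" "E \<noteq> {}" using False by (auto simp: E_def not_less)
      moreover from this(1) have bdd: "bdd_below E" by (intro bdd_belowI[of _ 0]) auto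
      ultimately have "Inf E \<in> E" by (intro closed_contains_Inf)
      then have s1: "0 \<le> Inf E" "Inf E \<le> 1" "r \<le> dist (\<gamma> (Inf E)) x" by (auto simp: E_def)
      have before: "dist (\<gamma> s) x < r" if "0 \<le> s" "s < Inf E" for s
      proof (rule ccontr)
        assume "\<not> ?thesis"
        then have "s \<in> E" using that s1 by (auto simp: E_def)
        then have "Inf E \<le> s" using bdd by (rule cInf_lower)
        then show False using that by simp
      qed
      have "ennreal (norm (\<gamma> (Inf E) - \<gamma> 0)) \<le> ennreal C * I"
        unfolding I_def
      proof (rule horizontal_curve_sublinear_bound[OF \<gamma>(1) s1(1,2) C(1)])
        show "norm v \<le> C * \<psi> (\<gamma> s, v)" if "0 \<le> s" "s < Inf E" "v \<in> hfiber G (\<gamma> s)" for s v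
          using before[OF that(1,2)] that(3) by (intro C(2)) (auto simp: r_def)
      qed (auto simp: norm_triangle_ineq intro!: continuous_intros)
      then have "ennreal (norm (\<gamma> (Inf E) - \<gamma> 0) / C) \<le> I" using C(1) by (rule div)
      moreover have "min (frozen x (y - x) / (1 + \<epsilon>)) (r / C) \<le> norm (\<gamma> (Inf E) - \<gamma> 0) / C"
        using s1(3) \<gamma>(2) C(1) by (intro min.coboundedI2) (auto simp: dist_norm divide_right_mono)
      ultimately show ?thesis by (meson ennreal_leI order_trans)
    qed
  qed
  have "(\<lambda>t. (x \<odot> (t *\<^sub>R w) - x) /\<^sub>R t) \<midarrow>0\<rightarrow> X w x"
  proof -
    have "((\<lambda>t. x \<odot> (t *\<^sub>R w) - x) has_vector_derivative X w x - 0) (at 0)"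
      using has_vector_derivative_diff[OF line_has_vector_derivative[of x w 0 UNIV] has_vector_derivative_const[of x]] by simp
    then show ?thesis by (subst (asm) has_vector_derivative_zero_iff) auto
  qed
  then have "(\<lambda>t. frozen x ((x \<odot> (t *\<^sub>R w) - x) /\<^sub>R t)) \<midarrow>0\<rightarrow> frozen x (X w x)"
    using continuous_on_tendsto_compose[OF frozen_continuous] by fastforce
  then have ev1: "eventually (\<lambda>t. p - e / 2 < frozen x ((x \<odot> (t *\<^sub>R w) - x) /\<^sub>R t)) (at 0)"
    using \<open>e > 0\<close> by (intro order_tendstoD(1)) (auto simp: frozen_X[OF w] p_def)
  \<comment> \<open>For small \<open>t\<close> the price \<open>r / C\<close> of escaping exceeds
    the target, so the second entry of the minimum in \<open>bound\<close> does no harm.\<close>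
  have ev2: "eventually (\<lambda>t. \<bar>t\<bar> * (p - e) < r / C) (at 0)"
  proof (rule order_tendstoD(2))
    show "((\<lambda>t. \<bar>t\<bar> * (p - e)) \<longlongrightarrow> \<bar>0\<bar> * (p - e)) (at 0)" by (intro tendsto_intros)
  qed (use \<open>r > 0\<close> C in simp)
  have ev3: "eventually (\<lambda>t::real. t \<noteq> 0) (at 0)" by (simp add: eventually_at_filter)
  from ev1 ev2 ev3
  have "eventually (\<lambda>t. ennreal (\<bar>t\<bar> * (p - e)) \<le> intrinsic_distance G \<psi> x (x \<odot> (t *\<^sub>R w))) (at 0)"
  proof eventually_elim
    case (elim t)
    define z where "z = x \<odot> (t *\<^sub>R w) - x"
    have "frozen x z = \<bar>t\<bar> * frozen x (z /\<^sub>R t)"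
      using elim(3) frozen_scale[of x t "z /\<^sub>R t"] by simp
    moreover have "\<bar>t\<bar> * (p - e / 2) \<le> \<bar>t\<bar> * frozen x (z /\<^sub>R t)"
      using elim(1) by (intro mult_left_mono) (auto simp: z_def)
    moreover have "\<bar>t\<bar> * ((1 + \<epsilon>) * (p - e)) \<le> \<bar>t\<bar> * (p - e / 2)"
      using \<epsilon>p by (intro mult_left_mono) auto
    ultimately have "\<bar>t\<bar> * (p - e) \<le> frozen x z / (1 + \<epsilon>)"
      using \<open>\<epsilon> > 0\<close> by (simp add: pos_le_divide_eq add_pos_pos mult_ac)
    then have "ennreal (\<bar>t\<bar> * (p - e)) \<le> ennreal (min (frozen x z / (1 + \<epsilon>)) (r / C))"
      using elim(2) by (intro ennreal_leI) simp
    also have "\<dots> \<le> intrinsic_distance G \<psi> x (x \<odot> (t *\<^sub>R w))" unfolding z_def by (rule bound)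
    finally show ?case .
  qed
  then show "eventually (\<lambda>t. ennreal (\<bar>t\<bar> * (\<Psi> x w - e)) \<le>
      intrinsic_distance G \<psi> x (x \<odot> (t *\<^sub>R to_layer G x (X w x)))) (at 0)"
    by (simp add: p_def to_layer_X)
qed

end

theorem theorem5p9:
  fixes G :: "'a::euclidean_space carnot"
    and \<alpha> :: real
    and \<psi> :: "'a \<times> 'a \<Rightarrow> real"
  assumes "carnot_group G"
    and "\<alpha> \<ge> 1"
    and "subfinsler_convex G \<alpha> \<psi>"
  shows "(AE x in lebesgue. \<forall>v\<in>hfiber G x.
            metric_derivative G (intrinsic_distance G \<psi>) (x, v) \<le> ennreal (\<psi> (x, v)))
    \<and> (upper_semicontinuous_map (hbundle_topology G) \<psi> \<longrightarrow>
         (\<forall>(x, v)\<in>hbundle G.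
            metric_derivative G (intrinsic_distance G \<psi>) (x, v) \<le> ennreal (\<psi> (x, v))))
    \<and> (lower_semicontinuous_map (hbundle_topology G) \<psi> \<longrightarrow>
         (\<forall>(x, v)\<in>hbundle G.
            metric_derivative G (intrinsic_distance G \<psi>) (x, v) \<ge> ennreal (\<psi> (x, v)))
       \<and> (AE x in lebesgue. \<forall>v\<in>hfiber G x.
            metric_derivative G (intrinsic_distance G \<psi>) (x, v) = ennreal (\<psi> (x, v))))"
proof -
  interpret subfinsler G \<alpha> \<psi>
    using assms by (simp add: subfinsler_def subfinsler_axioms_def)
  have to_\<Psi>: "to_layer G x v \<in> V" "X (to_layer G x v) x = v" "\<psi> (x, v) = \<Psi> x (to_layer G x v)"
    if "v \<in> hfiber G x" for x v
    using that by (auto simp: hfiber_eq X_to_layer \<Psi>_eq)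
  have up: "metric_derivative G (intrinsic_distance G \<psi>) (x, v) \<le> ennreal (\<psi> (x, v))"
    if "upper_semicontinuous_map (hbundle_topology G) \<psi>" "v \<in> hfiber G x" for x v
    using usc_metric_derivative_le[OF that(1) to_\<Psi>(1)[OF that(2)], of x] to_\<Psi>[OF that(2)] by simp
  have low: "metric_derivative G (intrinsic_distance G \<psi>) (x, v) \<ge> ennreal (\<psi> (x, v))"
    if "lower_semicontinuous_map (hbundle_topology G) \<psi>" "v \<in> hfiber G x" for x v
    using lsc_metric_derivative_ge[OF that(1) to_\<Psi>(1)[OF that(2)], of x] to_\<Psi>[OF that(2)] by simp
  have "AE x in lebesgue. \<forall>v\<in>hfiber G x. metric_derivative G (intrinsic_distance G \<psi>) (x, v) = ennreal (\<psi> (x, v))"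
    if "lower_semicontinuous_map (hbundle_topology G) \<psi>"
    using AE_metric_derivative_le by eventually_elim (use low[OF that] in \<open>auto intro: antisym\<close>)
  then show ?thesis
    using AE_metric_derivative_le up low by (auto simp: hbundle_def)
qed

end
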